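(* Let $r \colon \mathbb{N} \to \mathbb{N}$ be a function satisfying $2 \leq r(n) \leq \log n / (121 \log \log n)$ for all sufficiently large $n$. Then almost all $K_{r+1}$-free subgraphs of $K_n$ are $r$-partite (where $r = r(n)$); that is, the ratio of the number of $r(n)$-partite subgraphs of $K_n$ to the number of $K_{r(n)+1}$-free subgraphs of $K_n$ tends to $1$ as $n \to \infty$.
   Context: $K_n$ is the complete graph on the (labelled) vertex set $\{1,\dotsc,n\}$; subgraphs of $K_n$ are taken to be spanning, i.e. identified with subsets of $E(K_n)$. A graph is $K_{r+1}$-free if it does not contain $K_{r+1}$ as a subgraph. A graph is $r$-partite if its vertices can be properly coloured with $r$ colours. $\log$ is the natural logarithm. *)

theory Defs
  imports Complex_Main "HOL-Library.Ramsey"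
begin

text \<open>
  Graphs on the labelled vertex set \<open>{1..n}\<close> are represented by their edge sets,
  an edge being a two-element set of vertices.
\<close>

definition complete_edges :: "nat \<Rightarrow> nat set set" where
  "complete_edges n = [{1..n}]\<^bsup>2\<^esup>"

text \<open>A copy of the complete graph on \<open>k\<close> vertices is a set of \<open>k\<close> pairwise adjacent
  vertices.\<close>

definition clique_free :: "nat \<Rightarrow> nat \<Rightarrow> nat set set \<Rightarrow> bool" where
  "clique_free n k E \<longleftrightarrow> \<not> (\<exists>S \<subseteq> {1..n}. card S = k \<and> clique S E)"

text \<open>Colour classes may be empty.\<close>

definition partite :: "nat \<Rightarrow> nat \<Rightarrow> nat set set \<Rightarrow> bool" where
  "partite n k E \<longleftrightarrow>
     (\<exists>c. c ` {1..n} \<subseteq> {..<k} \<and>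
       (\<forall>u\<in>{1..n}. \<forall>v\<in>{1..n}. {u, v} \<in> E \<longrightarrow> c u \<noteq> (c v :: nat)))"

definition clique_free_graphs :: "nat \<Rightarrow> nat \<Rightarrow> nat set set set" where
  "clique_free_graphs n k = {E. E \<subseteq> complete_edges n \<and> clique_free n k E}"

definition partite_graphs :: "nat \<Rightarrow> nat \<Rightarrow> nat set set set" where
  "partite_graphs n k = {E. E \<subseteq> complete_edges n \<and> partite n k E}"

end

theory Submission
  imports Defs
begin

text \<open>
  Every \<open>r\<close>-partite graph is \<open>K\<^sub>r\<^sub>+\<^sub>1\<close>-free, so it has to be shown that the \<open>K\<^sub>r\<^sub>+\<^sub>1\<close>-free graphs that are
  not \<open>r\<close>-partite are few. Let \<open>L = ln n\<close>; the bound on \<open>r\<close> says \<open>L ^ (121 * r) \<le> n\<close>, so that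
  \<open>L ^ (C * r)\<close> is a small power of \<open>n\<close> for every moderate constant \<open>C\<close>.

  \<^bold>\<open>Rough structure.\<close> All \<open>K\<^sub>r\<^sub>+\<^sub>1\<close>-free graphs are covered by few containers, that is, graphs which
  themselves almost behave as if they were \<open>K\<^sub>r\<^sub>+\<^sub>1\<close>-free (\<open>clique_free_containers\<close>). The containers
  come from a decision tree controlled by the partition function of a hard-core model on the edges
  (\<open>container_tree\<close>); its leaves \<open>(C, S)\<close> are saturated, which means that in the hard-core measure on
  \<open>C\<close> every edge appears almost as often as in a \<open>p\<close>-random subset. By Harris' inequality a
  \<open>p\<close>-random subgraph of \<open>C\<close> can then be made \<open>K\<^sub>r\<^sub>+\<^sub>1\<close>-free by deleting a tiny proportion of its edges.
  A second moment computation (\<open>saturated_second_moment\<close>) shows that this is impossible if \<open>C\<close> has a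
  well spread family of \<open>(r + 1)\<close>-cliques. The density \<open>p\<close> is a negative power of \<open>L\<close>, and the second
  moment needs \<open>p ^ (- r)\<close> to stay below \<open>n\<close>: this is where \<open>r\<close> must be of order at most
  \<open>L / ln L\<close>.

  Such a family would arise by picking the vertices of a clique one after another among those of
  largest degree in the common neighbourhood of the previous ones. So this procedure has to run out
  of vertices after \<open>r\<close> steps, and the sets of vertices it discards in each step form an
  \<open>r\<close>-colouring with few monochromatic edges, unless \<open>C\<close> has substantially fewer edges than the Turan
  graph (\<open>stability\<close>). Hence there are not many more than \<open>2 powr ((1 - 1 / r) * n\<^sup>2 / 2)\<close> graphs
  without \<open>K\<^sub>r\<^sub>+\<^sub>1\<close>, and all but a negligible part of them have an \<open>r\<close>-colouring with at most
  \<open>n\<^sup>2 / L ^ 16\<close> monochromatic edges (\<open>card_clique_free_le\<close>, \<open>card_far_from_partite_le\<close>).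

  \<^bold>\<open>Exact structure.\<close> Fix for each such graph a colouring with the fewest monochromatic edges. The
  count of \<open>K\<^sub>r\<close>-free graphs, applied to subsets of the vertices, shows that almost always the edges
  between the classes are rich: any large parts of all the classes contain a transversal \<open>K\<^sub>r\<close>
  (\<open>card_not_rich_le\<close>). In a rich graph a monochromatic edge \<open>{u, v}\<close> is expensive. Its ends must
  have a small common neighbourhood in some other class, as otherwise richness would extend them to a
  \<open>K\<^sub>r\<^sub>+\<^sub>1\<close> (\<open>rich_mono_edge_codegree\<close>), and this costs a factor \<open>3 / 4\<close> for each vertex of that class.
  A matching of monochromatic edges makes these costs independent, so that they outweigh the number
  of ways to choose the monochromatic edges (\<open>card_defective_graphs_le\<close>). Finally a rich \<open>r\<close>-partite
  graph has few \<open>r\<close>-colourings, since two of them differ by a permutation of the colours and a few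
  vertices (\<open>rich_coloring_unique\<close>); so the sum over all colourings is comparable with the number of
  \<open>r\<close>-partite graphs (\<open>sum_balanced_colorings_le\<close>).
\<close>

section \<open>Sums over random subsets\<close>

definition wsum :: "real \<Rightarrow> 'a set \<Rightarrow> ('a set \<Rightarrow> real) \<Rightarrow> real" where
  "wsum l C f = (\<Sum>R\<in>Pow C. l ^ card R * f R)"

lemma wsum_empty [simp]: "wsum l {} f = f {}"
  by (simp add: wsum_def)

lemma wsum_insert:
  assumes "finite C" "v \<notin> C"
  shows "wsum l (insert v C) f = wsum l C f + l * wsum l C (\<lambda>R. f (insert v R))"
proof -
  have "wsum l (insert v C) f
      = wsum l C f + (\<Sum>R\<in>insert v ` Pow C. l ^ card R * f R)"
    unfolding wsum_def Pow_insert using assms by (intro sum.union_disjoint) auto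
  also have "(\<Sum>R\<in>insert v ` Pow C. l ^ card R * f R)
      = (\<Sum>R\<in>Pow C. l ^ card (insert v R) * f (insert v R))"
    using assms by (subst sum.reindex) (auto simp: inj_on_def)
  also have "\<dots> = l * wsum l C (\<lambda>R. f (insert v R))"
    unfolding wsum_def sum_distrib_left
  proof (rule sum.cong, simp)
    fix R assume "R \<in> Pow C"
    then have "finite R" "v \<notin> R" using assms finite_subset by auto
    then show "l ^ card (insert v R) * f (insert v R) = l * (l ^ card R * f (insert v R))"
      by simp
  qed
  finally show ?thesis .
qed

lemma wsum_mono:
  assumes "0 \<le> l" "\<And>R. R \<subseteq> C \<Longrightarrow> f R \<le> g R"
  shows "wsum l C f \<le> wsum l C g"
  unfolding wsum_def using assms by (intro sum_mono mult_left_mono) auto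

lemma wsum_cong:
  assumes "\<And>R. R \<subseteq> C \<Longrightarrow> f R = g R"
  shows "wsum l C f = wsum l C g"
  unfolding wsum_def using assms by (intro sum.cong) auto

lemma wsum_add: "wsum l C (\<lambda>R. f R + g R) = wsum l C f + wsum l C g"
  by (simp add: wsum_def sum.distrib algebra_simps)

lemma wsum_diff: "wsum l C (\<lambda>R. f R - g R) = wsum l C f - wsum l C g"
  by (simp add: wsum_def sum_subtractf algebra_simps)

lemma wsum_cmult: "wsum l C (\<lambda>R. a * f R) = a * wsum l C f"
  by (simp add: wsum_def sum_distrib_left algebra_simps)

lemma wsum_sum: "wsum l C (\<lambda>R. \<Sum>x\<in>A. f x R) = (\<Sum>x\<in>A. wsum l C (f x))"
  unfolding wsum_def by (subst sum.swap) (simp add: sum_distrib_left)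

lemma wsum_one:
  assumes "finite C"
  shows "wsum l C (\<lambda>_. 1) = (1 + l) ^ card C"
  using assms by induction (simp_all add: wsum_insert algebra_simps)

lemma wsum_ge_empty:
  assumes "finite C" "0 \<le> l" "\<And>R. R \<subseteq> C \<Longrightarrow> 0 \<le> f R"
  shows "f {} \<le> wsum l C f"
  unfolding wsum_def using assms
  by (intro order.trans[OF _ member_le_sum[of "{}"]]) (auto intro!: mult_nonneg_nonneg)

lemma wsum_nonneg:
  assumes "0 \<le> l" "\<And>R. R \<subseteq> C \<Longrightarrow> 0 \<le> f R"
  shows "0 \<le> wsum l C f"
  unfolding wsum_def using assms by (intro sum_nonneg) auto

text \<open>The normalising factor is \<^term>\<open>(1 + l) ^ card C\<close>, so this says that a random set in which
  every element appears independently with probability \<open>l / (1 + l)\<close> contains \<open>K\<close> with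
  probability \<open>(l / (1 + l)) ^ card K\<close>.\<close>

lemma wsum_superset:
  assumes "finite C" "K \<subseteq> C"
  shows "wsum l C (\<lambda>R. of_bool (K \<subseteq> R)) * (1 + l) ^ card K = l ^ card K * (1 + l) ^ card C"
  using assms
proof (induction C arbitrary: K)
  case (insert v C)
  show ?case
  proof (cases "v \<in> K")
    case True
    define K' where "K' = K - {v}"
    have K': "K = insert v K'" "v \<notin> K'" "K' \<subseteq> C" "finite K'"
      using True insert.prems insert.hyps by (auto simp: K'_def intro: finite_subset)
    have "wsum l C (\<lambda>R. of_bool (K \<subseteq> R)) = wsum l C (\<lambda>R. 0 * 0)"
      using insert.hyps True by (intro wsum_cong) auto
    then have 1: "wsum l C (\<lambda>R. of_bool (K \<subseteq> R)) = 0" by (subst (asm) wsum_cmult) simp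
    have 2: "wsum l C (\<lambda>R. of_bool (K \<subseteq> insert v R)) = wsum l C (\<lambda>R. of_bool (K' \<subseteq> R))"
      using K' by (intro wsum_cong) auto
    have "wsum l (insert v C) (\<lambda>R. of_bool (K \<subseteq> R)) = l * wsum l C (\<lambda>R. of_bool (K' \<subseteq> R))"
      by (simp only: wsum_insert[OF insert.hyps(1,2)] 1 2 add_0)
    moreover have "card K = Suc (card K')" "card (insert v C) = Suc (card C)"
      using K' insert.hyps by auto
    ultimately show ?thesis
      using insert.IH[OF K'(3)] by (simp add: mult_ac)
  next
    case False
    then have K: "K \<subseteq> C" using insert.prems by auto
    have 2: "wsum l C (\<lambda>R. of_bool (K \<subseteq> insert v R)) = wsum l C (\<lambda>R. of_bool (K \<subseteq> R))"
      using False by (intro wsum_cong) auto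
    show ?thesis
      using insert.IH[OF K] insert.hyps by (simp add: wsum_insert 2 algebra_simps)
  qed
qed auto

text \<open>Harris' inequality. In the induction step the two halves of the cube contribute the
  product \<open>(f\<^sub>0 - f\<^sub>1) * (g\<^sub>1 - g\<^sub>0)\<close> of two nonnegative increments.\<close>

lemma wsum_Harris:
  assumes "finite C" "0 \<le> l"
    and "\<And>R R'. R \<subseteq> R' \<Longrightarrow> R' \<subseteq> C \<Longrightarrow> f R' \<le> f R"
    and "\<And>R R'. R \<subseteq> R' \<Longrightarrow> R' \<subseteq> C \<Longrightarrow> g R \<le> g R'"
  shows "wsum l C (\<lambda>R. f R * g R) * (1 + l) ^ card C \<le> wsum l C f * wsum l C g"
  using assms(1,3,4)
proof (induction C arbitrary: f g)
  case (insert v C)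
  define F0 F1 G0 G1 where "F0 = wsum l C f" and "F1 = wsum l C (\<lambda>R. f (insert v R))"
    and "G0 = wsum l C g" and "G1 = wsum l C (\<lambda>R. g (insert v R))"
  define H0 H1 where "H0 = wsum l C (\<lambda>R. f R * g R) * (1 + l) ^ card C"
    and "H1 = wsum l C (\<lambda>R. f (insert v R) * g (insert v R)) * (1 + l) ^ card C"
  have h0: "H0 \<le> F0 * G0"
    unfolding H0_def F0_def G0_def
    by (rule insert.IH; rule insert.prems; simp add: subset_insertI2)
  have h1: "H1 \<le> F1 * G1"
    unfolding H1_def F1_def G1_def
    by (rule insert.IH; rule insert.prems; simp add: subset_insertI2 insert_mono)
  have F: "F1 \<le> F0" unfolding F0_def F1_def
    by (rule wsum_mono[OF assms(2)]; rule insert.prems) auto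
  have G: "G0 \<le> G1" unfolding G0_def G1_def
    by (rule wsum_mono[OF assms(2)]; rule insert.prems) auto
  have "wsum l (insert v C) (\<lambda>R. f R * g R) * (1 + l) ^ card (insert v C)
      = (1 + l) * (H0 + l * H1)"
    using insert.hyps by (simp add: wsum_insert H0_def H1_def algebra_simps)
  also have "\<dots> \<le> (1 + l) * (F0 * G0 + l * (F1 * G1))"
    using h0 h1 assms(2) by (intro mult_left_mono add_mono) auto
  also have "\<dots> = (F0 + l * F1) * (G0 + l * G1) - l * ((F0 - F1) * (G1 - G0))"
    by (simp add: algebra_simps)
  also have "\<dots> \<le> (F0 + l * F1) * (G0 + l * G1)"
    using F G assms(2) by simp
  also have "\<dots> = wsum l (insert v C) f * wsum l (insert v C) g"
    using insert.hyps by (simp add: wsum_insert F0_def F1_def G0_def G1_def)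
  finally show ?case .
qed simp

section \<open>Containers for a decreasing family\<close>

text \<open>The partition function of the hard-core model with activity \<open>l\<close>: the total weight of the
  subsets of \<open>C\<close> that are independent together with \<open>S\<close>.\<close>

definition hardcore :: "('a set \<Rightarrow> bool) \<Rightarrow> real \<Rightarrow> 'a set \<Rightarrow> 'a set \<Rightarrow> real" where
  "hardcore I l C S = wsum l C (\<lambda>R. of_bool (I (R \<union> S)))"

lemma hardcore_remove:
  assumes "finite C" "v \<in> C"
  shows "hardcore I l C S = hardcore I l (C - {v}) S + l * hardcore I l (C - {v}) (insert v S)"
proof -
  have "hardcore I l C S = hardcore I l (insert v (C - {v})) S"
    using assms by (simp add: insert_absorb)
  also have "\<dots> = hardcore I l (C - {v}) S
      + l * wsum l (C - {v}) (\<lambda>R. of_bool (I (insert v R \<union> S)))"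
    unfolding hardcore_def using assms by (subst wsum_insert) auto
  also have "wsum l (C - {v}) (\<lambda>R. of_bool (I (insert v R \<union> S))) = hardcore I l (C - {v}) (insert v S)"
    unfolding hardcore_def by simp
  finally show ?thesis .
qed

lemma hardcore_nonneg: "0 \<le> l \<Longrightarrow> 0 \<le> hardcore I l C S"
  unfolding hardcore_def by (rule wsum_nonneg) auto

lemma hardcore_ge_1:
  assumes "finite C" "0 \<le> l" "I S"
  shows "1 \<le> hardcore I l C S"
  using wsum_ge_empty[of C l "\<lambda>R. of_bool (I (R \<union> S))"] assms by (simp add: hardcore_def)

lemma hardcore_le:
  assumes "finite C" "0 \<le> l"
  shows "hardcore I l C S \<le> (1 + l) ^ card C"
  unfolding hardcore_def wsum_one[OF assms(1), symmetric]
  using assms by (intro wsum_mono) auto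

text \<open>A random independent subset of \<open>C - {v}\<close>, drawn from the hard-core measure, can be enlarged by
  \<open>v\<close> with probability at least \<open>1 - d\<close>.\<close>

definition saturated :: "('a set \<Rightarrow> bool) \<Rightarrow> real \<Rightarrow> real \<Rightarrow> 'a set \<Rightarrow> 'a set \<Rightarrow> bool" where
  "saturated I l d C S \<longleftrightarrow>
    (\<forall>v\<in>C. (1 - d) * hardcore I l (C - {v}) S \<le> hardcore I l (C - {v}) (insert v S))"

text \<open>The last inequality bounds the size of \<open>S'\<close>, because \<^term>\<open>hardcore I l C S\<close> is at most
  \<^term>\<open>(1 + l) ^ card C\<close>.\<close>

definition container_family ::
  "('a set \<Rightarrow> bool) \<Rightarrow> real \<Rightarrow> real \<Rightarrow> 'a set \<Rightarrow> 'a set \<Rightarrow> ('a set \<times> 'a set) set \<Rightarrow> bool" where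
  "container_family I l d C S F \<longleftrightarrow> finite F \<and>
     (\<forall>J. I J \<and> S \<subseteq> J \<and> J \<subseteq> C \<union> S \<longrightarrow> (\<exists>C' S'. (C', S') \<in> F \<and> J \<subseteq> C' \<union> S')) \<and>
     (\<forall>C' S'. (C', S') \<in> F \<longrightarrow> saturated I l d C' S' \<and> C' \<subseteq> C \<and> S \<subseteq> S' \<and> S' \<subseteq> C \<union> S \<and> I S' \<and>
        1 \<le> (1 - d) ^ (card S' - card S) * hardcore I l C S)"

lemma container_familyD:
  assumes "container_family I l d C S F"
  shows "finite F"
    and "I J \<Longrightarrow> S \<subseteq> J \<Longrightarrow> J \<subseteq> C \<union> S \<Longrightarrow> \<exists>C' S'. (C', S') \<in> F \<and> J \<subseteq> C' \<union> S'"
    and "(C', S') \<in> F \<Longrightarrow> saturated I l d C' S' \<and> C' \<subseteq> C \<and> S \<subseteq> S' \<and> S' \<subseteq> C \<union> S \<and> I S'"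
    and "(C', S') \<in> F \<Longrightarrow> 1 \<le> (1 - d) ^ (card S' - card S) * hardcore I l C S"
  using assms by (simp_all add: container_family_def)

text \<open>As long as \<open>(C, S)\<close> is not saturated, query a violating \<open>v\<close>. If the independent set contains \<open>v\<close>
  then \<open>v\<close> moves to \<open>S\<close> and the partition function drops by the factor \<open>1 - d\<close>; otherwise \<open>v\<close> is
  discarded and the partition function does not grow. It never falls below 1, so few queries are
  answered positively. The potential \<open>(1 + y) ^ card C * Z powr t\<close> turns this into a bound on the
  number of leaves, since \<open>(1 - d) powr t \<le> y\<close> makes the two branches add up.\<close>

lemma container_tree:
  assumes I: "\<And>A B. A \<subseteq> B \<Longrightarrow> I B \<Longrightarrow> I A"
    and l: "0 \<le> l" and d: "0 < d" "d < 1" and y: "0 \<le> y" and t: "0 \<le> t" "(1 - d) powr t \<le> y"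
    and "finite C" "I S" "C \<inter> S = {}" "finite S"
  shows "\<exists>F. container_family I l d C S F \<and>
    real (card F) \<le> (1 + y) ^ card C * hardcore I l C S powr t"
  using assms(8-)
proof (induction "card C" arbitrary: C S)
  case 0
  then have [simp]: "C = {}" by simp
  have "container_family I l d C S {(C, S)}"
    using 0 by (simp add: container_family_def saturated_def hardcore_def)
  then show ?case
    using 0 y by (intro exI[of _ "{(C, S)}"]) (simp add: hardcore_def)
next
  case (Suc n)
  have Z1: "1 \<le> hardcore I l C S" using Suc l by (intro hardcore_ge_1) auto
  show ?case
  proof (cases "saturated I l d C S")
    case True
    have "1 * 1 \<le> (1 + y) ^ card C * hardcore I l C S powr t"
      using y t Z1 by (intro mult_mono ge_one_powr_ge_zero one_le_power) auto
    moreover have "container_family I l d C S {(C, S)}"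
      using True Suc.prems Z1 by (simp add: container_family_def)
    ultimately show ?thesis by (intro exI[of _ "{(C, S)}"]) simp
  next
    case False
    then obtain v where v: "v \<in> C"
      and b: "hardcore I l (C - {v}) (insert v S) < (1 - d) * hardcore I l (C - {v}) S"
      unfolding saturated_def by (meson not_le)
    define D where "D = C - {v}"
    let ?Z = "hardcore I l C S"
    have n: "n = card D" "card C = Suc (card D)" "finite D"
      using v Suc.prems Suc.hyps(2) by (auto simp: D_def)
    have vS: "v \<notin> S" and DS: "D \<inter> S = {}" "D \<inter> insert v S = {}" and DC: "D \<subseteq> C"
      using v Suc.prems by (auto simp: D_def)
    have a: "hardcore I l D S \<le> ?Z"
      unfolding D_def hardcore_remove[OF Suc.prems(1) v] using l by (simp add: hardcore_nonneg)
    have b': "hardcore I l D (insert v S) \<le> (1 - d) * ?Z"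
    proof -
      have "(1 - d) * hardcore I l D S \<le> (1 - d) * ?Z" using a d by (intro mult_left_mono) auto
      then show ?thesis using b unfolding D_def by linarith
    qed
    obtain F0 where F0: "container_family I l d D S F0"
        "real (card F0) \<le> (1 + y) ^ card D * hardcore I l D S powr t"
      using Suc.hyps(1)[OF n(1,3) Suc.prems(2) DS(1) Suc.prems(4)] by blast
    obtain F1 where F1: "container_family I l d D (insert v S) F1"
        "real (card F1) \<le> (1 + y) ^ card D * hardcore I l D (insert v S) powr t"
    proof (cases "I (insert v S)")
      case True
      then show ?thesis
        using Suc.hyps(1)[OF n(1,3) True DS(2)] Suc.prems(4) that by blast
    next
      case False
      then have "container_family I l d D (insert v S) {}"
        using I by (auto simp: container_family_def)
      then show ?thesis using that y by simp
    qed
    have "hardcore I l D S powr t \<le> ?Z powr t"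
      using a t l by (intro powr_mono2 hardcore_nonneg) auto
    then have "real (card F0) \<le> (1 + y) ^ card D * ?Z powr t"
      using F0(2) y by (meson mult_left_mono order_trans zero_le_power add_nonneg_nonneg zero_le_one)
    moreover have "hardcore I l D (insert v S) powr t \<le> y * ?Z powr t"
    proof -
      have "hardcore I l D (insert v S) powr t \<le> ((1 - d) * ?Z) powr t"
        using b' t l by (intro powr_mono2 hardcore_nonneg) auto
      also have "\<dots> = (1 - d) powr t * ?Z powr t"
        using d Z1 by (simp add: powr_mult)
      also have "\<dots> \<le> y * ?Z powr t" using t by (intro mult_right_mono) auto
      finally show ?thesis .
    qed
    then have "real (card F1) \<le> (1 + y) ^ card D * (y * ?Z powr t)"
      using F1(2) y by (meson mult_left_mono order_trans zero_le_power add_nonneg_nonneg zero_le_one)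
    moreover have "real (card (F0 \<union> F1)) \<le> real (card F0) + real (card F1)"
      using card_Un_le[of F0 F1] by linarith
    ultimately have "real (card (F0 \<union> F1)) \<le> (1 + y) ^ card D * ?Z powr t + (1 + y) ^ card D * (y * ?Z powr t)"
      by linarith
    also have "\<dots> = (1 + y) ^ card C * ?Z powr t"
      unfolding n(2) by (simp add: algebra_simps)
    finally have 1: "real (card (F0 \<union> F1)) \<le> (1 + y) ^ card C * ?Z powr t" .
    have "container_family I l d C S (F0 \<union> F1)"
      unfolding container_family_def
    proof (intro conjI allI impI)
      show "finite (F0 \<union> F1)" using F0(1) F1(1) by (simp add: container_family_def)
    next
      fix J assume J: "I J \<and> S \<subseteq> J \<and> J \<subseteq> C \<union> S"
      show "\<exists>C' S'. (C', S') \<in> F0 \<union> F1 \<and> J \<subseteq> C' \<union> S'"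
      proof (cases "v \<in> J")
        case True
        then have "I J" "insert v S \<subseteq> J" "J \<subseteq> D \<union> insert v S" using J by (auto simp: D_def)
        then show ?thesis using container_familyD(2)[OF F1(1), of J] by (meson UnI2)
      next
        case False
        then have "I J" "S \<subseteq> J" "J \<subseteq> D \<union> S" using J by (auto simp: D_def)
        then show ?thesis using container_familyD(2)[OF F0(1), of J] by (meson UnI1)
      qed
    next
      fix C' S' assume "(C', S') \<in> F0 \<union> F1"
      then consider "(C', S') \<in> F0" | "(C', S') \<in> F1" by blast
      then have "saturated I l d C' S' \<and> C' \<subseteq> C \<and> S \<subseteq> S' \<and> S' \<subseteq> C \<union> S \<and> I S' \<and>
        1 \<le> (1 - d) ^ (card S' - card S) * ?Z"
      proof cases
        case 1
        then have *: "saturated I l d C' S' \<and> C' \<subseteq> D \<and> S \<subseteq> S' \<and> S' \<subseteq> D \<union> S \<and> I S'"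
          "1 \<le> (1 - d) ^ (card S' - card S) * hardcore I l D S"
          using container_familyD(3,4)[OF F0(1)] by auto
        have "(1 - d) ^ (card S' - card S) * hardcore I l D S \<le> (1 - d) ^ (card S' - card S) * ?Z"
          using a d by (intro mult_left_mono) auto
        then show ?thesis using * DC by auto
      next
        case 2
        then have *: "saturated I l d C' S' \<and> C' \<subseteq> D \<and> insert v S \<subseteq> S' \<and> S' \<subseteq> D \<union> insert v S \<and> I S'"
          "1 \<le> (1 - d) ^ (card S' - card (insert v S)) * hardcore I l D (insert v S)"
          using container_familyD(3,4)[OF F1(1)] by auto
        have "finite S'" using * Suc.prems n(3) by (meson finite_Un finite_insert finite_subset)
        then have "card (insert v S) \<le> card S'" using * by (intro card_mono) auto
        then have e: "card S' - card S = Suc (card S' - card (insert v S))"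
          using vS Suc.prems(4) by simp
        have "(1 - d) ^ (card S' - card (insert v S)) * hardcore I l D (insert v S)
            \<le> (1 - d) ^ (card S' - card (insert v S)) * ((1 - d) * ?Z)"
          using b' d by (intro mult_left_mono) auto
        then have "1 \<le> (1 - d) ^ (card S' - card S) * ?Z" using *(2) unfolding e by (simp add: mult_ac)
        then show ?thesis using *(1) v DC by auto
      qed
      then show "saturated I l d C' S'" "C' \<subseteq> C" "S \<subseteq> S'" "S' \<subseteq> C \<union> S" "I S'"
        "1 \<le> (1 - d) ^ (card S' - card S) * ?Z" by simp_all
    qed
    then show ?thesis using 1 by blast
  qed
qed

lemma containers:
  assumes I: "\<And>A B. A \<subseteq> B \<Longrightarrow> I B \<Longrightarrow> I A" "I {}"
    and l: "0 \<le> l" and d: "0 < d" "d < 1" and y: "0 < y" "y \<le> 1" and E: "finite E"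
  shows "\<exists>F. finite F \<and> real (card F) \<le> exp (real (card E) * (y + l * (ln (1 / y) / d))) \<and>
    (\<forall>J. I J \<and> J \<subseteq> E \<longrightarrow> (\<exists>C S. (C, S) \<in> F \<and> J \<subseteq> C \<union> S)) \<and>
    (\<forall>C S. (C, S) \<in> F \<longrightarrow>
       saturated I l d C S \<and> C \<subseteq> E \<and> S \<subseteq> E \<and> I S \<and> d * real (card S) \<le> l * real (card E))"
proof -
  define t where "t = ln (1 / y) / d"
  have t0: "0 \<le> t" using y d by (simp add: t_def)
  have "ln (1 - d) \<le> - d" using ln_add_one_self_le_self2[of "- d"] d by simp
  then have "t * ln (1 - d) \<le> t * (- d)" using t0 by (rule mult_left_mono)
  also have "\<dots> = ln y" using d y by (simp add: t_def ln_div)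
  finally have "exp (t * ln (1 - d)) \<le> exp (ln y)" by simp
  then have ty: "(1 - d) powr t \<le> y"
    using d y by (simp add: powr_def)
  have Z: "hardcore I l E {} \<le> exp (l * real (card E))"
  proof -
    have "hardcore I l E {} \<le> (1 + l) ^ card E" using E l by (rule hardcore_le)
    also have "\<dots> \<le> exp l ^ card E" using l by (intro power_mono) auto
    finally show ?thesis by (simp add: exp_of_nat_mult[symmetric] mult.commute)
  qed
  obtain F where F: "container_family I l d E {} F"
    "real (card F) \<le> (1 + y) ^ card E * hardcore I l E {} powr t"
  proof -
    have "\<exists>F. container_family I l d E {} F \<and>
        real (card F) \<le> (1 + y) ^ card E * hardcore I l E {} powr t"
    proof (rule container_tree[OF _ l d])
      show "I A" if "A \<subseteq> B" "I B" for A B using that by (rule I(1))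
    qed (use y t0 ty E I(2) in simp_all)
    then show ?thesis using that by blast
  qed
  have "real (card F) \<le> exp y ^ card E * exp (l * real (card E)) powr t"
    using F(2) Z y t0 l
    by (elim order_trans) (intro mult_mono power_mono powr_mono2 hardcore_nonneg; simp)
  also have "\<dots> = exp (real (card E) * (y + l * t))"
    by (simp add: powr_def exp_of_nat_mult[symmetric] exp_add[symmetric] algebra_simps)
  finally have 1: "real (card F) \<le> exp (real (card E) * (y + l * t))" .
  have 2: "d * real (card S) \<le> l * real (card E)" if "(C, S) \<in> F" for C S
  proof -
    have "1 \<le> (1 - d) ^ card S * hardcore I l E {}" using container_familyD(4)[OF F(1) that] by simp
    also have "\<dots> \<le> exp (- d) ^ card S * exp (l * real (card E))"
      using Z d l exp_ge_add_one_self[of "- d"]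
      by (intro mult_mono power_mono hardcore_nonneg) auto
    also have "\<dots> = exp (l * real (card E) - d * real (card S))"
      by (simp add: exp_of_nat_mult[symmetric] exp_add[symmetric] algebra_simps)
    finally show ?thesis by simp
  qed
  show ?thesis
    using container_familyD(1)[OF F(1)] 1 2 container_familyD(3)[OF F(1)]
      container_familyD(2)[OF F(1), of _ ]
    unfolding t_def by (intro exI[of _ F]) auto
qed

text \<open>In the hard-core measure of a saturated pair every element of \<open>C\<close> appears with probability at
  least \<open>(1 - d) * p\<close>, where \<open>p = l / (1 + l)\<close> is its probability in a free random subset.\<close>

lemma saturated_marginals:
  assumes l: "0 < l" and d: "0 \<le> d" and C: "finite C" and sat: "saturated I l d C S"
  shows "(1 - d) * l * real (card C) * hardcore I l C S
    \<le> (1 + l) * wsum l C (\<lambda>R. of_bool (I (R \<union> S)) * real (card R))"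
proof -
  have "wsum l C (\<lambda>R. of_bool (I (R \<union> S)) * real (card R))
      = wsum l C (\<lambda>R. \<Sum>v\<in>C. of_bool (I (R \<union> S)) * of_bool (v \<in> R))"
  proof (rule wsum_cong)
    fix R assume "R \<subseteq> C"
    then have "real (card R) = (\<Sum>v\<in>C. of_bool (v \<in> R))"
      using C by (simp add: of_bool_def sum.If_cases Int_absorb1)
    then show "of_bool (I (R \<union> S)) * real (card R) = (\<Sum>v\<in>C. of_bool (I (R \<union> S)) * of_bool (v \<in> R))"
      by (simp only: sum_distrib_left)
  qed
  also have "\<dots> = (\<Sum>v\<in>C. wsum l C (\<lambda>R. of_bool (I (R \<union> S)) * of_bool (v \<in> R)))"
    by (rule wsum_sum)
  finally have e: "wsum l C (\<lambda>R. of_bool (I (R \<union> S)) * real (card R))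
      = (\<Sum>v\<in>C. wsum l C (\<lambda>R. of_bool (I (R \<union> S)) * of_bool (v \<in> R)))" .
  have v: "(1 - d) * l * hardcore I l C S \<le> (1 + l) * wsum l C (\<lambda>R. of_bool (I (R \<union> S)) * of_bool (v \<in> R))"
    if "v \<in> C" for v
  proof -
    define a b where "a = hardcore I l (C - {v}) S" and "b = hardcore I l (C - {v}) (insert v S)"
    have "wsum l C (\<lambda>R. of_bool (I (R \<union> S)) * of_bool (v \<in> R))
        = wsum l (insert v (C - {v})) (\<lambda>R. of_bool (I (R \<union> S)) * of_bool (v \<in> R))"
      using that by (simp add: insert_absorb)
    also have "\<dots> = wsum l (C - {v}) (\<lambda>R. of_bool (I (R \<union> S)) * of_bool (v \<in> R)) + l * b"
      using C by (subst wsum_insert) (simp_all add: b_def hardcore_def)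
    also have "wsum l (C - {v}) (\<lambda>R. of_bool (I (R \<union> S)) * of_bool (v \<in> R)) = wsum l (C - {v}) (\<lambda>R. 0 * 0)"
      by (rule wsum_cong) auto
    also have "\<dots> = 0" by (subst wsum_cmult) simp
    finally have 1: "wsum l C (\<lambda>R. of_bool (I (R \<union> S)) * of_bool (v \<in> R)) = l * b" by simp
    have 2: "hardcore I l C S = a + l * b"
      unfolding a_def b_def using hardcore_remove[OF C that] .
    have ab: "(1 - d) * a \<le> b" using sat that by (simp add: saturated_def a_def b_def)
    have "0 \<le> b" unfolding b_def using l by (intro hardcore_nonneg) simp
    then have "(1 - d) * (l * b) \<le> 1 * (l * b)"
      using d l by (intro mult_right_mono) auto
    then have "(1 - d) * a + (1 - d) * (l * b) \<le> b + l * b" using ab by simp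
    then have "l * ((1 - d) * a + (1 - d) * (l * b)) \<le> l * (b + l * b)"
      using l by (intro mult_left_mono) auto
    then have "(1 - d) * l * (a + l * b) \<le> (1 + l) * (l * b)" by (simp add: algebra_simps)
    then show ?thesis unfolding 1 2 by simp
  qed
  have "(1 - d) * l * real (card C) * hardcore I l C S = (\<Sum>v\<in>C. (1 - d) * l * hardcore I l C S)"
    by simp
  also have "\<dots> \<le> (\<Sum>v\<in>C. (1 + l) * wsum l C (\<lambda>R. of_bool (I (R \<union> S)) * of_bool (v \<in> R)))"
    using v by (intro sum_mono)
  finally show ?thesis unfolding e by (simp add: sum_distrib_left)
qed

text \<open>Each forbidden set \<open>K x\<close> inside a random set \<open>R\<close> meets the part \<open>D R\<close> of \<open>R\<close> that is missing
  from a largest independent subset, and \<open>D R\<close> is small on average: by Harris' inequality the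
  marginals of the hard-core measure are a lower bound for the expected size of that independent
  subset. So few elements suffice to hit all the forbidden sets contained in \<open>R\<close>, and the sum on
  the right, a second moment of the number of such sets, limits how far this is possible.\<close>

lemma saturated_second_moment:
  assumes I: "\<And>A B. A \<subseteq> B \<Longrightarrow> I B \<Longrightarrow> I A"
    and l: "0 < l" and d: "0 < d" and C: "finite C" and S: "I S" and sat: "saturated I l d C S"
    and X: "finite X" and K: "\<And>x. x \<in> X \<Longrightarrow> K x \<subseteq> C" "\<And>x. x \<in> X \<Longrightarrow> \<not> I (K x)"
  shows "real (card X) ^ 2 \<le> d * real (card C) *
    (\<Sum>x\<in>X. \<Sum>y\<in>X. real (card (K x \<inter> K y)) * ((1 + l) / l) ^ (card (K x \<inter> K y) - 1))"
proof (cases "X = {}")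
  case False
  define P where "P = (1 + l) / l"
  define M where "M = (1 + l) ^ card C"
  define g where "g R = Max (card ` {Q. Q \<subseteq> R \<and> I Q})" for R
  have P: "P > 0" and M: "M > 0" using l by (auto simp: P_def M_def)
  have I0: "I {}" using I S by blast
  have fin: "finite R" if "R \<subseteq> C" for R using that C by (rule finite_subset)
  have fin': "finite (card ` {Q. Q \<subseteq> R \<and> I Q})" if "R \<subseteq> C" for R
    using fin[OF that] by simp
  have sup: "wsum l C (\<lambda>R. of_bool (A \<subseteq> R)) = M / P ^ card A" if "A \<subseteq> C" for A
    using wsum_superset[OF C that, of l] l by (simp add: M_def P_def power_divide field_simps)
  have "\<exists>Q. Q \<subseteq> R \<and> I Q \<and> card Q = g R" if "R \<subseteq> C" for R
  proof -
    have "g R \<in> card ` {Q. Q \<subseteq> R \<and> I Q}"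
      unfolding g_def using I0 by (intro Max_in fin'[OF that]) auto
    then show ?thesis by auto
  qed
  then obtain Q where Q: "\<And>R. R \<subseteq> C \<Longrightarrow> Q R \<subseteq> R" "\<And>R. R \<subseteq> C \<Longrightarrow> I (Q R)"
      "\<And>R. R \<subseteq> C \<Longrightarrow> card (Q R) = g R"
    by metis
  define D where "D R = R - Q R" for R
  have gm: "g R \<le> g R'" if "R \<subseteq> R'" "R' \<subseteq> C" for R R'
    unfolding g_def using that I0 fin'[OF that(2)] by (intro Max_mono) auto
  have gc: "card R \<le> g R" if "R \<subseteq> C" "I R" for R
    unfolding g_def using that fin'[OF that(1)] by (intro Max_ge) auto
  have h0: "0 < hardcore I l C S" using hardcore_ge_1[of C l I S] C S l by simp
  have "(1 - d) * l * real (card C) * hardcore I l C S * M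
      \<le> (1 + l) * wsum l C (\<lambda>R. of_bool (I (R \<union> S)) * real (card R)) * M"
    using saturated_marginals[OF l less_imp_le[OF d] C sat] M by (intro mult_right_mono) auto
  also have "\<dots> \<le> (1 + l) * wsum l C (\<lambda>R. of_bool (I (R \<union> S)) * real (g R)) * M"
  proof -
    have "wsum l C (\<lambda>R. of_bool (I (R \<union> S)) * real (card R))
        \<le> wsum l C (\<lambda>R. of_bool (I (R \<union> S)) * real (g R))"
    proof (rule wsum_mono)
      show "of_bool (I (R \<union> S)) * real (card R) \<le> of_bool (I (R \<union> S)) * real (g R)"
        if "R \<subseteq> C" for R
        using gc[OF that] I[of R "R \<union> S"] by (auto simp: of_bool_def)
    qed (use l in simp)
    then show ?thesis using l M by (intro mult_right_mono mult_left_mono) auto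
  qed
  also have "\<dots> = (1 + l) * (wsum l C (\<lambda>R. of_bool (I (R \<union> S)) * real (g R)) * (1 + l) ^ card C)"
    by (simp add: M_def)
  also have "\<dots> \<le> (1 + l) * (wsum l C (\<lambda>R. of_bool (I (R \<union> S))) * wsum l C (\<lambda>R. real (g R)))"
  proof -
    have "wsum l C (\<lambda>R. of_bool (I (R \<union> S)) * real (g R)) * (1 + l) ^ card C
        \<le> wsum l C (\<lambda>R. of_bool (I (R \<union> S))) * wsum l C (\<lambda>R. real (g R))"
    proof (rule wsum_Harris[OF C])
      show "of_bool (I (R' \<union> S)) \<le> (of_bool (I (R \<union> S)) :: real)" if "R \<subseteq> R'" "R' \<subseteq> C" for R R'
        using I[of "R \<union> S" "R' \<union> S"] that by (auto simp: of_bool_def)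
      show "real (g R) \<le> real (g R')" if "R \<subseteq> R'" "R' \<subseteq> C" for R R'
        using gm[OF that] by simp
    qed (use l in simp)
    then show ?thesis using l by (intro mult_left_mono) auto
  qed
  also have "\<dots> = (1 + l) * wsum l C (\<lambda>R. real (g R)) * hardcore I l C S"
    by (simp add: hardcore_def)
  finally have "((1 - d) * l * real (card C) * M) * hardcore I l C S
      \<le> ((1 + l) * wsum l C (\<lambda>R. real (g R))) * hardcore I l C S"
    by (simp add: mult_ac)
  then have "(1 - d) * l * real (card C) * M \<le> (1 + l) * wsum l C (\<lambda>R. real (g R))"
    using h0 by (simp only: mult_le_cancel_right_pos)
  then have g: "(1 - d) * real (card C) * M / P \<le> wsum l C (\<lambda>R. real (g R))"
    using l by (simp add: P_def field_simps)
  have cR: "wsum l C (\<lambda>R. real (card R)) = real (card C) * M / P"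
  proof -
    have "wsum l C (\<lambda>R. real (card R)) = wsum l C (\<lambda>R. \<Sum>v\<in>C. of_bool ({v} \<subseteq> R))"
      using C by (intro wsum_cong) (simp add: of_bool_def sum.If_cases Int_absorb1)
    also have "\<dots> = (\<Sum>v\<in>C. wsum l C (\<lambda>R. of_bool ({v} \<subseteq> R)))" by (rule wsum_sum)
    also have "\<dots> = (\<Sum>v\<in>C. M / P)"
      using sup[of "{_}"] by (intro sum.cong) auto
    finally show ?thesis by simp
  qed
  have "wsum l C (\<lambda>R. real (card (D R))) = wsum l C (\<lambda>R. real (card R) - real (g R))"
  proof (rule wsum_cong)
    fix R assume R: "R \<subseteq> C"
    show "real (card (D R)) = real (card R) - real (g R)"
      unfolding D_def Q(3)[OF R, symmetric] using Q(1)[OF R] fin[OF R]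
      by (simp add: card_Diff_subset card_mono finite_subset of_nat_diff)
  qed
  also have "\<dots> \<le> d * real (card C) * M / P"
  proof -
    have "(1 - d) * real (card C) * M / P = real (card C) * M / P - d * real (card C) * M / P"
      by (simp add: algebra_simps diff_divide_distrib)
    then show ?thesis unfolding wsum_diff cR using g by linarith
  qed
  finally have cD: "wsum l C (\<lambda>R. real (card (D R))) \<le> d * real (card C) * M / P" .
  define Y where "Y R e = (\<Sum>x\<in>X. P ^ card (K x) * of_bool (K x \<subseteq> R \<and> e \<in> K x))" for R e
  define q where "q = (\<Sum>x\<in>X. \<Sum>y\<in>X. real (card (K x \<inter> K y)) * P ^ card (K x \<inter> K y))"
  have Y2: "wsum l C (\<lambda>R. \<Sum>e\<in>C. Y R e ^ 2) = M * q"
  proof -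
    have fK: "finite (K x)" if "x \<in> X" for x using K(1)[OF that] by (rule fin)
    have "wsum l C (\<lambda>R. \<Sum>e\<in>C. Y R e ^ 2) = wsum l C (\<lambda>R. \<Sum>x\<in>X. \<Sum>y\<in>X.
        (P ^ card (K x) * P ^ card (K y) * real (card (K x \<inter> K y))) * of_bool (K x \<union> K y \<subseteq> R))"
    proof (rule wsum_cong)
      fix R assume R: "R \<subseteq> C"
      have "(\<Sum>e\<in>C. Y R e ^ 2) = (\<Sum>e\<in>C. \<Sum>x\<in>X. \<Sum>y\<in>X. (P ^ card (K x) * of_bool (K x \<subseteq> R \<and> e \<in> K x)) *
          (P ^ card (K y) * of_bool (K y \<subseteq> R \<and> e \<in> K y)))"
        by (simp add: Y_def power2_eq_square sum_product)
      also have "\<dots> = (\<Sum>x\<in>X. \<Sum>e\<in>C. \<Sum>y\<in>X. (P ^ card (K x) * of_bool (K x \<subseteq> R \<and> e \<in> K x)) *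
          (P ^ card (K y) * of_bool (K y \<subseteq> R \<and> e \<in> K y)))"
        by (rule sum.swap)
      also have "\<dots> = (\<Sum>x\<in>X. \<Sum>y\<in>X. \<Sum>e\<in>C. (P ^ card (K x) * of_bool (K x \<subseteq> R \<and> e \<in> K x)) *
          (P ^ card (K y) * of_bool (K y \<subseteq> R \<and> e \<in> K y)))"
        by (intro sum.cong refl sum.swap)
      also have "\<dots> = (\<Sum>x\<in>X. \<Sum>y\<in>X. \<Sum>e\<in>C. (P ^ card (K x) * P ^ card (K y) *
          of_bool (K x \<union> K y \<subseteq> R)) * of_bool (e \<in> K x \<inter> K y))"
      proof (intro sum.cong refl)
        fix x y e
        show "(P ^ card (K x) * of_bool (K x \<subseteq> R \<and> e \<in> K x)) * (P ^ card (K y) * of_bool (K y \<subseteq> R \<and> e \<in> K y))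
          = (P ^ card (K x) * P ^ card (K y) * of_bool (K x \<union> K y \<subseteq> R)) * of_bool (e \<in> K x \<inter> K y)"
          by (cases "K x \<subseteq> R"; cases "K y \<subseteq> R"; cases "e \<in> K x"; cases "e \<in> K y") simp_all
      qed
      also have "\<dots> = (\<Sum>x\<in>X. \<Sum>y\<in>X. (P ^ card (K x) * P ^ card (K y) * real (card (K x \<inter> K y))) *
          of_bool (K x \<union> K y \<subseteq> R))"
      proof (rule sum.cong[OF refl], rule sum.cong[OF refl])
        fix x y assume xy: "x \<in> X" "y \<in> X"
        have "C \<inter> {e. e \<in> K x \<inter> K y} = K x \<inter> K y" using K(1)[OF xy(1)] by auto
        then have "(\<Sum>e\<in>C. of_bool (e \<in> K x \<inter> K y)) = real (card (K x \<inter> K y))"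
          using C by (simp only: of_bool_def sum.If_cases) simp
        then show "(\<Sum>e\<in>C. (P ^ card (K x) * P ^ card (K y) * of_bool (K x \<union> K y \<subseteq> R)) * of_bool (e \<in> K x \<inter> K y))
          = (P ^ card (K x) * P ^ card (K y) * real (card (K x \<inter> K y))) * of_bool (K x \<union> K y \<subseteq> R)"
          by (simp only: sum_distrib_left[symmetric]) (simp add: mult_ac)
      qed
      finally show "(\<Sum>e\<in>C. Y R e ^ 2) = (\<Sum>x\<in>X. \<Sum>y\<in>X.
        (P ^ card (K x) * P ^ card (K y) * real (card (K x \<inter> K y))) * of_bool (K x \<union> K y \<subseteq> R))" .
    qed
    also have "\<dots> = (\<Sum>x\<in>X. \<Sum>y\<in>X. (P ^ card (K x) * P ^ card (K y) * real (card (K x \<inter> K y))) *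
        wsum l C (\<lambda>R. of_bool (K x \<union> K y \<subseteq> R)))"
      by (simp only: wsum_sum wsum_cmult)
    also have "\<dots> = (\<Sum>x\<in>X. \<Sum>y\<in>X. M * (real (card (K x \<inter> K y)) * P ^ card (K x \<inter> K y)))"
    proof (intro sum.cong refl)
      fix x y assume xy: "x \<in> X" "y \<in> X"
      have "card (K x) + card (K y) = card (K x \<union> K y) + card (K x \<inter> K y)"
        using fK xy by (intro card_Un_Int) auto
      then have "P ^ card (K x) * P ^ card (K y) = P ^ card (K x \<union> K y) * P ^ card (K x \<inter> K y)"
        by (simp add: power_add[symmetric])
      moreover have "wsum l C (\<lambda>R. of_bool (K x \<union> K y \<subseteq> R)) = M / P ^ card (K x \<union> K y)"
        using K(1) xy by (intro sup) auto
      ultimately show "(P ^ card (K x) * P ^ card (K y) * real (card (K x \<inter> K y))) *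
        wsum l C (\<lambda>R. of_bool (K x \<union> K y \<subseteq> R)) = M * (real (card (K x \<inter> K y)) * P ^ card (K x \<inter> K y))"
        using P by simp
    qed
    finally show ?thesis by (simp add: q_def sum_distrib_left)
  qed
  have main: "real (card X) \<le> a / 2 * (d * real (card C) / P) + q / (2 * a)" if a: "a > 0" for a
  proof -
    have "M * real (card X) = (\<Sum>x\<in>X. P ^ card (K x) * wsum l C (\<lambda>R. of_bool (K x \<subseteq> R)))"
      using P K(1) sup by simp
    also have "\<dots> = wsum l C (\<lambda>R. \<Sum>x\<in>X. P ^ card (K x) * of_bool (K x \<subseteq> R))"
      by (simp only: wsum_sum wsum_cmult)
    also have "\<dots> \<le> wsum l C (\<lambda>R. a / 2 * real (card (D R)) + (1 / (2 * a)) * (\<Sum>e\<in>C. Y R e ^ 2))"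
    proof (rule wsum_mono)
      fix R assume R: "R \<subseteq> C"
      have DC: "D R \<subseteq> C" "finite (D R)" using R fin[OF R] by (auto simp: D_def)
      have "(\<Sum>x\<in>X. P ^ card (K x) * of_bool (K x \<subseteq> R))
          \<le> (\<Sum>x\<in>X. \<Sum>e\<in>D R. P ^ card (K x) * of_bool (K x \<subseteq> R \<and> e \<in> K x))"
      proof (rule sum_mono)
        fix x assume x: "x \<in> X"
        show "P ^ card (K x) * of_bool (K x \<subseteq> R) \<le> (\<Sum>e\<in>D R. P ^ card (K x) * of_bool (K x \<subseteq> R \<and> e \<in> K x))"
        proof (cases "K x \<subseteq> R")
          case True
          then have "\<not> K x \<subseteq> Q R" using I[of "K x" "Q R"] K(2)[OF x] Q(2)[OF R] by blast
          then obtain e where e: "e \<in> K x" "e \<in> D R" using True by (auto simp: D_def)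
          have "P ^ card (K x) * of_bool (K x \<subseteq> R \<and> e \<in> K x)
              \<le> (\<Sum>e\<in>D R. P ^ card (K x) * of_bool (K x \<subseteq> R \<and> e \<in> K x))"
            using e P DC by (intro member_le_sum) auto
          then show ?thesis using e by simp
        next
          case False
          then show ?thesis by simp
        qed
      qed
      also have "\<dots> = (\<Sum>e\<in>D R. Y R e)" unfolding Y_def by (rule sum.swap)
      also have "\<dots> \<le> (\<Sum>e\<in>D R. a / 2 + Y R e ^ 2 / (2 * a))"
      proof (rule sum_mono)
        fix e
        have "0 \<le> (Y R e - a) ^ 2 / (2 * a)" using a by simp
        also have "\<dots> = a / 2 + Y R e ^ 2 / (2 * a) - Y R e"
          using a by (simp add: power2_eq_square field_simps)
        finally show "Y R e \<le> a / 2 + Y R e ^ 2 / (2 * a)" by simp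
      qed
      also have "\<dots> = a / 2 * real (card (D R)) + (\<Sum>e\<in>D R. Y R e ^ 2 / (2 * a))"
        by (simp add: sum.distrib)
      also have "(\<Sum>e\<in>D R. Y R e ^ 2 / (2 * a)) \<le> (\<Sum>e\<in>C. Y R e ^ 2 / (2 * a))"
        using DC C a by (intro sum_mono2) auto
      finally show "(\<Sum>x\<in>X. P ^ card (K x) * of_bool (K x \<subseteq> R))
          \<le> a / 2 * real (card (D R)) + (1 / (2 * a)) * (\<Sum>e\<in>C. Y R e ^ 2)"
        by (simp add: sum_divide_distrib)
    qed (use l in auto)
    also have "\<dots> = a / 2 * wsum l C (\<lambda>R. real (card (D R))) + (1 / (2 * a)) * (M * q)"
      by (simp only: wsum_add wsum_cmult Y2)
    also have "\<dots> \<le> a / 2 * (d * real (card C) * M / P) + (1 / (2 * a)) * (M * q)"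
      using cD a by (intro add_right_mono mult_left_mono) auto
    also have "\<dots> = M * (a / 2 * (d * real (card C) / P) + q / (2 * a))"
      using a P by (simp add: field_simps)
    finally show ?thesis using M by simp
  qed
  have Cpos: "card C > 0"
  proof -
    obtain x where x: "x \<in> X" using False by blast
    then have "K x \<noteq> {}" using K(2) I0 by metis
    then show ?thesis using K(1)[OF x] C by (auto simp: card_gt_0_iff)
  qed
  define A where "A = d * real (card C) / P"
  define m where "m = real (card X)"
  have A: "A > 0" using d Cpos P by (simp add: A_def)
  have m: "m > 0" using False X by (simp add: m_def card_gt_0_iff)
  \<comment> \<open>with this \<open>a\<close> the first term of the bound is \<open>m / 2\<close>\<close>
  have "m \<le> (m / A) / 2 * A + q / (2 * (m / A))"
    using main[of "m / A"] divide_pos_pos[OF m A] by (simp only: A_def m_def)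
  then have "m ^ 2 \<le> A * q" using A m by (simp add: field_simps power2_eq_square)
  also have "A * q = d * real (card C) *
      (\<Sum>x\<in>X. \<Sum>y\<in>X. real (card (K x \<inter> K y)) * P ^ (card (K x \<inter> K y) - 1))"
  proof -
    have "q = P * (\<Sum>x\<in>X. \<Sum>y\<in>X. real (card (K x \<inter> K y)) * P ^ (card (K x \<inter> K y) - 1))"
      unfolding q_def sum_distrib_left
      by (intro sum.cong refl) (simp add: power_eq_if)
    then show ?thesis using P by (simp add: A_def)
  qed
  finally show ?thesis by (simp add: m_def P_def)
qed simp

section \<open>Cliques chosen through vertices of large degree\<close>

definition cfree :: "'a set \<Rightarrow> nat \<Rightarrow> 'a set set \<Rightarrow> bool" where
  "cfree V k E \<longleftrightarrow> \<not> (\<exists>S\<subseteq>V. card S = k \<and> clique S E)"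

lemma cfree_antimono: "A \<subseteq> B \<Longrightarrow> cfree V k B \<Longrightarrow> cfree V k A"
  unfolding cfree_def clique_def by blast

definition nbhd :: "'a set set \<Rightarrow> 'a set \<Rightarrow> 'a \<Rightarrow> 'a set" where
  "nbhd E A x = {y\<in>A. {x, y} \<in> E}"

lemma nbhd_subset: "nbhd E A x \<subseteq> A"
  by (auto simp: nbhd_def)

lemma finite_nbhd [simp]: "finite A \<Longrightarrow> finite (nbhd E A x)"
  by (simp add: nbhd_def)

text \<open>The value is meaningless if \<open>A\<close> has fewer than \<open>k\<close> elements.\<close>

definition top_degree :: "'a set set \<Rightarrow> nat \<Rightarrow> 'a set \<Rightarrow> 'a set" where
  "top_degree E k A = (SOME T. T \<subseteq> A \<and> card T = k \<and>
     (\<forall>x\<in>T. \<forall>u\<in>A - T. card (nbhd E A u) \<le> card (nbhd E A x)))"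

lemma ex_top_values:
  fixes d :: "'a \<Rightarrow> nat"
  assumes "finite A" "k \<le> card A"
  shows "\<exists>T. T \<subseteq> A \<and> card T = k \<and> (\<forall>x\<in>T. \<forall>u\<in>A - T. d u \<le> d x)"
  using assms(2)
proof (induction k)
  case (Suc k)
  then obtain T where T: "T \<subseteq> A" "card T = k" "\<forall>x\<in>T. \<forall>u\<in>A - T. d u \<le> d x"
    by auto
  have fT: "finite T" using T(1) assms(1) by (rule finite_subset)
  have "A - T \<noteq> {}" using T Suc.prems fT by (metis Diff_eq_empty_iff card_mono not_less_eq_eq)
  then have "Max (d ` (A - T)) \<in> d ` (A - T)" using assms(1) by (intro Max_in) auto
  then obtain x where x0: "x \<in> A - T" "Max (d ` (A - T)) = d x" by auto
  have x: "x \<in> A - T" "\<forall>u\<in>A - T. d u \<le> d x"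
    using x0 assms(1) by (auto simp flip: x0(2))
  have "card (insert x T) = Suc k" using x(1) fT T(2) by simp
  then show ?case using T x by (intro exI[of _ "insert x T"]) auto
qed (auto intro: exI[of _ "{}"])

lemma top_degree:
  assumes "finite A" "k \<le> card A"
  shows "top_degree E k A \<subseteq> A" "card (top_degree E k A) = k"
    and "x \<in> top_degree E k A \<Longrightarrow> u \<in> A - top_degree E k A \<Longrightarrow> card (nbhd E A u) \<le> card (nbhd E A x)"
  using someI_ex[OF ex_top_values[OF assms, of "\<lambda>u. card (nbhd E A u)"]]
  unfolding top_degree_def[symmetric] by auto

text \<open>The next vertex always comes from the top degrees of the current common neighbourhood, as
  \<open>stable_coloring\<close> needs. Robustness says that this never gets stuck, so each of the \<open>m\<close> steps has
  exactly \<open>k\<close> choices and the uniform distribution on \<open>greedy_cliques\<close> is well spread.\<close>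

fun robust :: "'a set set \<Rightarrow> nat \<Rightarrow> 'a set \<Rightarrow> nat \<Rightarrow> bool" where
  "robust E k A 0 \<longleftrightarrow> True"
| "robust E k A (Suc m) \<longleftrightarrow> k \<le> card A \<and> (\<forall>x\<in>top_degree E k A. robust E k (nbhd E A x) m)"

fun greedy_cliques :: "'a set set \<Rightarrow> nat \<Rightarrow> 'a set \<Rightarrow> nat \<Rightarrow> 'a list set" where
  "greedy_cliques E k A 0 = {[]}"
| "greedy_cliques E k A (Suc m) =
     (\<Union>x\<in>top_degree E k A. (#) x ` greedy_cliques E k (nbhd E A x) m)"

lemma greedy_cliques:
  assumes "finite A" "robust E k A m" "xs \<in> greedy_cliques E k A m" and E: "\<And>x. {x} \<notin> E"
  shows "set xs \<subseteq> A \<and> length xs = m \<and> distinct xs \<and> clique (set xs) E"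
  using assms(1-3)
proof (induction m arbitrary: A xs)
  case (Suc m)
  then obtain x ys where x: "x \<in> top_degree E k A" "xs = x # ys" "ys \<in> greedy_cliques E k (nbhd E A x) m"
    by auto
  have xA: "x \<in> A" using top_degree(1)[of A k E] Suc.prems x(1) by auto
  have "set ys \<subseteq> nbhd E A x \<and> length ys = m \<and> distinct ys \<and> clique (set ys) E"
    using Suc.prems x by (intro Suc.IH[of "nbhd E A x"]) auto
  then show ?case
    using xA E[of x] x(2) by (auto simp: nbhd_def clique_def insert_commute)
qed (simp add: clique_def)

lemma finite_greedy_cliques:
  assumes "finite A" "robust E k A m"
  shows "finite (greedy_cliques E k A m)"
  using assms
proof (induction m arbitrary: A)
  case (Suc m)
  have "finite (top_degree E k A)" using top_degree(1)[of A k E] Suc.prems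
    by (auto intro: finite_subset)
  then show ?case using Suc by auto
qed simp

lemma sum_greedy_cliques_Suc:
  assumes "finite A" "robust E k A (Suc m)"
  shows "(\<Sum>xs\<in>greedy_cliques E k A (Suc m). f xs)
    = (\<Sum>x\<in>top_degree E k A. \<Sum>xs\<in>greedy_cliques E k (nbhd E A x) m. f (x # xs))"
proof -
  let ?G = "\<lambda>x. greedy_cliques E k (nbhd E A x) m"
  have fT: "finite (top_degree E k A)" using top_degree(1)[of A k E] assms
    by (auto intro: finite_subset)
  have fG: "finite (?G x)" if "x \<in> top_degree E k A" for x
    using assms that by (intro finite_greedy_cliques) auto
  have "(\<Sum>xs\<in>greedy_cliques E k A (Suc m). f xs) = (\<Sum>x\<in>top_degree E k A. \<Sum>xs\<in>(#) x ` ?G x. f xs)"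
    unfolding greedy_cliques.simps using fT fG by (intro sum.UNION_disjoint) auto
  also have "\<dots> = (\<Sum>x\<in>top_degree E k A. \<Sum>xs\<in>?G x. f (x # xs))"
    by (rule sum.cong[OF refl]) (simp add: sum.reindex)
  finally show ?thesis .
qed

lemma card_greedy_cliques:
  assumes "finite A" "robust E k A m"
  shows "card (greedy_cliques E k A m) = k ^ m"
  using assms
proof (induction m arbitrary: A)
  case (Suc m)
  have "card (greedy_cliques E k A (Suc m)) = (\<Sum>x\<in>top_degree E k A. card (greedy_cliques E k (nbhd E A x) m))"
    unfolding card_eq_sum by (rule sum_greedy_cliques_Suc[OF Suc.prems])
  also have "\<dots> = (\<Sum>x\<in>top_degree E k A. k ^ m)"
    using Suc by (intro sum.cong) auto
  finally show ?case using top_degree(2)[of A k E] Suc.prems by simp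
qed simp

lemma sum_split_bound:
  fixes g :: "'a \<Rightarrow> real"
  assumes "finite T" "finite U" "card T \<le> k" "card U \<le> u" "0 \<le> a" "0 \<le> b"
    and "\<And>x. x \<in> T \<Longrightarrow> x \<notin> U \<Longrightarrow> g x \<le> a" "\<And>x. x \<in> T \<Longrightarrow> x \<in> U \<Longrightarrow> g x \<le> b"
  shows "sum g T \<le> real k * a + real u * b"
proof -
  have "sum g T = sum g (T - U) + sum g (T \<inter> U)"
    using assms(1) by (metis Diff_Diff_Int Diff_subset sum.subset_diff add.commute)
  also have "sum g (T - U) \<le> real (card (T - U)) * a"
    using assms by (intro sum_bounded_above) auto
  also have "\<dots> \<le> real k * a"
    using assms card_mono[of T "T - U"] by (intro mult_right_mono) auto
  also have "sum g (T \<inter> U) \<le> real (card (T \<inter> U)) * b"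
    using assms by (intro sum_bounded_above) auto
  also have "\<dots> \<le> real u * b"
    using assms card_mono[of U "T \<inter> U"] by (intro mult_right_mono) auto
  finally show ?thesis by simp
qed

text \<open>The weights \<open>B ^ j\<close>, \<open>j * B ^ (j - 1)\<close> and \<open>(j choose 2) * B ^ (j - 2)\<close> of an intersection of
  size \<open>j\<close> are, up to constants, successive derivatives in \<open>B\<close>, and the three bounds follow the
  derivatives of \<open>(k + u * B) ^ m\<close>: each step of the construction hits \<open>U\<close> in at most \<open>u\<close> of its \<open>k\<close>
  choices. Only the joint induction on all three closes.\<close>

lemma greedy_clique_weights:
  assumes A: "finite A" "robust E k A m" and E: "\<And>x. {x} \<notin> E" and k: "0 < k"
    and U: "finite U" "card U \<le> u" and B: "0 \<le> B"
    and q_def: "q = real u / real k" and Y_def: "Y = real k + real u * B"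
  shows "(\<Sum>xs\<in>greedy_cliques E k A m. B ^ card (set xs \<inter> U)) \<le> Y ^ m" (is "?f0 A m \<le> _")
    and "(\<Sum>xs\<in>greedy_cliques E k A m. real (card (set xs \<inter> U)) * B ^ (card (set xs \<inter> U) - 1))
      \<le> real m * q * Y ^ m" (is "?f1 A m \<le> _")
    and "(\<Sum>xs\<in>greedy_cliques E k A m. real (card (set xs \<inter> U) choose 2) * B ^ (card (set xs \<inter> U) - 2))
      \<le> real m ^ 2 * q ^ 2 * Y ^ m" (is "?f2 A m \<le> _")
proof -
  have q: "0 \<le> q" "real u = q * real k" using k by (auto simp: q_def)
  have Y: "real k \<le> Y" "0 \<le> Y" using B by (auto simp: Y_def)
  have uY: "real u \<le> q * Y" unfolding q(2) using q Y by (intro mult_left_mono) auto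
  have "?f0 A m \<le> Y ^ m \<and> ?f1 A m \<le> real m * q * Y ^ m \<and> ?f2 A m \<le> real m ^ 2 * q ^ 2 * Y ^ m"
    using A
  proof (induction m arbitrary: A)
    case 0
    then show ?case by simp
  next
    case (Suc m)
    let ?T = "top_degree E k A"
    have T: "finite ?T" "card ?T \<le> k"
      using top_degree(1,2)[of A k E] Suc.prems by (auto intro: finite_subset)
    define g0 g1 g2 where "g0 x = ?f0 (nbhd E A x) m" and "g1 x = ?f1 (nbhd E A x) m"
      and "g2 x = ?f2 (nbhd E A x) m" for x
    define b1 b2 where "b1 = real m * q * Y ^ m" and "b2 = real m ^ 2 * q ^ 2 * Y ^ m"
    have b: "0 \<le> b1" "0 \<le> b2" "0 \<le> Y ^ m" using q Y by (auto simp: b1_def b2_def)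
    have IH: "g0 x \<le> Y ^ m" "g1 x \<le> b1" "g2 x \<le> b2" if "x \<in> ?T" for x
    proof -
      have "finite (nbhd E A x)" "robust E k (nbhd E A x) m" using Suc.prems that by auto
      note * = Suc.IH[OF this, folded g0_def g1_def g2_def b1_def b2_def]
      show "g0 x \<le> Y ^ m" "g1 x \<le> b1" "g2 x \<le> b2" using * by simp_all
    qed
    have IHB: "B * g0 x \<le> B * Y ^ m" "B * g1 x \<le> B * b1" "B * g2 x \<le> B * b2" if "x \<in> ?T" for x
      using IH[OF that] B by (simp_all add: mult_left_mono)
    have j: "card (insert x (set xs \<inter> U)) = Suc (card (set xs \<inter> U))"
      if "x \<in> ?T" "xs \<in> greedy_cliques E k (nbhd E A x) m" for x xs
    proof -
      have "set xs \<subseteq> nbhd E A x"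
        using greedy_cliques[of "nbhd E A x" E k m xs] Suc.prems that E by auto
      then have "x \<notin> set xs" using E[of x] by (auto simp: nbhd_def)
      then show ?thesis by simp
    qed
    have c2: "real (Suc i choose 2) * B ^ (i - Suc 0)
        = B * (real (i choose 2) * B ^ (i - 2)) + real i * B ^ (i - 1)" for i
    proof (cases "i \<ge> 2")
      case True
      then have "B ^ (i - 1) = B * B ^ (i - 2)" by (cases i; cases "i - 1") auto
      then show ?thesis by (simp add: numeral_2_eq_2 algebra_simps)
    next
      case False
      then have "i = 0 \<or> i = 1" by auto
      then show ?thesis by (auto simp: numeral_2_eq_2)
    qed
    have c1: "real (Suc i) * B ^ i = B * (real i * B ^ (i - 1)) + B ^ i" for i
      by (cases i) (simp_all add: algebra_simps)
    have f0: "?f0 A (Suc m) \<le> Y ^ Suc m"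
    proof -
      have "?f0 A (Suc m) = (\<Sum>x\<in>?T. if x \<in> U then B * g0 x else g0 x)"
        unfolding sum_greedy_cliques_Suc[OF Suc.prems] g0_def sum_distrib_left
        by (rule sum.cong[OF refl]) (auto simp: j intro!: sum.cong)
      also have "\<dots> \<le> real k * Y ^ m + real u * (B * Y ^ m)"
        by (rule sum_split_bound[OF T(1) U(1) T(2) U(2)]) (use b B IH IHB in simp_all)
      also have "\<dots> = Y ^ Suc m" by (simp add: Y_def algebra_simps)
      finally show ?thesis .
    qed
    have f1: "?f1 A (Suc m) \<le> real (Suc m) * q * Y ^ Suc m"
    proof -
      have "?f1 A (Suc m) = (\<Sum>x\<in>?T. if x \<in> U then B * g1 x + g0 x else g1 x)"
        unfolding sum_greedy_cliques_Suc[OF Suc.prems] g0_def g1_def sum_distrib_left sum.distrib[symmetric]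
        by (rule sum.cong[OF refl]) (auto simp: j c1 simp del: of_nat_Suc intro!: sum.cong)
      also have "\<dots> \<le> real k * b1 + real u * (B * b1 + Y ^ m)"
        by (rule sum_split_bound[OF T(1) U(1) T(2) U(2)]) (use b B IH IHB in \<open>simp_all add: add_mono\<close>)
      also have "\<dots> = Y * b1 + real u * Y ^ m" by (simp add: Y_def algebra_simps)
      also have "\<dots> \<le> Y * b1 + (q * Y) * Y ^ m"
        using uY Y by (intro add_left_mono mult_right_mono) auto
      finally show ?thesis by (simp add: b1_def algebra_simps)
    qed
    have f2: "?f2 A (Suc m) \<le> real (Suc m) ^ 2 * q ^ 2 * Y ^ Suc m"
    proof -
      have "?f2 A (Suc m) = (\<Sum>x\<in>?T. if x \<in> U then B * g2 x + g1 x else g2 x)"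
        unfolding sum_greedy_cliques_Suc[OF Suc.prems] g1_def g2_def sum_distrib_left sum.distrib[symmetric]
        by (rule sum.cong[OF refl]) (auto simp: j c2 simp del: binomial_Suc_Suc intro!: sum.cong)
      also have "\<dots> \<le> real k * b2 + real u * (B * b2 + b1)"
        by (rule sum_split_bound[OF T(1) U(1) T(2) U(2)]) (use b B IH IHB in \<open>simp_all add: add_mono\<close>)
      also have "\<dots> = Y * b2 + real u * b1" by (simp add: Y_def algebra_simps)
      also have "\<dots> \<le> Y * b2 + (q * Y) * b1"
        using uY b by (intro add_left_mono mult_right_mono) auto
      also have "\<dots> = (real m ^ 2 + real m) * (q ^ 2 * Y ^ Suc m)"
        by (simp add: b1_def b2_def algebra_simps power2_eq_square)
      also have "\<dots> \<le> real (Suc m) ^ 2 * (q ^ 2 * Y ^ Suc m)"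
        using Y by (intro mult_right_mono mult_nonneg_nonneg) (auto simp: power2_eq_square algebra_simps)
      finally show ?thesis by (simp add: mult.assoc)
    qed
    show ?case by (intro conjI f0 f1 f2)
  qed
  then show "?f0 A m \<le> Y ^ m" "?f1 A m \<le> real m * q * Y ^ m" "?f2 A m \<le> real m ^ 2 * q ^ 2 * Y ^ m"
    by simp_all
qed

lemma nsets_2_Int: "[A]\<^bsup>2\<^esup> \<inter> [B]\<^bsup>2\<^esup> = [A \<inter> B]\<^bsup>2\<^esup>"
  by (auto simp: nsets_def)

lemma card_nsets_2:
  assumes "finite A"
  shows "card ([A]\<^bsup>2\<^esup>) = card A choose 2"
proof -
  have "[A]\<^bsup>2\<^esup> = {B. B \<subseteq> A \<and> card B = 2}"
    using assms by (auto simp: nsets_def intro: finite_subset)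
  then show ?thesis using n_subsets[OF assms, of 2] by simp
qed

text \<open>Two cliques on \<open>r + 1\<close> vertices that share \<open>j\<close> vertices have \<open>j choose 2\<close> common edges. Beyond the
  first one these are paid for by the \<open>j - 2\<close> further coincidences of vertices, at the price of \<open>r\<close> edges
  each.\<close>

lemma pair_exponent_le:
  assumes "2 \<le> j" "j \<le> r + 1"
  shows "(j choose 2) - 1 \<le> r * (j - 2)"
proof -
  obtain i where i: "j = i + 2" using assms(1) by (metis add.commute le_Suc_ex)
  have "2 * (j choose 2) = (i + 2) * (i + 1)" unfolding i choose_two by simp
  moreover have "i * (i + 3) \<le> 2 * (r * i)"
  proof (cases i)
    case (Suc i')
    then have "i + 3 \<le> 2 * r" using assms i by auto
    then show ?thesis using mult_le_mono2[of "i + 3" "2 * r" i] by (simp add: algebra_simps)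
  qed simp
  ultimately show ?thesis unfolding i by (simp add: algebra_simps)
qed

text \<open>The greedy cliques are the well spread family for \<open>saturated_second_moment\<close>. Two of them rarely
  share an edge, and the numerical assumption says that this happens too rarely for saturation.\<close>

lemma saturated_not_robust:
  assumes V: "finite V" "C \<subseteq> [V]\<^bsup>2\<^esup>" and l: "0 < l" and d: "0 < d" and S: "cfree V (r + 1) S"
    and sat: "saturated (cfree V (r + 1)) l d C S" and k: "0 < k"
    and num: "d * real (card C) * (real (r + 1) ^ 2 * (real (r + 1) / real k) ^ 2
       * (real k + real (r + 1) * ((1 + l) / l) ^ r) ^ (r + 1)) < real k ^ (r + 1)"
  shows "\<not> robust C k V (r + 1)"
proof
  assume rob: "robust C k V (r + 1)"
  define P where "P = (1 + l) / l"
  define X where "X = greedy_cliques C k V (r + 1)"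
  define W where "W = real (r + 1) ^ 2 * (real (r + 1) / real k) ^ 2 * (real k + real (r + 1) * P ^ r) ^ (r + 1)"
  have P: "1 \<le> P" using l by (simp add: P_def)
  have fC: "finite C" using V finite_imp_finite_nsets finite_subset by blast
  have C1: "{x} \<notin> C" for x using V(2) by (auto simp: nsets_def)
  have X: "set xs \<subseteq> V" "card (set xs) = r + 1" "clique (set xs) C" if "xs \<in> X" for xs
    using greedy_cliques[OF V(1) rob that[unfolded X_def] C1] by (auto simp: distinct_card)
  have fX: "finite X" unfolding X_def using V(1) rob by (rule finite_greedy_cliques)
  have cX: "card X = k ^ (r + 1)" unfolding X_def using V(1) rob by (rule card_greedy_cliques)
  have "real (card X) ^ 2 \<le> d * real (card C) * (\<Sum>xs\<in>X. \<Sum>ys\<in>X.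
      real (card ([set xs]\<^bsup>2\<^esup> \<inter> [set ys]\<^bsup>2\<^esup>)) * P ^ (card ([set xs]\<^bsup>2\<^esup> \<inter> [set ys]\<^bsup>2\<^esup>) - 1))"
    unfolding P_def
  proof (rule saturated_second_moment[OF _ l d fC S sat fX])
    fix xs assume xs: "xs \<in> X"
    show "[set xs]\<^bsup>2\<^esup> \<subseteq> C" using X(3)[OF xs] by (auto simp: nsets_2_eq clique_def)
    have "clique (set xs) ([set xs]\<^bsup>2\<^esup>)" by (auto simp: clique_def)
    then show "\<not> cfree V (r + 1) ([set xs]\<^bsup>2\<^esup>)" using X[OF xs] by (auto simp: cfree_def)
  qed (rule cfree_antimono)
  also have "\<dots> \<le> d * real (card C) * (\<Sum>xs\<in>X. W)"
  proof (intro mult_left_mono sum_mono)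
    fix xs assume xs: "xs \<in> X"
    have "(\<Sum>ys\<in>X. real (card ([set xs]\<^bsup>2\<^esup> \<inter> [set ys]\<^bsup>2\<^esup>)) * P ^ (card ([set xs]\<^bsup>2\<^esup> \<inter> [set ys]\<^bsup>2\<^esup>) - 1))
      \<le> (\<Sum>ys\<in>X. real (card (set ys \<inter> set xs) choose 2) * (P ^ r) ^ (card (set ys \<inter> set xs) - 2))"
    proof (rule sum_mono)
      fix ys assume "ys \<in> X"
      define j where "j = card (set ys \<inter> set xs)"
      have j: "j \<le> r + 1" unfolding j_def X(2)[OF xs, symmetric] by (intro card_mono) auto
      have "real (j choose 2) * P ^ ((j choose 2) - 1) \<le> real (j choose 2) * (P ^ r) ^ (j - 2)"
      proof (cases "2 \<le> j")
        case True
        then have "P ^ ((j choose 2) - 1) \<le> P ^ (r * (j - 2))"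
          using P j by (intro power_increasing pair_exponent_le) auto
        then show ?thesis by (intro mult_left_mono) (auto simp: power_mult)
      qed (simp add: binomial_eq_0)
      then show "real (card ([set xs]\<^bsup>2\<^esup> \<inter> [set ys]\<^bsup>2\<^esup>)) * P ^ (card ([set xs]\<^bsup>2\<^esup> \<inter> [set ys]\<^bsup>2\<^esup>) - 1)
          \<le> real (card (set ys \<inter> set xs) choose 2) * (P ^ r) ^ (card (set ys \<inter> set xs) - 2)"
        by (simp add: nsets_2_Int card_nsets_2 j_def Int_commute)
    qed
    also have "\<dots> \<le> W"
      unfolding W_def X_def using X(2)[OF xs] P
      by (intro greedy_clique_weights(3)[OF V(1) rob C1 k _ _ _ refl refl]) auto
    finally show "(\<Sum>ys\<in>X. real (card ([set xs]\<^bsup>2\<^esup> \<inter> [set ys]\<^bsup>2\<^esup>)) *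
        P ^ (card ([set xs]\<^bsup>2\<^esup> \<inter> [set ys]\<^bsup>2\<^esup>) - 1)) \<le> W" .
  qed (use d in auto)
  also have "\<dots> = (d * real (card C) * W) * real (card X)" by simp
  also have "\<dots> < real k ^ (r + 1) * real (card X)"
    using num k by (intro mult_strict_right_mono) (auto simp: W_def P_def cX)
  finally show False by (simp add: cX power2_eq_square)
qed


section \<open>Stability\<close>

definition mono_edges :: "'a set set \<Rightarrow> ('a \<Rightarrow> 'b) \<Rightarrow> 'a set set" where
  "mono_edges E c = {e\<in>E. \<forall>u\<in>e. \<forall>v\<in>e. c u = c v}"

definition cross_edges :: "'a set \<Rightarrow> ('a \<Rightarrow> 'b) \<Rightarrow> 'a set set" where
  "cross_edges V c = {e\<in>[V]\<^bsup>2\<^esup>. \<exists>u\<in>e. \<exists>v\<in>e. c u \<noteq> c v}"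

lemma mono_edges_iff [simp]: "{u, v} \<in> mono_edges E c \<longleftrightarrow> {u, v} \<in> E \<and> c u = c v"
  by (auto simp: mono_edges_def)

lemma cross_edges_iff [simp]: "{u, v} \<in> cross_edges V c \<longleftrightarrow> u \<in> V \<and> v \<in> V \<and> c u \<noteq> c v"
  by (auto simp: cross_edges_def)

lemma sum_ordered_pairs:
  assumes "finite V" "E \<subseteq> [V]\<^bsup>2\<^esup>"
  shows "(\<Sum>u\<in>V. \<Sum>v\<in>V. of_bool ({u, v} \<in> E)) = 2 * real (card E)"
proof -
  have "finite E" using assms finite_imp_finite_nsets finite_subset by blast
  then show ?thesis
    using assms(2)
  proof (induction E)
    case (insert e E)
    obtain a b where e: "e = {a, b}" "a \<noteq> b" "a \<in> V" "b \<in> V"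
      using insert.prems by (auto elim!: nsets2_E)
    have p: "{u, v} = e \<longleftrightarrow> (u = a \<and> v = b) \<or> (u = b \<and> v = a)" for u v
      using e by (auto simp: doubleton_eq_iff)
    have "(\<Sum>u\<in>V. \<Sum>v\<in>V. of_bool ({u, v} \<in> insert e E)) = (\<Sum>u\<in>V. \<Sum>v\<in>V. (of_bool ({u, v} \<in> E)
        + (if v = b then of_bool (u = a) else 0) + (if v = a then of_bool (u = b) else 0) :: real))"
    proof (rule sum.cong[OF refl], rule sum.cong[OF refl])
      fix u v
      show "of_bool ({u, v} \<in> insert e E) = (of_bool ({u, v} \<in> E)
        + (if v = b then of_bool (u = a) else 0) + (if v = a then of_bool (u = b) else 0) :: real)"
        using insert.hyps(2) e(2) p[of u v] by (cases "{u, v} = e") auto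
    qed
    also have "\<dots> = (\<Sum>u\<in>V. \<Sum>v\<in>V. of_bool ({u, v} \<in> E)) + (\<Sum>u\<in>V. of_bool (u = a)) + (\<Sum>u\<in>V. of_bool (u = b))"
      using e assms(1) by (simp add: sum.distrib)
    also have "\<dots> = 2 * real (card E) + 1 + 1"
      using insert.IH insert.prems e assms(1) by (simp add: of_bool_def)
    finally show ?case using insert.hyps by simp
  qed simp
qed

lemma sum_card_color_classes:
  assumes "finite V" "c ` V \<subseteq> {..<r::nat}"
  shows "(\<Sum>i<r. card {v\<in>V. c v = i}) = card V"
proof -
  have "card (\<Union>i<r. {v\<in>V. c v = i}) = (\<Sum>i<r. card {v\<in>V. c v = i})"
    using assms(1) by (intro card_UN_disjoint) auto
  moreover have "(\<Union>i<r. {v\<in>V. c v = i}) = V" using assms(2) by auto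
  ultimately show ?thesis by simp
qed

lemma sum_cross_pairs:
  assumes "finite V" "c ` V \<subseteq> {..<r::nat}"
  shows "(\<Sum>u\<in>V. \<Sum>v\<in>V. of_bool (c u \<noteq> c v)) = real (card V) ^ 2 - (\<Sum>i<r. real (card {v\<in>V. c v = i}) ^ 2)"
proof -
  have "(\<Sum>u\<in>V. \<Sum>v\<in>V. of_bool (c u = c v)) = (\<Sum>u\<in>V. \<Sum>v\<in>V. \<Sum>i<r. (of_bool (c u = i) * of_bool (c v = i) :: real))"
  proof (rule sum.cong[OF refl], rule sum.cong[OF refl])
    fix u v assume "u \<in> V" "v \<in> V"
    then have "c u \<in> {..<r}" using assms(2) by blast
    then have "(\<Sum>i<r. (of_bool (c u = i) * of_bool (c v = i) :: real)) = (\<Sum>i<r. if i = c u then of_bool (c v = c u) else 0)"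
      by (intro sum.cong) auto
    then show "of_bool (c u = c v) = (\<Sum>i<r. (of_bool (c u = i) * of_bool (c v = i) :: real))"
      using \<open>c u \<in> {..<r}\<close> by (auto simp: of_bool_def)
  qed
  also have "\<dots> = (\<Sum>u\<in>V. \<Sum>i<r. \<Sum>v\<in>V. (of_bool (c u = i) * of_bool (c v = i) :: real))"
    by (rule sum.cong[OF refl], rule sum.swap)
  also have "\<dots> = (\<Sum>i<r. \<Sum>u\<in>V. \<Sum>v\<in>V. (of_bool (c u = i) * of_bool (c v = i) :: real))"
    by (rule sum.swap)
  also have "\<dots> = (\<Sum>i<r. real (card {v\<in>V. c v = i}) ^ 2)"
  proof (rule sum.cong[OF refl])
    fix i
    have "(\<Sum>u\<in>V. of_bool (c u = i)) = real (card {v\<in>V. c v = i})"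
      using assms(1) by (simp add: of_bool_def sum.If_cases Int_def)
    then show "(\<Sum>u\<in>V. \<Sum>v\<in>V. (of_bool (c u = i) * of_bool (c v = i) :: real)) = real (card {v\<in>V. c v = i}) ^ 2"
      by (simp only: sum_product[symmetric] power2_eq_square)
  qed
  finally have "(\<Sum>u\<in>V. \<Sum>v\<in>V. of_bool (c u = c v)) = (\<Sum>i<r. real (card {v\<in>V. c v = i}) ^ 2)" .
  moreover have "(\<Sum>u\<in>V. \<Sum>v\<in>V. of_bool (c u = c v)) + (\<Sum>u\<in>V. \<Sum>v\<in>V. of_bool (c u \<noteq> c v)) = (\<Sum>u\<in>V. \<Sum>v\<in>V. (1::real))"
    unfolding sum.distrib[symmetric] by (intro sum.cong refl) auto
  ultimately show ?thesis by (simp add: power2_eq_square)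
qed

lemma card_cross_edges:
  assumes "finite V" "c ` V \<subseteq> {..<r::nat}" "0 < r"
  shows "real (card (cross_edges V c)) = (1 - 1 / real r) * real (card V) ^ 2 / 2
    - (\<Sum>i<r. (real (card {v\<in>V. c v = i}) - real (card V) / real r) ^ 2) / 2"
proof -
  have "2 * real (card (cross_edges V c)) = (\<Sum>u\<in>V. \<Sum>v\<in>V. of_bool ({u, v} \<in> cross_edges V c))"
    by (rule sum_ordered_pairs[symmetric, OF assms(1)]) (auto simp: cross_edges_def)
  also have "\<dots> = (\<Sum>u\<in>V. \<Sum>v\<in>V. of_bool (c u \<noteq> c v))"
    by (intro sum.cong) auto
  also have "\<dots> = real (card V) ^ 2 - (\<Sum>i<r. real (card {v\<in>V. c v = i}) ^ 2)"
    by (rule sum_cross_pairs[OF assms(1,2)])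
  finally have 1: "2 * real (card (cross_edges V c)) = real (card V) ^ 2 - (\<Sum>i<r. real (card {v\<in>V. c v = i}) ^ 2)" .
  define n where "n = real (card V)"
  define s where "s i = real (card {v\<in>V. c v = i})" for i
  have s: "(\<Sum>i<r. s i) = n"
    unfolding s_def n_def sum_card_color_classes[OF assms(1,2), symmetric] by simp
  have "(\<Sum>i<r. (s i - n / real r) ^ 2) = (\<Sum>i<r. s i ^ 2 - 2 * (n / real r) * s i + (n / real r) ^ 2)"
    by (intro sum.cong refl) (simp add: power2_eq_square algebra_simps)
  also have "\<dots> = (\<Sum>i<r. s i ^ 2) - 2 * (n / real r) * n + real r * (n / real r) ^ 2"
    by (simp only: sum.distrib sum_subtractf sum_distrib_left[symmetric] s sum_constant card_lessThan)
  also have "\<dots> = (\<Sum>i<r. s i ^ 2) - n ^ 2 / real r"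
    using assms(3) by (simp add: power2_eq_square field_simps)
  finally have "(\<Sum>i<r. (s i - n / real r) ^ 2) = (\<Sum>i<r. s i ^ 2) - n ^ 2 / real r" .
  then show ?thesis using 1 unfolding n_def[symmetric] s_def[symmetric]
    by (simp add: algebra_simps diff_divide_distrib)
qed

lemma sum_degrees_le:
  assumes "finite A" "k \<le> card A" "x \<in> top_degree E k A" "B \<subseteq> A" "card A \<le> n"
  shows "(\<Sum>u\<in>B. real (card (nbhd E A u))) \<le> real (card B) * real (card (nbhd E A x)) + real k * real n"
proof -
  let ?T = "top_degree E k A"
  note T = top_degree[OF assms(1,2), where E = E]
  have fT: "finite ?T" and fB: "finite B" using T(1) assms by (auto intro: finite_subset)
  have "(\<Sum>u\<in>B. real (card (nbhd E A u))) \<le> real (card B) * real (card (nbhd E A x)) + real k * (real n)"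
  proof (rule sum_split_bound[where U = ?T])
    show "real (card (nbhd E A u)) \<le> real (card (nbhd E A x))" if "u \<in> B" "u \<notin> ?T" for u
      using T(3)[OF assms(3)] that assms(4) by auto
    show "real (card (nbhd E A u)) \<le> real n" if "u \<in> B" "u \<in> ?T" for u
      using card_mono[OF assms(1) nbhd_subset[of E A u]] assms(5) by linarith
  qed (use T(2) fT fB in auto)
  then show ?thesis .
qed

text \<open>Summed over all ordered pairs of vertices this is twice the number of edges, plus twice the number
  of monochromatic edges, minus twice the number of pairs of different colours.\<close>

definition excess :: "'a set set \<Rightarrow> ('a \<Rightarrow> nat) \<Rightarrow> 'a \<Rightarrow> 'a \<Rightarrow> real" where
  "excess E c u v = (if c u = c v then 2 * of_bool ({u, v} \<in> E) else of_bool ({u, v} \<in> E) - 1)"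

lemma sum_adjacent: "finite A \<Longrightarrow> (\<Sum>v\<in>A. of_bool ({u, v} \<in> E)) = real (card (nbhd E A u))"
  by (simp add: of_bool_def sum.If_cases nbhd_def Int_def)

text \<open>If the greedy procedure gets stuck after some choices of \<open>x\<close>, colour the vertices by the step in
  which they leave the common neighbourhood. In the step from \<open>A\<close> to \<open>nbhd E A x\<close> all but \<open>k\<close> vertices
  have degree at most \<open>card (nbhd E A x)\<close>, so the new class \<open>A - nbhd E A x\<close> contributes to the
  excess at most as many edges, its monochromatic ones counted twice, as it creates pairs of
  different colours, up to \<open>k * n\<close>. This is the degree argument behind Turan's theorem, tolerant to \<open>k\<close> exceptional vertices per step.\<close>

lemma stable_coloring:
  assumes "finite A" "card A \<le> n" "\<not> robust E k A (Suc (Suc m))"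
  shows "\<exists>c. c ` A \<subseteq> {..<Suc m} \<and> (\<Sum>u\<in>A. \<Sum>v\<in>A. excess E c u v) \<le> 2 * real (m + 2) * real k * real n"
  using assms
proof (induction m arbitrary: A)
  case 0
  have S: "(\<Sum>u\<in>A. \<Sum>v\<in>A. excess E (\<lambda>_. 0) u v) = 2 * (\<Sum>u\<in>A. real (card (nbhd E A u)))"
    using 0 by (simp add: excess_def sum_distrib_left[symmetric] sum_adjacent del: sum_of_bool_eq)
  have "(\<Sum>u\<in>A. real (card (nbhd E A u))) \<le> 2 * (real k * real n)"
  proof (cases "k \<le> card A")
    case True
    then obtain x where x: "x \<in> top_degree E k A" "\<not> robust E k (nbhd E A x) 1" using 0 by auto
    then have "card (nbhd E A x) \<le> k" by simp
    have "(\<Sum>u\<in>A. real (card (nbhd E A u))) \<le> real (card A) * real (card (nbhd E A x)) + real k * real n"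
      using 0 True x by (intro sum_degrees_le) auto
    also have "\<dots> \<le> real n * real k + real k * real n"
      using 0 \<open>card (nbhd E A x) \<le> k\<close> by (intro add_mono mult_mono) auto
    finally show ?thesis by simp
  next
    case False
    have "(\<Sum>u\<in>A. real (card (nbhd E A u))) \<le> (\<Sum>u\<in>A. real (card A))"
      using card_mono[OF 0(1) nbhd_subset[of E A]] by (intro sum_mono) simp
    also have "\<dots> \<le> real k * real n" using False 0 by (simp add: mult_mono)
    finally show ?thesis by (smt (verit) mult_nonneg_nonneg of_nat_0_le_iff)
  qed
  then show ?case using S by (intro exI[of _ "\<lambda>_. 0"]) auto
next
  case (Suc m)
  show ?case
  proof (cases "k \<le> card A")
    case True
    then obtain x where x: "x \<in> top_degree E k A" and nr: "\<not> robust E k (nbhd E A x) (Suc (Suc m))"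
      using Suc.prems by auto
    define A' where "A' = nbhd E A x"
    define B where "B = A - A'"
    have AA: "A' \<subseteq> A" "finite A'" "finite B" "A = A' \<union> B" "A' \<inter> B = {}" "card A' \<le> n"
      using Suc.prems nbhd_subset[of E A x] card_mono[OF Suc.prems(1) nbhd_subset[of E A x]]
      by (auto simp: A'_def B_def)
    obtain c' where c': "c' ` A' \<subseteq> {..<Suc m}"
        "(\<Sum>u\<in>A'. \<Sum>v\<in>A'. excess E c' u v) \<le> 2 * real (m + 2) * real k * real n"
      using Suc.IH[of A'] nr AA unfolding A'_def by blast
    define c where "c v = (if v \<in> A' then c' v else Suc m)" for v
    have cr: "c ` A \<subseteq> {..<Suc (Suc m)}" using c'(1) by (auto simp: c_def)
    have ne: "c u \<noteq> Suc m" if "u \<in> A'" for u using c'(1) that by (auto simp: c_def)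
    have cB: "c u = Suc m" if "u \<in> B" for u using that by (auto simp: c_def B_def)
    let ?a = "\<lambda>u v. of_bool ({u, v} \<in> E) :: real"
    have e1: "(\<Sum>u\<in>A'. \<Sum>v\<in>A'. excess E c u v) = (\<Sum>u\<in>A'. \<Sum>v\<in>A'. excess E c' u v)"
      by (intro sum.cong refl) (auto simp: excess_def c_def)
    have e2: "(\<Sum>u\<in>B. \<Sum>v\<in>A'. excess E c u v) = (\<Sum>u\<in>B. \<Sum>v\<in>A'. ?a u v) - real (card B) * real (card A')"
    proof -
      have "(\<Sum>u\<in>B. \<Sum>v\<in>A'. excess E c u v) = (\<Sum>u\<in>B. \<Sum>v\<in>A'. ?a u v - 1)"
      proof (rule sum.cong[OF refl], rule sum.cong[OF refl])
        fix u v assume "u \<in> B" "v \<in> A'"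
        then have "c u \<noteq> c v" using ne[of v] cB[of u] by simp
        then show "excess E c u v = ?a u v - 1" by (simp add: excess_def)
      qed
      then show ?thesis by (simp add: sum_subtractf del: sum_of_bool_eq)
    qed
    have e3: "(\<Sum>u\<in>A'. \<Sum>v\<in>B. excess E c u v) = (\<Sum>u\<in>B. \<Sum>v\<in>A'. excess E c u v)"
      by (subst sum.swap) (auto simp: excess_def insert_commute eq_commute intro!: sum.cong)
    have e4: "(\<Sum>u\<in>B. \<Sum>v\<in>B. excess E c u v) = 2 * (\<Sum>u\<in>B. \<Sum>v\<in>B. ?a u v)"
      unfolding sum_distrib_left using cB by (intro sum.cong refl) (auto simp: excess_def)
    have "(\<Sum>u\<in>A. \<Sum>v\<in>A. excess E c u v) = (\<Sum>u\<in>A'. \<Sum>v\<in>A'. excess E c u v) + (\<Sum>u\<in>A'. \<Sum>v\<in>B. excess E c u v)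
        + ((\<Sum>u\<in>B. \<Sum>v\<in>A'. excess E c u v) + (\<Sum>u\<in>B. \<Sum>v\<in>B. excess E c u v))"
      unfolding AA(4) using AA by (simp add: sum.union_disjoint sum.distrib)
    also have "\<dots> = (\<Sum>u\<in>A'. \<Sum>v\<in>A'. excess E c' u v)
        + 2 * ((\<Sum>u\<in>B. \<Sum>v\<in>A'. ?a u v) + (\<Sum>u\<in>B. \<Sum>v\<in>B. ?a u v) - real (card B) * real (card A'))"
      unfolding e1 e3 e4 e2 by simp
    also have "(\<Sum>u\<in>B. \<Sum>v\<in>A'. ?a u v) + (\<Sum>u\<in>B. \<Sum>v\<in>B. ?a u v) = (\<Sum>u\<in>B. \<Sum>v\<in>A. ?a u v)"
      unfolding AA(4) using AA by (simp add: sum.union_disjoint sum.distrib del: sum_of_bool_eq)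
    also have "\<dots> = (\<Sum>u\<in>B. real (card (nbhd E A u)))"
      using Suc.prems by (simp only: sum_adjacent)
    also have "\<dots> \<le> real (card B) * real (card A') + real k * real n"
      unfolding A'_def using Suc.prems True x by (intro sum_degrees_le) (auto simp: B_def)
    finally have "(\<Sum>u\<in>A. \<Sum>v\<in>A. excess E c u v) \<le> 2 * real (Suc m + 2) * real k * real n"
      using c'(2) by (simp add: algebra_simps)
    then show ?thesis using cr by blast
  next
    case False
    have "(\<Sum>u\<in>A. \<Sum>v\<in>A. excess E (\<lambda>_. 0) u v) \<le> (\<Sum>u\<in>A. \<Sum>v\<in>A. 2)"
      by (intro sum_mono) (auto simp: excess_def)
    also have "\<dots> = 2 * (real (card A) * real (card A))" by simp
    also have "\<dots> \<le> 2 * (real k * real n)" using False Suc.prems by (intro mult_left_mono mult_mono) auto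
    also have "\<dots> \<le> real (Suc m + 2) * (2 * (real k * real n))"
      using mult_right_mono[of 1 "real (Suc m + 2)" "2 * (real k * real n)"] by simp
    finally show ?thesis by (intro exI[of _ "\<lambda>_. 0"]) (auto simp: mult_ac)
  qed
qed

lemma stability:
  assumes V: "finite V" "E \<subseteq> [V]\<^bsup>2\<^esup>" and r: "0 < r" and nr: "\<not> robust E k V (r + 1)"
  shows "\<exists>c. c ` V \<subseteq> {..<r} \<and> real (card E) + real (card (mono_edges E c))
    \<le> (1 - 1 / real r) * real (card V) ^ 2 / 2 + real (r + 1) * real k * real (card V)"
proof -
  obtain m where m: "r = Suc m" using r by (cases r) auto
  obtain c where c: "c ` V \<subseteq> {..<r}"
    "(\<Sum>u\<in>V. \<Sum>v\<in>V. excess E c u v) \<le> 2 * real (r + 1) * real k * real (card V)"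
    using stable_coloring[of V "card V" E k m] V nr by (auto simp: m)
  have "(\<Sum>u\<in>V. \<Sum>v\<in>V. excess E c u v) = (\<Sum>u\<in>V. \<Sum>v\<in>V. of_bool ({u, v} \<in> E)
      + of_bool ({u, v} \<in> mono_edges E c) - of_bool ({u, v} \<in> cross_edges V c))"
    by (intro sum.cong refl) (auto simp: excess_def)
  also have "\<dots> = 2 * real (card E) + 2 * real (card (mono_edges E c)) - 2 * real (card (cross_edges V c))"
    unfolding sum.distrib sum_subtractf using V
    by (subst (1 2 3) sum_ordered_pairs) (auto simp: mono_edges_def cross_edges_def)
  finally have "real (card E) + real (card (mono_edges E c))
      \<le> real (card (cross_edges V c)) + real (r + 1) * real k * real (card V)"
    using c(2) by (simp add: algebra_simps)
  moreover have "real (card (cross_edges V c)) \<le> (1 - 1 / real r) * real (card V) ^ 2 / 2"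
    unfolding card_cross_edges[OF V(1) c(1) r] by (simp add: sum_nonneg)
  ultimately have "real (card E) + real (card (mono_edges E c))
    \<le> (1 - 1 / real r) * real (card V) ^ 2 / 2 + real (r + 1) * real k * real (card V)"
    by linarith
  then show ?thesis using c(1) by blast
qed

section \<open>Containers for clique-free graphs\<close>

lemma card_nsets_2_le: "finite V \<Longrightarrow> real (card ([V]\<^bsup>2\<^esup>)) \<le> real (card V) ^ 2 / 2"
proof -
  assume V: "finite V"
  have "2 * (card V choose 2) \<le> card V * (card V - 1)" unfolding choose_two by (rule times_div_less_eq_dividend)
  also have "\<dots> \<le> card V * card V" by simp
  finally have "2 * (card V choose 2) \<le> card V * card V" .
  then have "2 * real (card V choose 2) \<le> real (card V) ^ 2"
    unfolding power2_eq_square by (metis of_nat_le_iff of_nat_mult of_nat_numeral)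
  then show ?thesis by (simp add: card_nsets_2[OF V])
qed

text \<open>The exponents are chosen from the end: \<open>k = card V / L ^ 19\<close> is small enough for the error of
  \<open>stability\<close>, \<open>d = 1 / L ^ 43\<close> is below \<open>(k / card V)\<^sup>2\<close> by the factor that
  \<open>saturated_not_robust\<close> asks for, and \<open>l = 1 / L ^ 61\<close> makes both the number of containers and the
  sets \<open>S\<close> negligible. The lower bound on \<open>card V\<close> is what keeps \<open>l ^ (- r)\<close> below \<open>k\<close>.\<close>

lemma clique_free_containers:
  fixes L :: real
  assumes V: "finite V" and r: "1 \<le> r" "real (r + 1) \<le> L" and L: "100 \<le> L" "36 * ln L \<le> L"
    and n: "L ^ (62 * r + 22) \<le> real (card V)"
  shows "\<exists>F. finite F \<and> real (card F) \<le> exp (real (card V) ^ 2 / L ^ 17) \<and>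
    (\<forall>G. G \<subseteq> [V]\<^bsup>2\<^esup> \<and> cfree V (r + 1) G \<longrightarrow> (\<exists>X\<in>F. G \<subseteq> X)) \<and>
    (\<forall>X\<in>F. X \<subseteq> [V]\<^bsup>2\<^esup> \<and> (\<exists>c. c ` V \<subseteq> {..<r} \<and> real (card X) + real (card (mono_edges X c))
       \<le> (1 - 1 / real r) * real (card V) ^ 2 / 2 + 4 * real (card V) ^ 2 / L ^ 18))"
proof -
  define N where "N = real (card V)"
  define d l y where "d = 1 / L ^ 43" and "l = 1 / L ^ 61" and "y = 1 / L ^ 18"
  define k where "k = nat \<lceil>N / L ^ 19\<rceil>"
  let ?I = "cfree V (r + 1)"
  have L1: "1 \<le> L" "0 < L" using L by auto
  have pw: "L ^ a \<le> L ^ b" if "a \<le> b" for a b using L1 that by (simp add: power_increasing)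
  have dly: "0 < d" "d < 1" "0 < l" "0 < y" "y \<le> 1"
    using L by (auto simp: d_def l_def y_def)
  have N19: "L ^ 19 \<le> N" using n pw[of 19 "62 * r + 22"] by (simp add: N_def)
  have N1: "1 \<le> N" using N19 L1 one_le_power[of L 19] by linarith
  have k1: "N / L ^ 19 \<le> real k" unfolding k_def by linarith
  have k0: "0 < real k" using k1 N1 L1 by (smt (verit) divide_pos_pos zero_less_power)
  have k2: "real k \<le> 2 * N / L ^ 19"
  proof -
    have "1 \<le> N / L ^ 19" using N19 L1 by simp
    then show ?thesis unfolding k_def by linarith
  qed
  have E: "finite ([V]\<^bsup>2\<^esup>)" using V by (rule finite_imp_finite_nsets)
  have Ecard: "real (card ([V]\<^bsup>2\<^esup>)) \<le> N ^ 2 / 2" unfolding N_def using V by (rule card_nsets_2_le)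
  have empty: "?I {}"
  proof -
    have "False" if S: "S \<subseteq> V" "card S = r + 1" "clique S {}" for S
    proof -
      have "finite S" "2 \<le> card S" using S V r by (auto intro: finite_subset)
      then obtain T where "T \<subseteq> S" "card T = 2" by (meson obtain_subset_with_card_n)
      then show False using S(3) by (auto simp: clique_def card_2_iff)
    qed
    then show ?thesis by (auto simp: cfree_def)
  qed
  have "\<exists>F. finite F \<and> real (card F) \<le> exp (real (card ([V]\<^bsup>2\<^esup>)) * (y + l * (ln (1 / y) / d))) \<and>
    (\<forall>J. ?I J \<and> J \<subseteq> [V]\<^bsup>2\<^esup> \<longrightarrow> (\<exists>C S. (C, S) \<in> F \<and> J \<subseteq> C \<union> S)) \<and>
    (\<forall>C S. (C, S) \<in> F \<longrightarrow> saturated ?I l d C S \<and> C \<subseteq> [V]\<^bsup>2\<^esup> \<and> S \<subseteq> [V]\<^bsup>2\<^esup> \<and> ?I S \<and>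
       d * real (card S) \<le> l * real (card ([V]\<^bsup>2\<^esup>)))"
  proof (rule containers[where I = ?I])
    show "?I A" if "A \<subseteq> B" "?I B" for A B using that by (rule cfree_antimono)
    show "?I {}" by (rule empty)
  qed (use dly E in simp_all)
  then obtain F where F: "finite F" "real (card F) \<le> exp (real (card ([V]\<^bsup>2\<^esup>)) * (y + l * (ln (1 / y) / d)))"
      "\<And>J. ?I J \<Longrightarrow> J \<subseteq> [V]\<^bsup>2\<^esup> \<Longrightarrow> \<exists>C S. (C, S) \<in> F \<and> J \<subseteq> C \<union> S"
      "\<And>C S. (C, S) \<in> F \<Longrightarrow> saturated ?I l d C S"
      "\<And>C S. (C, S) \<in> F \<Longrightarrow> C \<subseteq> [V]\<^bsup>2\<^esup>" "\<And>C S. (C, S) \<in> F \<Longrightarrow> S \<subseteq> [V]\<^bsup>2\<^esup>" "\<And>C S. (C, S) \<in> F \<Longrightarrow> ?I S"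
      "\<And>C S. (C, S) \<in> F \<Longrightarrow> d * real (card S) \<le> l * real (card ([V]\<^bsup>2\<^esup>))"
    by auto
  have cardF: "real (card F) \<le> exp (N ^ 2 / L ^ 17)"
  proof -
    have "ln (1 / y) = 18 * ln L" using L1 by (simp add: y_def ln_realpow)
    moreover have "l / d = y" using L1 by (simp add: l_def d_def y_def field_simps power_add[symmetric])
    moreover have "l * (ln (1 / y) / d) = (l / d) * ln (1 / y)" by simp
    ultimately have "y + l * (ln (1 / y) / d) = y * (1 + 18 * ln L)"
      by (simp only: distrib_left mult_1_right)
    also have "\<dots> \<le> y * (2 * L)" using L dly by (intro mult_left_mono) auto
    also have "\<dots> = 2 / L ^ 17" using L1 by (simp add: y_def power_eq_if)
    finally have 1: "y + l * (ln (1 / y) / d) \<le> 2 / L ^ 17" .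
    have "real (card ([V]\<^bsup>2\<^esup>)) * (y + l * (ln (1 / y) / d)) \<le> real (card ([V]\<^bsup>2\<^esup>)) * (2 / L ^ 17)"
      using 1 by (intro mult_left_mono) auto
    also have "\<dots> \<le> N ^ 2 / 2 * (2 / L ^ 17)"
      using Ecard L1 by (intro mult_right_mono) auto
    finally have "exp (real (card ([V]\<^bsup>2\<^esup>)) * (y + l * (ln (1 / y) / d))) \<le> exp (N ^ 2 / L ^ 17)" by simp
    then show ?thesis using F(2) by linarith
  qed
  have Scard: "real (card S) \<le> N ^ 2 / (2 * L ^ 18)" if "(C, S) \<in> F" for C S
  proof -
    have "d * real (card S) \<le> l * (N ^ 2 / 2)"
      using F(8)[OF that] Ecard dly by (meson mult_left_mono order_trans less_imp_le)
    also have "\<dots> = d * (N ^ 2 / (2 * L ^ 18))"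
      using L1 by (simp add: l_def d_def field_simps power_add[symmetric])
    finally show ?thesis using dly(1) by (simp only: mult_le_cancel_left_pos)
  qed
  have col: "\<exists>c. c ` V \<subseteq> {..<r} \<and> real (card (C \<union> S)) + real (card (mono_edges (C \<union> S) c))
       \<le> (1 - 1 / real r) * N ^ 2 / 2 + 4 * N ^ 2 / L ^ 18" if CS: "(C, S) \<in> F" for C S
  proof -
    note C = F(5)[OF CS] and S = F(6)[OF CS]
    have fin: "finite C" "finite S" using C S E finite_subset by auto
    define P where "P = (1 + l) / l"
    have P: "0 < P" "P \<le> L ^ 62"
    proof -
      have "P = 1 + L ^ 61" using L1 by (simp add: P_def l_def field_simps)
      also have "\<dots> \<le> L ^ 61 + L ^ 61" using L1 by simp
      also have "\<dots> \<le> L * L ^ 61" using L by simp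
      finally show "P \<le> L ^ 62" by (simp add: power_Suc[symmetric] del: power_Suc)
      show "0 < P" using dly by (simp add: P_def)
    qed
    define z where "z = real (r + 1) * P ^ r / real k"
    have z: "real (r + 1) * z \<le> 1 / 2" "0 \<le> z"
    proof -
      have "real (r + 1) * z = real (r + 1) * (real (r + 1) * P ^ r) / real k" by (simp add: z_def)
      also have "\<dots> \<le> L * (L * (L ^ 62) ^ r) / real k"
        using r(2) P L1 k0 by (intro divide_right_mono mult_mono power_mono) auto
      also have "\<dots> \<le> L * (L * (L ^ 62) ^ r) / (N / L ^ 19)"
        using k0 k1 N1 L1 by (intro divide_left_mono) (auto intro!: mult_pos_pos divide_pos_pos)
      also have "\<dots> = L ^ (62 * r + 21) / N"
      proof -
        have "62 * r + 21 = 62 * r + 1 + 1 + 19" by simp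
        then have "L ^ (62 * r + 21) = L ^ (62 * r + 1 + 1 + 19)" by (simp only:)
        also have "\<dots> = (L ^ 62) ^ r * L * L * L ^ 19"
          by (simp only: power_add power_mult power_one_right)
        finally show ?thesis by (simp add: mult_ac)
      qed
      also have "\<dots> \<le> L ^ (62 * r + 21) / L ^ (62 * r + 22)"
        using n L1 N1 by (intro divide_left_mono) (auto simp: N_def intro!: mult_pos_pos)
      also have "\<dots> = 1 / L"
      proof -
        have "62 * r + 22 = Suc (62 * r + 21)" by simp
        then have "L ^ (62 * r + 22) = L ^ (62 * r + 21) * L" by (simp only: power_Suc2)
        then show ?thesis using L1 by simp
      qed
      also have "\<dots> \<le> 1 / 2" using L by (simp add: field_simps)
      finally show "real (r + 1) * z \<le> 1 / 2" .
      show "0 \<le> z" using P by (simp add: z_def)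
    qed
    have "\<not> robust C k V (r + 1)"
    proof (rule saturated_not_robust[OF V C dly(3,1) F(7)[OF CS] F(4)[OF CS]])
      have "real k * (1 + z) = real k + real (r + 1) * P ^ r"
        using k0 by (simp add: z_def distrib_left)
      then have "(real k + real (r + 1) * P ^ r) ^ (r + 1) = (real k * (1 + z)) ^ (r + 1)"
        by (simp only:)
      also have "\<dots> = real k ^ (r + 1) * (1 + z) ^ (r + 1)" by (rule power_mult_distrib)
      also have "\<dots> \<le> real k ^ (r + 1) * 2"
      proof (rule mult_left_mono)
        have "(1 + z) ^ (r + 1) \<le> exp z ^ (r + 1)" using z by (intro power_mono) auto
        also have "\<dots> = exp (real (r + 1) * z)" by (simp only: exp_of_nat_mult)
        also have "\<dots> \<le> exp (1 / 2)" using z by simp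
        also have "\<dots> \<le> 2" using exp_bound[of "1 / 2"] by (simp add: power2_eq_square)
        finally show "(1 + z) ^ (r + 1) \<le> 2" .
      qed (use k0 in simp)
      finally have b1: "(real k + real (r + 1) * P ^ r) ^ (r + 1) \<le> real k ^ (r + 1) * 2" .
      have b2: "d * real (card C) * (real (r + 1) ^ 2 * (real (r + 1) / real k) ^ 2) \<le> 1 / (2 * L)"
      proof -
        have "real (card C) \<le> N ^ 2 / 2" using card_mono[OF E C] Ecard by linarith
        moreover have "real (r + 1) / real k \<le> L / (N / L ^ 19)"
          using r(2) k1 N1 L1 by (intro frac_le) auto
        ultimately have "d * real (card C) * (real (r + 1) ^ 2 * (real (r + 1) / real k) ^ 2)
            \<le> d * (N ^ 2 / 2) * (L ^ 2 * (L / (N / L ^ 19)) ^ 2)"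
          using dly r(2) k0 by (intro mult_mono power_mono) auto
        also have "\<dots> = 1 / (2 * L)"
        proof -
          have "L ^ 43 = L ^ Suc 42" by simp
          then have "L ^ 43 = L * L ^ 42" by (simp only: power_Suc)
          then show ?thesis
            using N1 L1 by (simp add: d_def field_simps power_add[symmetric] power_mult_distrib power_mult[symmetric])
        qed
        finally show ?thesis .
      qed
      have "d * real (card C) * (real (r + 1) ^ 2 * (real (r + 1) / real k) ^ 2
          * (real k + real (r + 1) * P ^ r) ^ (r + 1))
        = d * real (card C) * (real (r + 1) ^ 2 * (real (r + 1) / real k) ^ 2) *
          (real k + real (r + 1) * P ^ r) ^ (r + 1)" by simp
      also have "\<dots> \<le> 1 / (2 * L) * (real k ^ (r + 1) * 2)"
        using b1 b2 L1 P by (intro mult_mono) auto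
      also have "\<dots> = real k ^ (r + 1) / L" by simp
      also have "\<dots> < real k ^ (r + 1)" using L k0 by (simp add: divide_less_eq)
      finally show "d * real (card C) * (real (r + 1) ^ 2 * (real (r + 1) / real k) ^ 2
        * (real k + real (r + 1) * ((1 + l) / l) ^ r) ^ (r + 1)) < real k ^ (r + 1)"
        unfolding P_def .
    qed (use k0 in simp)
    then obtain c where c: "c ` V \<subseteq> {..<r}" "real (card C) + real (card (mono_edges C c))
        \<le> (1 - 1 / real r) * N ^ 2 / 2 + real (r + 1) * real k * N"
      using stability[OF V C, of r k] r(1) unfolding N_def by auto
    have "real (r + 1) * real k * N \<le> L * (2 * N / L ^ 19) * N"
      using r(2) k2 N1 L1 by (intro mult_mono) auto
    also have "\<dots> = 2 * N ^ 2 / L ^ 18"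
    proof -
      have "L ^ 19 = L ^ Suc 18" by simp
      then have "L ^ 19 = L * L ^ 18" by (simp only: power_Suc)
      then show ?thesis using L1 by (simp add: power2_eq_square)
    qed
    finally have e1: "real (r + 1) * real k * N \<le> 2 * N ^ 2 / L ^ 18" .
    have e2: "real (card (C \<union> S)) \<le> real (card C) + real (card S)"
      using card_Un_le[of C S] by linarith
    have "mono_edges (C \<union> S) c \<subseteq> mono_edges C c \<union> S" by (auto simp: mono_edges_def)
    then have "card (mono_edges (C \<union> S) c) \<le> card (mono_edges C c \<union> S)"
      using fin by (intro card_mono) (auto simp: mono_edges_def)
    then have e3: "real (card (mono_edges (C \<union> S) c)) \<le> real (card (mono_edges C c)) + real (card S)"
      using card_Un_le[of "mono_edges C c" S] by linarith
    have e4: "real (card S) \<le> N ^ 2 / L ^ 18 / 2" using Scard[OF CS] by simp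
    have e5: "0 \<le> N ^ 2 / L ^ 18" using L1 by simp
    show ?thesis
    proof (intro exI[of _ c] conjI)
      show "real (card (C \<union> S)) + real (card (mono_edges (C \<union> S) c))
        \<le> (1 - 1 / real r) * N ^ 2 / 2 + 4 * N ^ 2 / L ^ 18"
        using c(2) e1 e2 e3 e4 e5 by simp
    qed (rule c(1))
  qed
  show ?thesis
    unfolding N_def[symmetric]
  proof (intro exI[of _ "(\<lambda>(C, S). C \<union> S) ` F"] conjI allI ballI impI)
    show "real (card ((\<lambda>(C, S). C \<union> S) ` F)) \<le> exp (N ^ 2 / L ^ 17)"
      using card_image_le[OF F(1), of "\<lambda>(C, S). C \<union> S"] cardF by linarith
    show "\<exists>X\<in>(\<lambda>(C, S). C \<union> S) ` F. G \<subseteq> X" if G: "G \<subseteq> [V]\<^bsup>2\<^esup> \<and> ?I G" for G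
    proof -
      obtain C S where "(C, S) \<in> F" "G \<subseteq> C \<union> S"
        using F(3)[OF conjunct2[OF G] conjunct1[OF G]] by (elim exE conjE)
      then show ?thesis by (intro bexI[of _ "C \<union> S"]) force+
    qed
  next
    fix X assume "X \<in> (\<lambda>(C, S). C \<union> S) ` F"
    then obtain C S where CS: "(C, S) \<in> F" "X = C \<union> S" by auto
    show "X \<subseteq> [V]\<^bsup>2\<^esup>" using F(5,6)[OF CS(1)] CS(2) by auto
    show "\<exists>c. c ` V \<subseteq> {..<r} \<and> real (card X) + real (card (mono_edges X c))
       \<le> (1 - 1 / real r) * N ^ 2 / 2 + 4 * N ^ 2 / L ^ 18"
      using col[OF CS(1)] CS(2) by simp
  qed (use F(1) in simp)
qed

lemma card_covered_le:
  assumes "finite F" "finite E" "\<And>X. X \<in> F \<Longrightarrow> X \<subseteq> E" "\<And>X. X \<in> F \<Longrightarrow> real (card X) \<le> a"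
    and "\<And>G. G \<in> A \<Longrightarrow> \<exists>X\<in>F. G \<subseteq> X"
  shows "real (card A) \<le> real (card F) * 2 powr a"
proof -
  have fX: "finite X" if "X \<in> F" for X using assms(2,3) that finite_subset by blast
  have "card A \<le> card (\<Union>X\<in>F. Pow X)"
    using assms(1,5) fX by (intro card_mono) auto
  also have "\<dots> \<le> (\<Sum>X\<in>F. card (Pow X))" by (rule card_UN_le[OF assms(1)])
  finally have "real (card A) \<le> (\<Sum>X\<in>F. real (card (Pow X)))" by (metis of_nat_le_iff of_nat_sum)
  also have "\<dots> \<le> (\<Sum>X\<in>F. 2 powr a)"
  proof (rule sum_mono)
    fix X assume X: "X \<in> F"
    have "real (card (Pow X)) = 2 powr real (card X)" using fX[OF X] by (simp add: card_Pow powr_realpow)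
    then show "real (card (Pow X)) \<le> 2 powr a" using assms(4)[OF X] by simp
  qed
  finally show ?thesis by simp
qed

lemma card_clique_free_le:
  fixes L :: real
  assumes V: "finite V" and r: "1 \<le> r" "real (r + 1) \<le> L" and L: "100 \<le> L" "36 * ln L \<le> L"
    and n: "L ^ (62 * r + 22) \<le> real (card V)"
  shows "real (card {G. G \<subseteq> [V]\<^bsup>2\<^esup> \<and> cfree V (r + 1) G})
    \<le> exp (real (card V) ^ 2 / L ^ 17) *
      2 powr ((1 - 1 / real r) * real (card V) ^ 2 / 2 + 4 * real (card V) ^ 2 / L ^ 18)"
    (is "_ \<le> ?e * 2 powr ?a")
proof -
  obtain F where F: "finite F" "real (card F) \<le> ?e" "\<And>G. G \<subseteq> [V]\<^bsup>2\<^esup> \<and> cfree V (r + 1) G \<Longrightarrow> \<exists>X\<in>F. G \<subseteq> X"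
    "\<And>X. X \<in> F \<Longrightarrow> X \<subseteq> [V]\<^bsup>2\<^esup>"
    "\<And>X. X \<in> F \<Longrightarrow> \<exists>c. c ` V \<subseteq> {..<r} \<and> real (card X) + real (card (mono_edges X c)) \<le> ?a"
    using clique_free_containers[OF assms] by auto
  have "real (card {G. G \<subseteq> [V]\<^bsup>2\<^esup> \<and> cfree V (r + 1) G}) \<le> real (card F) * 2 powr ?a"
  proof (rule card_covered_le[OF F(1) finite_imp_finite_nsets[OF V] F(4)])
    show "real (card X) \<le> ?a" if "X \<in> F" for X
      using F(5)[OF that] by (smt (verit) of_nat_0_le_iff)
  qed (use F(3) in auto)
  also have "\<dots> \<le> ?e * 2 powr ?a" using F(2) by (intro mult_right_mono) auto
  finally show ?thesis .
qed

text \<open>A container with almost as many edges as the Turan graph has a colouring with few monochromatic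
  edges, which serves all its subgraphs; so graphs without such a colouring lie in containers with
  substantially fewer edges.\<close>

lemma card_far_from_partite_le:
  fixes L :: real
  assumes V: "finite V" and r: "1 \<le> r" "real (r + 1) \<le> L" and L: "100 \<le> L" "36 * ln L \<le> L"
    and n: "L ^ (62 * r + 22) \<le> real (card V)"
  shows "real (card {G. G \<subseteq> [V]\<^bsup>2\<^esup> \<and> cfree V (r + 1) G \<and>
       (\<forall>c. c ` V \<subseteq> {..<r} \<longrightarrow> real (card V) ^ 2 / L ^ 16 < real (card (mono_edges G c)))})
    \<le> exp (real (card V) ^ 2 / L ^ 17) *
      2 powr ((1 - 1 / real r) * real (card V) ^ 2 / 2 - real (card V) ^ 2 / (2 * L ^ 16))"
    (is "real (card ?A) \<le> ?e * 2 powr ?b")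
proof -
  define N where "N = real (card V)"
  obtain F where F: "finite F" "real (card F) \<le> ?e" "\<And>G. G \<subseteq> [V]\<^bsup>2\<^esup> \<and> cfree V (r + 1) G \<Longrightarrow> \<exists>X\<in>F. G \<subseteq> X"
    "\<And>X. X \<in> F \<Longrightarrow> X \<subseteq> [V]\<^bsup>2\<^esup>"
    "\<And>X. X \<in> F \<Longrightarrow> \<exists>c. c ` V \<subseteq> {..<r} \<and> real (card X) + real (card (mono_edges X c))
       \<le> (1 - 1 / real r) * N ^ 2 / 2 + 4 * N ^ 2 / L ^ 18"
    using clique_free_containers[OF assms] unfolding N_def by auto
  define F' where "F' = {X\<in>F. real (card X) \<le> ?b}"
  have L8: "4 * N ^ 2 / L ^ 18 \<le> N ^ 2 / (2 * L ^ 16)"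
  proof -
    have "10 ^ 2 \<le> L ^ 2" using L by (intro power_mono) auto
    then have "N ^ 2 * (8 * L ^ 16) \<le> N ^ 2 * (L ^ 2 * L ^ 16)"
      using L by (intro mult_left_mono mult_right_mono) auto
    then show ?thesis using L by (simp add: field_simps power_add[symmetric])
  qed
  have half: "N ^ 2 / (2 * L ^ 16) + N ^ 2 / (2 * L ^ 16) = N ^ 2 / L ^ 16" by simp
  have "real (card ?A) \<le> real (card F') * 2 powr ?b"
  proof (rule card_covered_le[OF _ finite_imp_finite_nsets[OF V]])
    fix G assume G: "G \<in> ?A"
    then obtain X where X: "X \<in> F" "G \<subseteq> X" using F(3) by blast
    obtain c where c: "c ` V \<subseteq> {..<r}" "real (card X) + real (card (mono_edges X c))
       \<le> (1 - 1 / real r) * N ^ 2 / 2 + 4 * N ^ 2 / L ^ 18" using F(5)[OF X(1)] by blast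
    have fX: "finite X" using F(4)[OF X(1)] V finite_imp_finite_nsets finite_subset by blast
    have "card (mono_edges G c) \<le> card (mono_edges X c)"
      using fX X(2) by (intro card_mono) (auto simp: mono_edges_def)
    moreover have "N ^ 2 / L ^ 16 < real (card (mono_edges G c))" using G c(1) by (simp add: N_def)
    ultimately have "real (card X) \<le> ?b" using c(2) L8 half unfolding N_def[symmetric] by linarith
    then show "\<exists>X\<in>F'. G \<subseteq> X" using X by (auto simp: F'_def)
  qed (use F in \<open>auto simp: F'_def\<close>)
  also have "\<dots> \<le> ?e * 2 powr ?b"
  proof (rule mult_right_mono)
    have "card F' \<le> card F" using F(1) by (intro card_mono) (auto simp: F'_def)
    then show "real (card F') \<le> ?e" using F(2) by linarith
  qed simp
  finally show ?thesis .
qed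

section \<open>Rich colourings\<close>

text \<open>Large parts of all colour classes span a clique. Asking for exactly \<open>m\<close> vertices of each colour
  fixes the size of \<open>A\<close>; \<open>rich_transversal\<close> is the form in which the property is used.\<close>

definition rich :: "'a set \<Rightarrow> nat \<Rightarrow> nat \<Rightarrow> ('a \<Rightarrow> nat) \<Rightarrow> 'a set set \<Rightarrow> bool" where
  "rich V r m c H \<longleftrightarrow> (\<forall>A\<subseteq>V. (\<forall>i<r. card {v\<in>A. c v = i} = m) \<longrightarrow> \<not> cfree A r H)"

lemma rich_transversal:
  assumes V: "finite V" and c: "c ` V \<subseteq> {..<r}" and rich: "rich V r m c H" and H: "H \<subseteq> cross_edges V c"
    and B: "\<And>i. i < r \<Longrightarrow> B i \<subseteq> {v\<in>V. c v = i}" "\<And>i. i < r \<Longrightarrow> m \<le> card (B i)"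
  obtains s where "\<And>i. i < r \<Longrightarrow> s i \<in> B i"
    and "\<And>i j. i < r \<Longrightarrow> j < r \<Longrightarrow> i \<noteq> j \<Longrightarrow> {s i, s j} \<in> H"
proof -
  have "\<exists>C. C \<subseteq> B i \<and> card C = m" if "i < r" for i
    using B(2)[OF that] by (meson obtain_subset_with_card_n)
  then obtain C where C: "\<And>i. i < r \<Longrightarrow> C i \<subseteq> B i" "\<And>i. i < r \<Longrightarrow> card (C i) = m" by metis
  define A where "A = (\<Union>i<r. C i)"
  have cC: "c v = i" if "v \<in> C i" "i < r" for v i using C(1)[OF that(2)] B(1)[OF that(2)] that by auto
  have AV: "A \<subseteq> V" using B(1) C(1) by (auto simp: A_def)
  have "{v\<in>A. c v = i} = C i" if "i < r" for i
    using cC that by (auto simp: A_def)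
  then have "\<not> cfree A r H" using rich AV C(2) by (auto simp: rich_def)
  then obtain S where S: "S \<subseteq> A" "card S = r" "clique S H" by (auto simp: cfree_def)
  have fS: "finite S" using S(1) AV V by (meson finite_subset)
  have inj: "inj_on c S"
  proof (rule inj_onI, rule ccontr)
    fix u v assume uv: "u \<in> S" "v \<in> S" "c u = c v" "u \<noteq> v"
    then have "{u, v} \<in> H" using S(3) by (simp add: clique_def)
    then have "{u, v} \<in> cross_edges V c" using H by blast
    then show False using uv by simp
  qed
  have "c ` S = {..<r}"
  proof (rule card_subset_eq)
    show "c ` S \<subseteq> {..<r}" using S(1) AV c by blast
    show "card (c ` S) = card {..<r}" using inj S(2) by (simp add: card_image)
  qed simp
  then have "\<exists>v\<in>S. c v = i" if "i < r" for i using that by (metis imageE lessThan_iff)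
  then obtain s where s: "\<And>i. i < r \<Longrightarrow> s i \<in> S" "\<And>i. i < r \<Longrightarrow> c (s i) = i" by metis
  show ?thesis
  proof (rule that[of s])
    fix i assume i: "i < r"
    then have "s i \<in> A" using s S by auto
    then obtain j where "j < r" "s i \<in> C j" by (auto simp: A_def)
    then show "s i \<in> B i" using cC s(2)[OF i] C(1) by auto
  next
    fix i j assume "i < r" "j < r" "i \<noteq> j"
    then show "{s i, s j} \<in> H" using S(3) s unfolding clique_def by metis
  qed
qed

lemma mono_edges_eq: "e \<in> mono_edges E c \<Longrightarrow> x \<in> e \<Longrightarrow> y \<in> e \<Longrightarrow> c x = c y"
  unfolding mono_edges_def by blast

lemma mono_edges_recolor:
  assumes V: "finite V" and G: "G \<subseteq> [V]\<^bsup>2\<^esup>" and v: "v \<in> V" and j: "j \<noteq> c v"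
  shows "card (mono_edges G (c(v := j))) + card {w\<in>V. c w = c v \<and> {v, w} \<in> G}
    = card (mono_edges G c) + card {w\<in>V. c w = j \<and> {v, w} \<in> G}"
proof -
  define R where "R = {e\<in>mono_edges G c. v \<notin> e}"
  define E where "E i = (\<lambda>w. {v, w}) ` {w\<in>V. c w = i \<and> {v, w} \<in> G}" for i
  have loop: "{v, v} \<notin> G" using G by (auto simp: nsets_def)
  have fG: "finite G" using V G finite_imp_finite_nsets finite_subset by blast
  have fR: "finite R" using fG by (simp add: R_def mono_edges_def)
  have cE: "card (E i) = card {w\<in>V. c w = i \<and> {v, w} \<in> G}" for i
    unfolding E_def by (intro card_image inj_onI) (auto simp: doubleton_eq_iff)
  have fE: "finite (E i)" for i using V by (simp add: E_def)
  have d: "R \<inter> E i = {}" for i by (auto simp: R_def E_def)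
  have pair: "\<exists>w. e = {v, w} \<and> w \<in> V \<and> w \<noteq> v" if "e \<in> G" "v \<in> e" for e
  proof -
    have "e \<in> [V]\<^bsup>2\<^esup>" using G that(1) by blast
    then obtain a b where ab: "e = {a, b}" "a \<in> V" "b \<in> V" "a \<noteq> b" by (elim nsets2_E)
    show ?thesis
    proof (cases "v = a")
      case True
      then show ?thesis using ab by (intro exI[of _ b]) auto
    next
      case False
      then show ?thesis using ab that(2) by (intro exI[of _ a]) auto
    qed
  qed
  have 1: "mono_edges G c = R \<union> E (c v)"
  proof (intro equalityI subsetI)
    fix e assume e: "e \<in> mono_edges G c"
    show "e \<in> R \<union> E (c v)"
    proof (cases "v \<in> e")
      case True
      then obtain w where "e = {v, w}" "w \<in> V" using pair[of e] e by (auto simp: mono_edges_def)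
      then show ?thesis using e by (auto simp: E_def)
    qed (use e in \<open>simp add: R_def\<close>)
  qed (auto simp: R_def E_def)
  have 2: "mono_edges G (c(v := j)) = R \<union> E j"
  proof (intro equalityI subsetI)
    fix e assume e: "e \<in> mono_edges G (c(v := j))"
    then have eG: "e \<in> G" by (simp add: mono_edges_def)
    show "e \<in> R \<union> E j"
    proof (cases "v \<in> e")
      case True
      then obtain w where "e = {v, w}" "w \<in> V" "w \<noteq> v" using pair[OF eG] by blast
      then show ?thesis using e by (auto simp: E_def)
    next
      case False
      then have eq: "(c(v := j)) x = c x" if "x \<in> e" for x using that by auto
      have "c x = c y" if "x \<in> e" "y \<in> e" for x y
      proof -
        have "(c(v := j)) x = (c(v := j)) y"
          using e that by (rule mono_edges_eq)
        then show ?thesis using eq[OF that(1)] eq[OF that(2)] by argo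
      qed
      then have "e \<in> mono_edges G c" using eG unfolding mono_edges_def by blast
      then show ?thesis using False by (simp add: R_def)
    qed
  next
    fix e assume "e \<in> R \<union> E j"
    then show "e \<in> mono_edges G (c(v := j))"
    proof
      assume "e \<in> R"
      then have R: "e \<in> mono_edges G c" "v \<notin> e" by (simp_all add: R_def)
      have "(c(v := j)) x = (c(v := j)) y" if "x \<in> e" "y \<in> e" for x y
      proof -
        have "x \<noteq> v" "y \<noteq> v" using that R(2) by auto
        then show ?thesis using mono_edges_eq[OF R(1) that] by simp
      qed
      then show ?thesis using R(1) unfolding mono_edges_def by blast
    next
      assume "e \<in> E j"
      then obtain w where w: "e = {v, w}" "c w = j" "{v, w} \<in> G" by (auto simp: E_def)
      then show ?thesis using j by auto
    qed
  qed
  show ?thesis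
    unfolding 1 2 using fR fE d by (simp add: card_Un_disjoint cE)
qed

text \<open>In a colouring with the fewest monochromatic edges every vertex has at least as many neighbours
  in each other class as in its own, so a large monochromatic degree would make all its
  neighbourhoods large, and richness would extend the vertex to a clique.\<close>

lemma rich_mono_degree:
  assumes V: "finite V" and G: "G \<subseteq> [V]\<^bsup>2\<^esup>" "cfree V (r + 1) G" and c: "c ` V \<subseteq> {..<r}"
    and opt: "\<And>c'. c' ` V \<subseteq> {..<r} \<Longrightarrow> card (mono_edges G c) \<le> card (mono_edges G c')"
    and rich: "rich V r m c (G \<inter> cross_edges V c)" and v: "v \<in> V"
  shows "card {w\<in>V. c w = c v \<and> {v, w} \<in> G} < m"
proof (rule ccontr)
  assume big: "\<not> ?thesis"
  define B where "B j = {w\<in>V. c w = j \<and> {v, w} \<in> G}" for j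
  have Bs: "B j \<subseteq> {w\<in>V. c w = j}" for j by (auto simp: B_def)
  have Bm: "m \<le> card (B j)" if j: "j < r" for j
  proof (cases "j = c v")
    case False
    have "card (mono_edges G c) \<le> card (mono_edges G (c(v := j)))"
      using c j by (intro opt) auto
    then have "card (B (c v)) \<le> card (B j)"
      using mono_edges_recolor[where c = c and j = j, OF V G(1) v False] by (simp add: B_def)
    then show ?thesis using big by (simp add: B_def)
  qed (use big in \<open>simp add: B_def\<close>)
  obtain s where s: "\<And>i. i < r \<Longrightarrow> s i \<in> B i"
      "\<And>i j. i < r \<Longrightarrow> j < r \<Longrightarrow> i \<noteq> j \<Longrightarrow> {s i, s j} \<in> G \<inter> cross_edges V c"
    by (rule rich_transversal[OF V c rich Int_lower2, where B = B]) (rule Bs, rule Bm, assumption, rule that, blast+)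
  have inj: "inj_on s {..<r}" using s(1) by (intro inj_on_inverseI[of _ c]) (auto simp: B_def)
  have "v \<noteq> s i" if "i < r" for i
  proof -
    have "{v, s i} \<in> G" using s(1)[OF that] by (simp add: B_def)
    then have "{v, s i} \<in> [V]\<^bsup>2\<^esup>" using G(1) by blast
    then show ?thesis by simp
  qed
  then have vs: "v \<notin> s ` {..<r}" by auto
  have "card (insert v (s ` {..<r})) = r + 1" using inj vs by (simp add: card_image)
  moreover have "clique (insert v (s ` {..<r})) G"
    unfolding clique_def
  proof (intro ballI impI)
    fix x y assume xy: "x \<in> insert v (s ` {..<r})" "y \<in> insert v (s ` {..<r})" "x \<noteq> y"
    have vs: "{v, s i} \<in> G" if "i < r" for i using s(1)[OF that] by (simp add: B_def)
    have ss: "{s i, s j} \<in> G" if "i < r" "j < r" "s i \<noteq> s j" for i j using s(2)[of i j] that by auto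
    show "{x, y} \<in> G" using xy vs ss by (auto simp: insert_commute)
  qed
  moreover have "insert v (s ` {..<r}) \<subseteq> V" using v s(1) by (auto simp: B_def)
  ultimately show False using G(2) by (auto simp: cfree_def)
qed

text \<open>Otherwise richness gives a transversal clique in the common neighbourhoods of \<open>u\<close> and \<open>v\<close> in the
  other classes, together with an arbitrary vertex of their own class. Replacing this vertex by \<open>u\<close>
  and \<open>v\<close> gives a clique on \<open>r + 1\<close> vertices.\<close>

lemma rich_mono_edge_codegree:
  assumes V: "finite V" and G: "G \<subseteq> [V]\<^bsup>2\<^esup>" "cfree V (r + 1) G" and c: "c ` V \<subseteq> {..<r}"
    and rich: "rich V r m c (G \<inter> cross_edges V c)" and uv: "{u, v} \<in> mono_edges G c"
    and big: "m \<le> card {w\<in>V. c w = c u}"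
  shows "\<exists>j<r. j \<noteq> c u \<and> card {w\<in>V. c w = j \<and> {u, w} \<in> G \<and> {v, w} \<in> G} < m"
proof (rule ccontr)
  assume no: "\<not> ?thesis"
  have uvG: "{u, v} \<in> G" "c u = c v" using uv by auto
  have "{u, v} \<in> [V]\<^bsup>2\<^esup>" using uvG(1) G(1) by blast
  then have uv': "u \<in> V" "v \<in> V" "u \<noteq> v" by simp_all
  define B where "B j = (if j = c u then {w\<in>V. c w = c u} else {w\<in>V. c w = j \<and> {u, w} \<in> G \<and> {v, w} \<in> G})" for j
  have Bm: "m \<le> card (B j)" if "j < r" for j using no that big by (auto simp: B_def)
  have Bs: "B j \<subseteq> {w\<in>V. c w = j}" for j by (auto simp: B_def)
  obtain s where s: "\<And>i. i < r \<Longrightarrow> s i \<in> B i"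
      "\<And>i j. i < r \<Longrightarrow> j < r \<Longrightarrow> i \<noteq> j \<Longrightarrow> {s i, s j} \<in> G \<inter> cross_edges V c"
    by (rule rich_transversal[OF V c rich Int_lower2, where B = B]) (rule Bs, rule Bm, assumption, rule that, blast+)
  define J where "J = {..<r} - {c u}"
  have cu: "c u < r" using c uv' by auto
  have cs: "c (s i) = i" if "i < r" for i using s(1)[OF that] by (auto simp: B_def split: if_splits)
  have inj: "inj_on s J" using cs by (intro inj_on_inverseI[of _ c]) (auto simp: J_def)
  have n: "u \<notin> s ` J" "v \<notin> s ` J" using cs uvG by (auto simp: J_def)
  have "card J = r - 1" using cu by (simp add: J_def)
  then have "card (insert u (insert v (s ` J))) = r + 1"
    using inj n uv'(3) cu by (simp add: card_image J_def)
  moreover have "clique (insert u (insert v (s ` J))) G"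
    unfolding clique_def
  proof (intro ballI impI)
    fix x y assume xy: "x \<in> insert u (insert v (s ` J))" "y \<in> insert u (insert v (s ` J))" "x \<noteq> y"
    have us: "{u, s i} \<in> G" "{v, s i} \<in> G" if "i \<in> J" for i
      using s(1)[of i] that by (auto simp: B_def J_def)
    have ss: "{s i, s j} \<in> G" if "i \<in> J" "j \<in> J" "s i \<noteq> s j" for i j
      using s(2)[of i j] that by (auto simp: J_def)
    show "{x, y} \<in> G" using xy us ss uvG(1) by (auto simp: insert_commute)
  qed
  moreover have "insert u (insert v (s ` J)) \<subseteq> V"
  proof -
    have "s i \<in> V" if "i \<in> J" for i using s(1)[of i] Bs[of i] that by (auto simp: J_def)
    then show ?thesis using uv' by auto
  qed
  ultimately show False using G(2) by (auto simp: cfree_def)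
qed

section \<open>Colourings of a rich graph\<close>

lemma card_colorings_near_le:
  assumes V: "finite V" "V \<noteq> {}" and f: "f ` V \<subseteq> {..<r::nat}"
  shows "card {c \<in> V \<rightarrow>\<^sub>E {..<r}. card {v\<in>V. c v \<noteq> f v} \<le> d} \<le> (card V * r) ^ d"
proof (induction d)
  case 0
  have "{c \<in> V \<rightarrow>\<^sub>E {..<r}. card {v\<in>V. c v \<noteq> f v} \<le> 0} \<subseteq> {restrict f V}"
    using V by (auto simp: PiE_def extensional_def fun_eq_iff)
  from card_mono[OF _ this] show ?case by simp
next
  case (Suc d)
  let ?S = "\<lambda>d. {c \<in> V \<rightarrow>\<^sub>E {..<r}. card {v\<in>V. c v \<noteq> f v} \<le> d}"
  have "finite (V \<rightarrow>\<^sub>E {..<r})" using V(1) by (intro finite_PiE) auto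
  then have fin: "finite (?S d)" by (rule rev_finite_subset) blast
  have "?S (Suc d) \<subseteq> (\<lambda>((v, j), c). c(v := j)) ` ((V \<times> {..<r}) \<times> ?S d)"
  proof
    fix c assume c: "c \<in> ?S (Suc d)"
    obtain v where v: "v \<in> V" "c v \<noteq> f v \<or> {v\<in>V. c v \<noteq> f v} = {}"
    proof (cases "{v\<in>V. c v \<noteq> f v} = {}")
      case True
      then show thesis using V(2) that by blast
    next
      case False
      then show thesis using that by blast
    qed
    have cv: "c v \<in> {..<r}" using c v by auto
    have "{w\<in>V. (c(v := f v)) w \<noteq> f w} = {w\<in>V. c w \<noteq> f w} - {v}" by auto
    moreover have "card ({w\<in>V. c w \<noteq> f w} - {v}) \<le> d"
    proof (cases "{w\<in>V. c w \<noteq> f w} = {}")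
      case False
      then have "v \<in> {w\<in>V. c w \<noteq> f w}" using v by blast
      moreover have "card {w\<in>V. c w \<noteq> f w} \<le> Suc d" using c by blast
      ultimately show ?thesis using V(1) by (simp add: card_Diff_singleton)
    qed (simp only: empty_Diff card.empty le0)
    moreover have "c(v := f v) \<in> V \<rightarrow>\<^sub>E {..<r}"
      using c v(1) f by (auto simp: PiE_iff extensional_def)
    ultimately have "c(v := f v) \<in> ?S d" by simp
    moreover have "c = (c(v := f v))(v := c v)" by simp
    ultimately show "c \<in> (\<lambda>((v, j), c). c(v := j)) ` ((V \<times> {..<r}) \<times> ?S d)"
      using v(1) cv by (intro image_eqI[of _ _ "((v, c v), c(v := f v))"]) auto
  qed
  then have "card (?S (Suc d)) \<le> card ((V \<times> {..<r}) \<times> ?S d)"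
    using V fin by (meson card_image_le card_mono finite_SigmaI finite_imageI finite_lessThan order_trans)
  also have "\<dots> = card V * r * card (?S d)" by (simp add: card_cartesian_product)
  also have "\<dots> \<le> card V * r * (card V * r) ^ d" using Suc by (intro mult_left_mono) auto
  finally show ?case by simp
qed

text \<open>No class \<open>j\<close> of \<open>c\<close> contains large parts of two classes of \<open>c\<^sub>0\<close>, as these parts would span an
  edge inside \<open>j\<close>. So up to few vertices \<open>c\<close> arises from \<open>c\<^sub>0\<close> by permuting the colours.\<close>

lemma rich_coloring_unique:
  assumes V: "finite V" and c0: "c0 ` V \<subseteq> {..<r}" and c: "c ` V \<subseteq> {..<r}"
    and rich: "rich V r m c0 H" and H: "H \<subseteq> cross_edges V c0" "H \<subseteq> cross_edges V c"
    and big: "\<And>i. i < r \<Longrightarrow> r * m < card {v\<in>V. c0 v = i}"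
  shows "\<exists>p\<in>{..<r} \<rightarrow>\<^sub>E {..<r}. card {v\<in>V. c v \<noteq> p (c0 v)} \<le> r * r * m"
proof -
  define X where "X i j = {v\<in>V. c0 v = i \<and> c v = j}" for i j
  have fX: "finite (X i j)" for i j using V by (simp add: X_def)
  have one: "i = i'" if ij: "i < r" "i' < r" "m \<le> card (X i j)" "m \<le> card (X i' j)" for i i' j
  proof (rule ccontr)
    assume ne: "i \<noteq> i'"
    define B where "B l = (if l = i \<or> l = i' then X l j else {v\<in>V. c0 v = l})" for l
    have Bm: "m \<le> card (B l)" if "l < r" for l
    proof -
      have "m \<le> r * m" using that by simp
      then have "m \<le> card {v\<in>V. c0 v = l}" using big[OF that] by linarith
      then show ?thesis using ij by (simp add: B_def)
    qed
    have Bs: "B l \<subseteq> {v\<in>V. c0 v = l}" for l by (auto simp: B_def X_def)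
    obtain s where s: "\<And>i. i < r \<Longrightarrow> s i \<in> B i"
      "\<And>i j. i < r \<Longrightarrow> j < r \<Longrightarrow> i \<noteq> j \<Longrightarrow> {s i, s j} \<in> H"
      by (rule rich_transversal[OF V c0 rich H(1), where B = B]) (rule Bs, rule Bm, assumption, rule that, blast+)
    have "c (s i) = c (s i')" using s(1)[of i] s(1)[of i'] ij by (simp add: B_def X_def)
    moreover have "{s i, s i'} \<in> cross_edges V c" using s(2)[of i i'] ij ne H(2) by auto
    ultimately show False by simp
  qed
  have "\<exists>j<r. m \<le> card (X i j)" if i: "i < r" for i
  proof (rule ccontr)
    assume no: "\<not> ?thesis"
    have "{v\<in>V. c0 v = i} = (\<Union>j<r. X i j)" using c by (auto simp: X_def)
    then have "card {v\<in>V. c0 v = i} \<le> (\<Sum>j<r. card (X i j))"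
      using card_UN_le[of "{..<r}" "X i"] by simp
    also have "\<dots> \<le> (\<Sum>j<r. m)" using no by (intro sum_mono) (auto simp: not_le intro: less_imp_le)
    finally show False using big[OF i] by simp
  qed
  then obtain p0 where p0: "\<And>i. i < r \<Longrightarrow> p0 i < r" "\<And>i. i < r \<Longrightarrow> m \<le> card (X i (p0 i))" by metis
  define p where "p = restrict p0 {..<r}"
  have p: "p \<in> {..<r} \<rightarrow>\<^sub>E {..<r}" "\<And>i. i < r \<Longrightarrow> p i < r" "\<And>i. i < r \<Longrightarrow> m \<le> card (X i (p i))"
    using p0 by (auto simp: p_def)
  have "inj_on p {..<r}"
  proof (rule inj_onI)
    fix i i' assume "i \<in> {..<r}" "i' \<in> {..<r}" "p i = p i'"
    then show "i = i'" using one[of i i' "p i"] p(3)[of i] p(3)[of i'] by simp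
  qed
  then have surj: "p ` {..<r} = {..<r}"
    using p(2) by (intro card_subset_eq) (auto simp: card_image)
  have small: "card (X i j) \<le> m" if ij: "i < r" "j < r" "j \<noteq> p i" for i j
  proof (rule ccontr)
    assume "\<not> ?thesis"
    moreover obtain i' where "i' < r" "p i' = j" using surj ij(2) by (metis imageE lessThan_iff)
    ultimately show False using one[of i i' j] p(3)[of i'] ij by auto
  qed
  have "{v\<in>V. c v \<noteq> p (c0 v)} \<subseteq> (\<Union>i<r. \<Union>j\<in>{..<r} - {p i}. X i j)"
    using c c0 by (auto simp: X_def)
  then have "card {v\<in>V. c v \<noteq> p (c0 v)} \<le> card (\<Union>i<r. \<Union>j\<in>{..<r} - {p i}. X i j)"
    using fX by (intro card_mono) auto
  also have "\<dots> \<le> (\<Sum>i<r. card (\<Union>j\<in>{..<r} - {p i}. X i j))" by (intro card_UN_le) simp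
  also have "\<dots> \<le> (\<Sum>i<r. \<Sum>j\<in>{..<r} - {p i}. card (X i j))" by (intro sum_mono card_UN_le) simp
  also have "\<dots> \<le> (\<Sum>i<r. \<Sum>j\<in>{..<r} - {p i}. m)" using small by (intro sum_mono) auto
  also have "\<dots> \<le> (\<Sum>i<r. r * m)"
    by (intro sum_mono) (simp add: mult_right_mono card_Diff1_le[of "{..<r}", simplified])
  finally show ?thesis using p(1) by (auto simp: mult.assoc)
qed

lemma card_rich_colorings_le:
  assumes V: "finite V" "V \<noteq> {}"
  shows "card {c \<in> V \<rightarrow>\<^sub>E {..<r}. (\<forall>i<r. r * m < card {v\<in>V. c v = i}) \<and> H \<subseteq> cross_edges V c \<and> rich V r m c H}
    \<le> r ^ r * (card V * r) ^ (r * r * m)" (is "card ?S \<le> _")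
proof (cases "?S = {}")
  case False
  then obtain c0 where c0: "c0 \<in> ?S" by blast
  define T where "T p = {c \<in> V \<rightarrow>\<^sub>E {..<r}. card {v\<in>V. c v \<noteq> p (c0 v)} \<le> r * r * m}" for p
  have "?S \<subseteq> (\<Union>p\<in>{..<r} \<rightarrow>\<^sub>E {..<r}. T p)"
  proof
    fix c assume c: "c \<in> ?S"
    have "\<exists>p\<in>{..<r} \<rightarrow>\<^sub>E {..<r}. card {v\<in>V. c v \<noteq> p (c0 v)} \<le> r * r * m"
      using c c0 by (intro rich_coloring_unique[OF V(1), of c0 r c m H]) auto
    then show "c \<in> (\<Union>p\<in>{..<r} \<rightarrow>\<^sub>E {..<r}. T p)" using c by (auto simp: T_def)
  qed
  moreover have "finite (\<Union>p\<in>{..<r} \<rightarrow>\<^sub>E {..<r}. T p)"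
  proof (rule finite_UN_I)
    have "finite (V \<rightarrow>\<^sub>E {..<r})" using V(1) by (intro finite_PiE) auto
    then show "finite (T p)" for p by (rule rev_finite_subset) (auto simp: T_def)
  qed (intro finite_PiE; simp)
  ultimately have "card ?S \<le> card (\<Union>p\<in>{..<r} \<rightarrow>\<^sub>E {..<r}. T p)" by (rule card_mono[rotated])
  also have "\<dots> \<le> (\<Sum>p\<in>{..<r} \<rightarrow>\<^sub>E {..<r}. card (T p))" by (intro card_UN_le finite_PiE) auto
  also have "\<dots> \<le> (\<Sum>p\<in>{..<r} \<rightarrow>\<^sub>E {..<r}. (card V * r) ^ (r * r * m))"
  proof (rule sum_mono)
    fix p :: "nat \<Rightarrow> nat" assume p: "p \<in> {..<r} \<rightarrow>\<^sub>E {..<r}"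
    show "card (T p) \<le> (card V * r) ^ (r * r * m)"
      unfolding T_def using c0 p by (intro card_colorings_near_le[OF V]) auto
  qed
  also have "\<dots> = r ^ r * (card V * r) ^ (r * r * m)" by (simp add: card_PiE)
  finally show ?thesis .
qed (simp only: card.empty le0)

section \<open>Counting graphs with prescribed defects\<close>

lemma mono_edges_subset: "mono_edges G c \<subseteq> G"
  unfolding mono_edges_def by blast

lemma mono_cross_split: "G \<subseteq> [V]\<^bsup>2\<^esup> \<Longrightarrow> mono_edges G c \<union> (G \<inter> cross_edges V c) = G"
  unfolding mono_edges_def cross_edges_def by blast

lemma card_small_subsets_le:
  assumes "finite X"
  shows "card {A. A \<subseteq> X \<and> card A \<le> k} \<le> (card X + 1) ^ k"
proof (induction k)
  case 0
  have "{A. A \<subseteq> X \<and> card A \<le> 0} \<subseteq> {{}}" using assms by (auto dest: finite_subset)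
  from card_mono[OF _ this] show ?case by simp
next
  case (Suc k)
  let ?S = "\<lambda>k. {A. A \<subseteq> X \<and> card A \<le> k}"
  have fin: "finite (?S k)" for k using assms by simp
  have "?S (Suc k) \<subseteq> ?S k \<union> (\<lambda>(x, A). insert x A) ` (X \<times> ?S k)"
  proof
    fix A assume A: "A \<in> ?S (Suc k)"
    show "A \<in> ?S k \<union> (\<lambda>(x, A). insert x A) ` (X \<times> ?S k)"
    proof (cases "A = {}")
      case False
      then obtain x where x: "x \<in> A" by blast
      have "finite A" using A assms by (auto dest: finite_subset)
      then have "card (A - {x}) \<le> k" using A x by (auto simp: card_Diff_singleton)
      moreover have "A = insert x (A - {x})" using x by blast
      ultimately have "A \<in> (\<lambda>(x, A). insert x A) ` (X \<times> ?S k)"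
        using A x by (intro image_eqI[of _ _ "(x, A - {x})"]) auto
      then show ?thesis by blast
    qed simp
  qed
  then have "card (?S (Suc k)) \<le> card (?S k \<union> (\<lambda>(x, A). insert x A) ` (X \<times> ?S k))"
    using fin assms by (intro card_mono) auto
  also have "\<dots> \<le> card (?S k) + card ((\<lambda>(x, A). insert x A) ` (X \<times> ?S k))" by (rule card_Un_le)
  also have "\<dots> \<le> card (?S k) + card (X \<times> ?S k)"
    using fin assms by (intro add_left_mono card_image_le) auto
  also have "\<dots> = (card X + 1) * card (?S k)" by (simp add: card_cartesian_product)
  also have "\<dots> \<le> (card X + 1) * (card X + 1) ^ k" using Suc by (intro mult_left_mono) auto
  finally show ?case by simp
qed

text \<open>Restrictions on disjoint sets of edges are independent.\<close>

lemma card_restricted_subsets_le: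
  assumes "finite I" "finite E" "0 \<le> \<rho>"
    and "\<And>i. i \<in> I \<Longrightarrow> D i \<subseteq> E" "\<And>i j. i \<in> I \<Longrightarrow> j \<in> I \<Longrightarrow> i \<noteq> j \<Longrightarrow> D i \<inter> D j = {}"
    and "\<And>i. i \<in> I \<Longrightarrow> real (card {K. K \<subseteq> D i \<and> Q i K}) \<le> \<rho> * 2 ^ card (D i)"
  shows "real (card {H. H \<subseteq> E \<and> (\<forall>i\<in>I. Q i (H \<inter> D i))}) \<le> \<rho> ^ card I * 2 ^ card E"
  using assms
proof (induction I arbitrary: E)
  case empty
  then show ?case by (simp add: card_Pow Pow_def[symmetric])
next
  case (insert i I)
  let ?A = "{K. K \<subseteq> D i \<and> Q i K}"
  let ?B = "{H. H \<subseteq> E - D i \<and> (\<forall>j\<in>I. Q j (H \<inter> D j))}"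
  have DE: "D i \<subseteq> E" using insert.prems by simp
  have dis: "D j \<inter> D i = {}" if "j \<in> I" for j using insert.prems(4)[of j i] insert.hyps(2) that by auto
  have fin: "finite ?A" "finite ?B" using insert.prems(1) finite_subset[OF DE] by simp_all
  have "{H. H \<subseteq> E \<and> (\<forall>j\<in>insert i I. Q j (H \<inter> D j))} \<subseteq> (\<lambda>(K, H). K \<union> H) ` (?A \<times> ?B)"
  proof
    fix H assume H: "H \<in> {H. H \<subseteq> E \<and> (\<forall>j\<in>insert i I. Q j (H \<inter> D j))}"
    have "(H - D i) \<inter> D j = H \<inter> D j" if "j \<in> I" for j using dis[OF that] by blast
    then have "H - D i \<in> ?B" using H by auto
    moreover have "H \<inter> D i \<in> ?A" using H by auto
    ultimately have "(H \<inter> D i) \<union> (H - D i) \<in> (\<lambda>(K, H). K \<union> H) ` (?A \<times> ?B)"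
      by (intro image_eqI[of _ _ "(H \<inter> D i, H - D i)"]) auto
    then show "H \<in> (\<lambda>(K, H). K \<union> H) ` (?A \<times> ?B)"
      by (simp only: Int_Diff_Un)
  qed
  then have "card {H. H \<subseteq> E \<and> (\<forall>j\<in>insert i I. Q j (H \<inter> D j))} \<le> card ((\<lambda>(K, H). K \<union> H) ` (?A \<times> ?B))"
    by (rule card_mono[rotated]) (intro finite_imageI finite_cartesian_product fin)
  also have "\<dots> \<le> card (?A \<times> ?B)" by (intro card_image_le finite_cartesian_product fin)
  finally have "card {H. H \<subseteq> E \<and> (\<forall>j\<in>insert i I. Q j (H \<inter> D j))} \<le> card (?A \<times> ?B)" .
  then have "card {H. H \<subseteq> E \<and> (\<forall>j\<in>insert i I. Q j (H \<inter> D j))} \<le> card ?A * card ?B"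
    by (simp only: card_cartesian_product)
  then have "real (card {H. H \<subseteq> E \<and> (\<forall>j\<in>insert i I. Q j (H \<inter> D j))}) \<le> real (card ?A) * real (card ?B)"
    by (simp only: of_nat_mult[symmetric] of_nat_le_iff)
  also have "\<dots> \<le> (\<rho> * 2 ^ card (D i)) * (\<rho> ^ card I * 2 ^ card (E - D i))"
  proof (rule mult_mono)
    show "real (card ?B) \<le> \<rho> ^ card I * 2 ^ card (E - D i)"
    proof (rule insert.IH)
      show "D j \<subseteq> E - D i" if "j \<in> I" for j using insert.prems(3)[of j] dis[OF that] that by blast
      show "D j \<inter> D k = {}" if "j \<in> I" "k \<in> I" "j \<noteq> k" for j k
        using insert.prems(4)[of j k] that by simp
      show "real (card {K. K \<subseteq> D j \<and> Q j K}) \<le> \<rho> * 2 ^ card (D j)" if "j \<in> I" for j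
        using insert.prems(5)[of j] that by simp
    qed (use insert.prems(1,2) in auto)
  qed (use insert.prems in auto)
  also have "\<dots> = \<rho> ^ card (insert i I) * 2 ^ (card (D i) + card (E - D i))"
    using insert.hyps by (simp add: power_add)
  also have "card (D i) + card (E - D i) = card E"
    using DE insert.prems(1) by (metis add.commute card_Diff_subset card_mono finite_subset le_add_diff_inverse2)
  finally show ?case .
qed

text \<open>Two vertices \<open>u\<close>, \<open>v\<close> with a small common neighbourhood in \<open>T\<close>: apart from the few
  exceptions each vertex of \<open>T\<close> has three instead of four possible ways to attach to them.\<close>

lemma card_small_codegree_le:
  assumes T: "finite T" and uv: "u \<noteq> v" "u \<notin> T" "v \<notin> T"
  defines "D \<equiv> (\<lambda>(x, w). {x, w}) ` ({u, v} \<times> T)"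
  shows "card D = 2 * card T"
    and "card {K. K \<subseteq> D \<and> card {w\<in>T. {u, w} \<in> K \<and> {v, w} \<in> K} \<le> m} \<le> (card T + 1) ^ m * 3 ^ card T"
proof -
  have "inj_on (\<lambda>(x, w). {x, w}) ({u, v} \<times> T)"
    using uv by (auto simp: inj_on_def doubleton_eq_iff)
  then show "card D = 2 * card T"
    unfolding D_def using uv(1) by (simp add: card_image card_cartesian_product)
  define f where "f K = ({w\<in>T. {u, w} \<in> K \<and> {v, w} \<in> K},
    restrict (\<lambda>w. if {u, w} \<in> K \<and> {v, w} \<notin> K then 1 else if {v, w} \<in> K \<and> {u, w} \<notin> K then 2 else 0::nat) T)" for K
  let ?S = "{K. K \<subseteq> D \<and> card {w\<in>T. {u, w} \<in> K \<and> {v, w} \<in> K} \<le> m}"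
  have rec: "{u, w} \<in> K \<longleftrightarrow> w \<in> fst (f K) \<or> snd (f K) w = 1"
    "{v, w} \<in> K \<longleftrightarrow> w \<in> fst (f K) \<or> snd (f K) w = 2" if "w \<in> T" for w K
    using that by (auto simp: f_def)
  have "inj_on f ?S"
  proof (rule inj_onI)
    have sub: "K \<subseteq> K'" if "K \<subseteq> D" "f K = f K'" for K K'
    proof
      fix e assume e: "e \<in> K"
      then have "e \<in> D" using that(1) by blast
      then obtain x w where w: "e = {x, w}" "x = u \<or> x = v" "w \<in> T" by (auto simp: D_def)
      then show "e \<in> K'" using rec[OF w(3), of K] rec[OF w(3), of K'] e that(2) by auto
    qed
    fix K K' assume "K \<in> ?S" "K' \<in> ?S" "f K = f K'"
    then show "K = K'" using sub[of K K'] sub[of K' K] by simp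
  qed
  then have "card ?S = card (f ` ?S)" by (simp add: card_image)
  also have "\<dots> \<le> card ({A. A \<subseteq> T \<and> card A \<le> m} \<times> (T \<rightarrow>\<^sub>E {0, 1, 2::nat}))"
  proof (rule card_mono)
    show "finite ({A. A \<subseteq> T \<and> card A \<le> m} \<times> (T \<rightarrow>\<^sub>E {0, 1, 2::nat}))"
      using T by (intro finite_cartesian_product finite_PiE) auto
  next
    have sn: "snd (f K) \<in> T \<rightarrow>\<^sub>E {0, 1, 2}" for K unfolding f_def snd_conv by (rule restrict_PiE_iff[THEN iffD2]) simp
    show "f ` ?S \<subseteq> {A. A \<subseteq> T \<and> card A \<le> m} \<times> (T \<rightarrow>\<^sub>E {0, 1, 2::nat})"
    proof (rule image_subsetI)
      fix K assume K: "K \<in> ?S"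
      have "fst (f K) = {w\<in>T. {u, w} \<in> K \<and> {v, w} \<in> K}" by (simp add: f_def)
      then have "fst (f K) \<in> {A. A \<subseteq> T \<and> card A \<le> m}" using K by auto
      then show "f K \<in> {A. A \<subseteq> T \<and> card A \<le> m} \<times> (T \<rightarrow>\<^sub>E {0, 1, 2::nat})"
        using sn[of K] unfolding mem_Times_iff by (rule conjI)
    qed
  qed
  also have "\<dots> = card {A. A \<subseteq> T \<and> card A \<le> m} * 3 ^ card T"
    using T by (simp add: card_cartesian_product card_PiE numeral_3_eq_3)
  also have "\<dots> \<le> (card T + 1) ^ m * 3 ^ card T"
    using card_small_subsets_le[OF T] by (intro mult_right_mono) auto
  finally show "card ?S \<le> (card T + 1) ^ m * 3 ^ card T" .
qed

lemma ex_matching: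
  fixes q :: nat
  assumes "N \<noteq> {}" "1 \<le> q"
  shows "\<exists>s e. 1 \<le> s \<and> s \<le> q \<and> (\<forall>i<s. e i \<in> N) \<and> (\<forall>i<s. \<forall>j<s. i \<noteq> j \<longrightarrow> e i \<inter> e j = {}) \<and>
    (s = q \<or> (\<forall>x\<in>N. \<exists>i<s. x \<inter> e i \<noteq> {}))"
  using assms(2)
proof (induction q rule: dec_induct)
  case base
  obtain x where "x \<in> N" using assms(1) by blast
  then show ?case by (intro exI[of _ 1] exI[of _ "\<lambda>_. x"]) auto
next
  case (step q)
  then obtain s e where e: "1 \<le> s" "s \<le> q" "\<forall>i<s. e i \<in> N" "\<forall>i<s. \<forall>j<s. i \<noteq> j \<longrightarrow> e i \<inter> e j = {}"
    "s = q \<or> (\<forall>x\<in>N. \<exists>i<s. x \<inter> e i \<noteq> {})" by blast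
  show ?case
  proof (cases "\<forall>x\<in>N. \<exists>i<s. x \<inter> e i \<noteq> {}")
    case True
    then show ?thesis using e by (intro exI[of _ s] exI[of _ e]) auto
  next
    case False
    then obtain x where x: "x \<in> N" "\<forall>i<s. x \<inter> e i = {}" by blast
    have "s = q" using False e(5) by blast
    then show ?thesis
      using e x by (intro exI[of _ "Suc s"] exI[of _ "e(s := x)"]) (auto simp: less_Suc_eq Int_commute)
  qed
qed

lemma card_covered_graphs_le:
  assumes V: "finite V" and W: "W \<subseteq> V"
  shows "card {N. N \<subseteq> [V]\<^bsup>2\<^esup> \<and> (\<forall>e\<in>N. e \<inter> W \<noteq> {}) \<and> (\<forall>v\<in>W. card {w\<in>V. {v, w} \<in> N} \<le> m)}
    \<le> ((card V + 1) ^ m) ^ card W" (is "card ?S \<le> _")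
proof -
  let ?P = "W \<rightarrow>\<^sub>E {A. A \<subseteq> V \<and> card A \<le> m}"
  define g where "g f = (\<Union>v\<in>W. (\<lambda>w. {v, w}) ` f v)" for f :: "'a \<Rightarrow> 'a set"
  have fW: "finite W" using W V by (rule finite_subset)
  have fP: "finite ?P" using V fW by (intro finite_PiE) auto
  have "?S \<subseteq> g ` ?P"
  proof
    fix N assume N: "N \<in> ?S"
    define f where "f = restrict (\<lambda>v. {w\<in>V. {v, w} \<in> N}) W"
    have "N = g f"
    proof (intro equalityI subsetI)
      fix e assume e: "e \<in> N"
      then have "e \<in> [V]\<^bsup>2\<^esup>" using N by blast
      then obtain x y where xy: "e = {x, y}" "x \<in> V" "y \<in> V" by (elim nsets2_E)
      have "x \<in> W \<or> y \<in> W" using N e xy by auto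
      then obtain a b where ab: "e = {a, b}" "a \<in> W" "b \<in> V"
        using xy by (metis insert_commute)
      then show "e \<in> g f" using e by (auto simp: g_def f_def)
    qed (auto simp: g_def f_def)
    moreover have "f \<in> ?P" using N by (auto simp: f_def)
    ultimately show "N \<in> g ` ?P" by blast
  qed
  then have "card ?S \<le> card ?P" using fP by (meson card_image_le card_mono finite_imageI order_trans)
  also have "\<dots> = card {A. A \<subseteq> V \<and> card A \<le> m} ^ card W" using fW by (simp add: card_PiE)
  also have "\<dots> \<le> ((card V + 1) ^ m) ^ card W"
    using card_small_subsets_le[OF V] by (intro power_mono) auto
  finally show ?thesis .
qed

text \<open>A maximal matching of monochromatic edges, cut off at size \<open>q\<close>, gives independent restrictions on
  the edges between different classes, one for each matching edge and the class in which its ends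
  have few common neighbours. If it has fewer than
  \<open>q\<close> edges then its vertices cover all monochromatic edges, so these are few enough to enumerate;
  if it has \<open>q\<close> edges the saving outweighs all choices of \<open>K\<close> monochromatic edges.\<close>

lemma card_defective_graphs_le:
  fixes c :: "'a \<Rightarrow> nat" and m K :: nat
  assumes V: "finite V" and c: "c ` V \<subseteq> {..<r}" and q: "1 \<le> q"
    and big: "\<And>j. j < r \<Longrightarrow> a + 2 * q \<le> card {v\<in>V. c v = j}"
  defines "n \<equiv> card V"
  defines "\<rho> \<equiv> real ((n + 1) ^ m) * (3 / 4) ^ a"
  defines "S \<equiv> {G. G \<subseteq> [V]\<^bsup>2\<^esup> \<and> mono_edges G c \<noteq> {} \<and> card (mono_edges G c) \<le> K \<and>
      (\<forall>v\<in>V. card {w\<in>V. c w = c v \<and> {v, w} \<in> G} \<le> m) \<and>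
      (\<forall>u v. {u, v} \<in> mono_edges G c \<longrightarrow>
         (\<exists>j<r. j \<noteq> c u \<and> card {w\<in>V. c w = j \<and> {u, w} \<in> G \<and> {v, w} \<in> G} \<le> m))}"
  shows "real (card S) \<le> 2 ^ card (cross_edges V c) *
    ((\<Sum>s=1..q. (real (n * n * r) * real ((n + 1) ^ m) ^ 2 * \<rho>) ^ s)
     + (real (n * n * r) * \<rho>) ^ q * real (card ([V]\<^bsup>2\<^esup>) + 1) ^ K)"
proof -
  let ?E = "[V]\<^bsup>2\<^esup>"
  let ?X = "cross_edges V c"
  have fE: "finite ?E" using V by (rule finite_imp_finite_nsets)
  have fX: "finite ?X" using fE by (simp add: cross_edges_def)
  have \<rho>: "0 \<le> \<rho>" by (simp add: \<rho>_def)
  define pu where "pu p i = fst (p i)" for p :: "nat \<Rightarrow> 'a \<times> 'a \<times> nat" and i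
  define pv where "pv p i = fst (snd (p i))" for p :: "nat \<Rightarrow> 'a \<times> 'a \<times> nat" and i
  define pj where "pj p i = snd (snd (p i))" for p :: "nat \<Rightarrow> 'a \<times> 'a \<times> nat" and i
  define W where "W s p = (\<Union>i<s. {pu p i, pv p i})" for s p
  define T where "T s p i = {w\<in>V. c w = pj p i} - W s p" for s p i
  define D where "D s p i = (\<lambda>(x, w). {x, w}) ` ({pu p i, pv p i} \<times> T s p i)" for s p i
  define Q where "Q s p i = (\<lambda>K. card {w\<in>T s p i. {pu p i, w} \<in> K \<and> {pv p i, w} \<in> K} \<le> m)" for s p i
  define valid where "valid s p \<longleftrightarrow> (\<forall>i<s. pu p i \<noteq> pv p i \<and> pj p i \<noteq> c (pu p i) \<and> c (pu p i) = c (pv p i)) \<and>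
    (\<forall>i<s. \<forall>k<s. i \<noteq> k \<longrightarrow> {pu p i, pv p i} \<inter> {pu p k, pv p k} = {})" for s p
  define \<Sigma> where "\<Sigma> s = {p \<in> {..<s} \<rightarrow>\<^sub>E V \<times> V \<times> {..<r}. valid s p}" for s
  define HS where "HS s p = {H. H \<subseteq> ?X \<and> (\<forall>i\<in>{..<s}. Q s p i (H \<inter> D s p i))}" for s p
  define N1 where "N1 s p = {N. N \<subseteq> ?E \<and> (\<forall>e\<in>N. e \<inter> W s p \<noteq> {}) \<and> (\<forall>v\<in>W s p. card {w\<in>V. {v, w} \<in> N} \<le> m)}" for s p
  define N2 where "N2 = {N. N \<subseteq> ?E \<and> card N \<le> K}"
  have in\<Sigma>: "pu p i \<in> V" "pv p i \<in> V" "pj p i < r" if "p \<in> \<Sigma> s" "i < s" for p s i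
  proof -
    have "p i \<in> V \<times> V \<times> {..<r}" using that by (auto simp: \<Sigma>_def)
    then show "pu p i \<in> V" "pv p i \<in> V" "pj p i < r" by (auto simp: pu_def pv_def pj_def)
  qed
  have WV: "W s p \<subseteq> V" if "p \<in> \<Sigma> s" for s p using in\<Sigma>[OF that] by (auto simp: W_def)
  have cW: "card (W s p) \<le> 2 * s" for s p
  proof -
    have "card (W s p) \<le> (\<Sum>i<s. card {pu p i, pv p i})" unfolding W_def by (intro card_UN_le) simp
    also have "\<dots> \<le> (\<Sum>i<s. 2)" by (intro sum_mono) (simp add: card_insert_if)
    finally show ?thesis by simp
  qed
  have f\<Sigma>: "finite (\<Sigma> s)" for s
  proof -
    have "finite ({..<s} \<rightarrow>\<^sub>E V \<times> V \<times> {..<r})" using V by (intro finite_PiE) auto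
    then show ?thesis by (rule rev_finite_subset) (auto simp: \<Sigma>_def)
  qed
  have c\<Sigma>: "card (\<Sigma> s) \<le> (n * n * r) ^ s" for s
  proof -
    have "card (\<Sigma> s) \<le> card ({..<s} \<rightarrow>\<^sub>E V \<times> V \<times> {..<r})"
      using V by (intro card_mono finite_PiE) (auto simp: \<Sigma>_def)
    then show ?thesis by (simp add: card_PiE card_cartesian_product n_def mult.assoc)
  qed
  have HSle: "real (card (HS s p)) \<le> \<rho> ^ s * 2 ^ card ?X" if p: "p \<in> \<Sigma> s" and s: "s \<le> q" for s p
  proof -
    have "real (card (HS s p)) \<le> \<rho> ^ card {..<s} * 2 ^ card ?X"
      unfolding HS_def
    proof (rule card_restricted_subsets_le[OF _ fX \<rho>])
      fix i assume i: "i \<in> {..<s}"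
      then have v: "pu p i \<noteq> pv p i" "pj p i \<noteq> c (pu p i)" "c (pu p i) = c (pv p i)"
        using p by (auto simp: \<Sigma>_def valid_def)
      have i_s: "i < s" using i by simp
      note pin = in\<Sigma>[OF p i_s]
      show "D s p i \<subseteq> ?X" using v pin by (auto simp: D_def T_def)
      have fT: "finite (T s p i)" using V by (simp add: T_def)
      have nT: "pu p i \<notin> T s p i" "pv p i \<notin> T s p i" using i by (auto simp: T_def W_def)
      have Tn: "card (T s p i) \<le> n" unfolding n_def using V by (intro card_mono) (auto simp: T_def)
      have aT: "a \<le> card (T s p i)"
      proof -
        have "card {w\<in>V. c w = pj p i} - card (W s p) \<le> card (T s p i)"
          unfolding T_def using finite_subset[OF WV[OF p] V] by (rule diff_card_le_card_Diff)
        then show ?thesis using big[OF pin(3)] cW[of s p] s by linarith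
      qed
      note cd = card_small_codegree_le[OF fT v(1) nT, folded D_def]
      have "real (card {K. K \<subseteq> D s p i \<and> Q s p i K}) \<le> real ((card (T s p i) + 1) ^ m * 3 ^ card (T s p i))"
        unfolding Q_def of_nat_le_iff by (rule cd(2))
      also have "\<dots> \<le> real ((n + 1) ^ m) * 3 ^ card (T s p i)"
        using Tn by (simp add: power_mono)
      also have "(3::real) ^ card (T s p i) = (3 / 4) ^ card (T s p i) * 2 ^ (2 * card (T s p i))"
        by (simp add: power_mult power_divide)
      also have "real ((n + 1) ^ m) * \<dots> \<le> real ((n + 1) ^ m) * ((3 / 4) ^ a * 2 ^ (2 * card (T s p i)))"
        using aT by (intro mult_left_mono mult_right_mono power_decreasing) auto
      also have "\<dots> = \<rho> * 2 ^ card (D s p i)" unfolding cd(1) \<rho>_def by simp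
      finally show "real (card {K. K \<subseteq> D s p i \<and> Q s p i K}) \<le> \<rho> * 2 ^ card (D s p i)" .
    next
      fix i k assume ik: "i \<in> {..<s}" "k \<in> {..<s}" "i \<noteq> k"
      then have d: "{pu p i, pv p i} \<inter> {pu p k, pv p k} = {}" using p by (auto simp: \<Sigma>_def valid_def)
      have "False" if e: "e \<in> D s p i" "e \<in> D s p k" for e
      proof -
        obtain x w where x: "e = {x, w}" "x \<in> {pu p i, pv p i}" "w \<in> T s p i" using e(1) by (auto simp: D_def)
        obtain y z where y: "e = {y, z}" "y \<in> {pu p k, pv p k}" "z \<in> T s p k" using e(2) by (auto simp: D_def)
        have "x \<in> W s p" "y \<in> W s p" using x y ik by (auto simp: W_def)
        then have "x \<noteq> z" "y \<noteq> w" using x y by (auto simp: T_def)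
        then have "x = y" using x(1) y(1) by (auto simp: doubleton_eq_iff)
        then show False using d x(2) y(2) by blast
      qed
      then show "D s p i \<inter> D s p k = {}" by blast
    qed simp
    then show ?thesis by simp
  qed
  have N1le: "card (N1 s p) \<le> ((n + 1) ^ m) ^ (2 * s)" if "p \<in> \<Sigma> s" for s p
  proof -
    have "card (N1 s p) \<le> ((n + 1) ^ m) ^ card (W s p)"
      unfolding N1_def n_def by (rule card_covered_graphs_le[OF V WV[OF that]])
    also have "\<dots> \<le> ((n + 1) ^ m) ^ (2 * s)" using cW by (intro power_increasing) auto
    finally show ?thesis .
  qed
  have N2le: "card N2 \<le> (card ?E + 1) ^ K" unfolding N2_def by (rule card_small_subsets_le[OF fE])
  have fHS: "finite (HS s p)" for s p using fX by (simp add: HS_def)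
  have fN: "finite (N1 s p)" "finite N2" for s p using fE by (simp_all add: N1_def N2_def)
  define U1 where "U1 = (\<Union>s\<in>{1..q}. \<Union>p\<in>\<Sigma> s. (\<lambda>(N, H). N \<union> H) ` (N1 s p \<times> HS s p))"
  define U2 where "U2 = (\<Union>p\<in>\<Sigma> q. (\<lambda>(N, H). N \<union> H) ` (N2 \<times> HS q p))"
  have "S \<subseteq> U1 \<union> U2"
  proof
    fix G assume G: "G \<in> S"
    have GE: "G \<subseteq> ?E" using G by (simp add: S_def)
    have deg: "card {w\<in>V. c w = c v \<and> {v, w} \<in> G} \<le> m" if "v \<in> V" for v using G that by (simp add: S_def)
    have cod: "\<exists>j<r. j \<noteq> c u \<and> card {w\<in>V. c w = j \<and> {u, w} \<in> G \<and> {v, w} \<in> G} \<le> m"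
      if "{u, v} \<in> mono_edges G c" for u v
      using G that unfolding S_def by blast
    have "mono_edges G c \<noteq> {}" using G by (simp add: S_def)
    from ex_matching[OF this q] obtain s e where s: "1 \<le> s" "s \<le> q" "\<And>i. i < s \<Longrightarrow> e i \<in> mono_edges G c"
      "\<And>i j. i < s \<Longrightarrow> j < s \<Longrightarrow> i \<noteq> j \<Longrightarrow> e i \<inter> e j = {}"
      "s = q \<or> (\<forall>x\<in>mono_edges G c. \<exists>i<s. x \<inter> e i \<noteq> {})" by metis
    define R where "R i t \<longleftrightarrow> t \<in> V \<times> V \<times> {..<r} \<and> e i = {fst t, fst (snd t)} \<and> fst t \<noteq> fst (snd t) \<and>
        snd (snd t) \<noteq> c (fst t) \<and> c (fst t) = c (fst (snd t)) \<and>
        card {w\<in>V. c w = snd (snd t) \<and> {fst t, w} \<in> G \<and> {fst (snd t), w} \<in> G} \<le> m" for i t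
    have "\<exists>t. R i t" if i: "i < s" for i
    proof -
      have "e i \<in> ?E" using s(3)[OF i] GE by (auto simp: mono_edges_def)
      then obtain u v where uv: "e i = {u, v}" "u \<in> V" "v \<in> V" "u \<noteq> v" by (elim nsets2_E)
      have "{u, v} \<in> mono_edges G c" using s(3)[OF i] uv(1) by simp
      then obtain j where "j < r" "j \<noteq> c u" "card {w\<in>V. c w = j \<and> {u, w} \<in> G \<and> {v, w} \<in> G} \<le> m" "c u = c v"
        using cod[of u v] by auto
      then show ?thesis using uv unfolding R_def by (intro exI[of _ "(u, v, j)"]) simp
    qed
    then obtain t where t: "\<And>i. i < s \<Longrightarrow> R i (t i)" by metis
    define p where "p = restrict t {..<s}"
    have pt: "e i = {pu p i, pv p i}" "pu p i \<noteq> pv p i" "pj p i \<noteq> c (pu p i)" "c (pu p i) = c (pv p i)"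
        "card {w\<in>V. c w = pj p i \<and> {pu p i, w} \<in> G \<and> {pv p i, w} \<in> G} \<le> m" if "i < s" for i
      using t[OF that] that by (simp_all add: R_def p_def pu_def pv_def pj_def)
    have "valid s p"
      unfolding valid_def
    proof (intro conjI allI impI pt)
      fix i k assume ik: "i < s" "k < s" "i \<noteq> k"
      show "{pu p i, pv p i} \<inter> {pu p k, pv p k} = {}"
        using s(4)[OF ik] unfolding pt(1)[OF ik(1)] pt(1)[OF ik(2)] .
    qed
    moreover have "p \<in> {..<s} \<rightarrow>\<^sub>E V \<times> V \<times> {..<r}" unfolding p_def restrict_PiE_iff using t by (auto simp: R_def)
    ultimately have p: "p \<in> \<Sigma> s" by (simp add: \<Sigma>_def)
    have H: "G \<inter> ?X \<in> HS s p"
      unfolding HS_def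
    proof (intro CollectI conjI ballI)
      fix i assume "i \<in> {..<s}"
      then have i: "i < s" by simp
      have "card {w\<in>T s p i. {pu p i, w} \<in> G \<inter> ?X \<inter> D s p i \<and> {pv p i, w} \<in> G \<inter> ?X \<inter> D s p i}
          \<le> card {w\<in>V. c w = pj p i \<and> {pu p i, w} \<in> G \<and> {pv p i, w} \<in> G}"
        using V by (intro card_mono) (auto simp: T_def)
      then show "Q s p i (G \<inter> ?X \<inter> D s p i)" unfolding Q_def using pt(5)[OF i] by linarith
    qed simp
    note split = mono_cross_split[OF GE, of c]
    have ME: "mono_edges G c \<subseteq> ?E" using mono_edges_subset GE by blast
    show "G \<in> U1 \<union> U2"
    proof (cases "s = q")
      case True
      have "mono_edges G c \<in> N2" using G ME by (simp add: N2_def S_def)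
      then have "mono_edges G c \<union> (G \<inter> ?X) \<in> (\<lambda>(N, H). N \<union> H) ` (N2 \<times> HS q p)"
        using H True by (intro image_eqI[of _ _ "(mono_edges G c, G \<inter> ?X)"]) simp_all
      then have "G \<in> (\<lambda>(N, H). N \<union> H) ` (N2 \<times> HS q p)" unfolding split .
      moreover have "p \<in> \<Sigma> q" using p True by simp
      ultimately have "G \<in> U2" unfolding U2_def by (intro UN_I)
      then show ?thesis ..
    next
      case False
      have "mono_edges G c \<in> N1 s p"
        unfolding N1_def
      proof (intro CollectI conjI ballI)
        show "mono_edges G c \<subseteq> ?E" by (rule ME)
        show "x \<inter> W s p \<noteq> {}" if x: "x \<in> mono_edges G c" for x
        proof -
          obtain i where "i < s" "x \<inter> e i \<noteq> {}" using False s(5) x by blast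
          then show ?thesis using pt(1)[of i] by (auto simp: W_def)
        qed
        show "card {w\<in>V. {v, w} \<in> mono_edges G c} \<le> m" if "v \<in> W s p" for v
        proof -
          have "{w\<in>V. {v, w} \<in> mono_edges G c} \<subseteq> {w\<in>V. c w = c v \<and> {v, w} \<in> G}"
            unfolding mono_edges_iff by force
          then have "card {w\<in>V. {v, w} \<in> mono_edges G c} \<le> card {w\<in>V. c w = c v \<and> {v, w} \<in> G}"
            using V by (intro card_mono) auto
          then show ?thesis using deg[of v] WV[OF p] that by (meson order_trans subsetD)
        qed
      qed
      then have "mono_edges G c \<union> (G \<inter> ?X) \<in> (\<lambda>(N, H). N \<union> H) ` (N1 s p \<times> HS s p)"
        using H by (intro image_eqI[of _ _ "(mono_edges G c, G \<inter> ?X)"]) simp_all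
      then have "G \<in> (\<lambda>(N, H). N \<union> H) ` (N1 s p \<times> HS s p)" unfolding split .
      moreover have "s \<in> {1..q}" using s(1,2) by simp
      ultimately have "G \<in> U1" unfolding U1_def using p by (intro UN_I)
      then show ?thesis ..
    qed
  qed
  moreover have "finite (U1 \<union> U2)"
    using f\<Sigma> fHS fN unfolding U1_def U2_def by (intro finite_UnI finite_UN_I finite_imageI finite_cartesian_product) auto
  ultimately have "card S \<le> card (U1 \<union> U2)" by (rule card_mono[rotated])
  then have "card S \<le> card U1 + card U2" using card_Un_le[of U1 U2] by linarith
  then have "real (card S) \<le> real (card U1) + real (card U2)" by linarith
  moreover have prod: "real (card ((\<lambda>(N, H). N \<union> H) ` (A \<times> HS s p))) \<le> real (card A) * real (card (HS s p))"
    if "finite A" for A :: "'a set set set" and s p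
  proof -
    have "card ((\<lambda>(N, H). N \<union> H) ` (A \<times> HS s p)) \<le> card (A \<times> HS s p)"
      using that fHS by (intro card_image_le finite_cartesian_product)
    then show ?thesis by (simp only: card_cartesian_product of_nat_mult[symmetric] of_nat_le_iff)
  qed
  have "real (card U1) \<le> (\<Sum>s=1..q. 2 ^ card ?X * (real (n * n * r) * real ((n + 1) ^ m) ^ 2 * \<rho>) ^ s)"
  proof -
    have "card U1 \<le> (\<Sum>s=1..q. card (\<Union>p\<in>\<Sigma> s. (\<lambda>(N, H). N \<union> H) ` (N1 s p \<times> HS s p)))"
      unfolding U1_def by (rule card_UN_le) simp
    also have "\<dots> \<le> (\<Sum>s=1..q. \<Sum>p\<in>\<Sigma> s. card ((\<lambda>(N, H). N \<union> H) ` (N1 s p \<times> HS s p)))"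
      by (intro sum_mono card_UN_le f\<Sigma>)
    finally have "real (card U1) \<le> (\<Sum>s=1..q. \<Sum>p\<in>\<Sigma> s. real (card ((\<lambda>(N, H). N \<union> H) ` (N1 s p \<times> HS s p))))"
      by (simp only: of_nat_sum[symmetric] of_nat_le_iff)
    also have "\<dots> \<le> (\<Sum>s=1..q. \<Sum>p\<in>\<Sigma> s. real ((n + 1) ^ m) ^ (2 * s) * (\<rho> ^ s * 2 ^ card ?X))"
    proof (intro sum_mono)
      fix s p assume sp: "s \<in> {1..q}" "p \<in> \<Sigma> s"
      have "real (card (N1 s p)) \<le> real ((n + 1) ^ m) ^ (2 * s)"
        using N1le[OF sp(2)] by (simp only: of_nat_power[symmetric] of_nat_le_iff)
      then have "real (card (N1 s p)) * real (card (HS s p)) \<le> real ((n + 1) ^ m) ^ (2 * s) * (\<rho> ^ s * 2 ^ card ?X)"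
        using HSle[OF sp(2)] sp(1) by (intro mult_mono) auto
      then show "real (card ((\<lambda>(N, H). N \<union> H) ` (N1 s p \<times> HS s p))) \<le> real ((n + 1) ^ m) ^ (2 * s) * (\<rho> ^ s * 2 ^ card ?X)"
        using prod[OF fN(1), of s p s p] by linarith
    qed
    also have "\<dots> = (\<Sum>s=1..q. real (card (\<Sigma> s)) * (real ((n + 1) ^ m) ^ (2 * s) * (\<rho> ^ s * 2 ^ card ?X)))" by simp
    also have "\<dots> \<le> (\<Sum>s=1..q. real (n * n * r) ^ s * (real ((n + 1) ^ m) ^ (2 * s) * (\<rho> ^ s * 2 ^ card ?X)))"
    proof (intro sum_mono mult_right_mono)
      show "real (card (\<Sigma> s)) \<le> real (n * n * r) ^ s" for s using c\<Sigma>[of s] by (simp only: of_nat_power[symmetric] of_nat_le_iff)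
    qed (use \<rho> in auto)
    also have "\<dots> = (\<Sum>s=1..q. 2 ^ card ?X * (real (n * n * r) * real ((n + 1) ^ m) ^ 2 * \<rho>) ^ s)"
      by (intro sum.cong refl) (simp add: power_mult_distrib power_mult[symmetric] mult_ac del: of_nat_mult of_nat_power)
    finally show ?thesis .
  qed
  moreover have "real (card U2) \<le> 2 ^ card ?X * ((real (n * n * r) * \<rho>) ^ q * real (card ?E + 1) ^ K)"
  proof -
    have "card U2 \<le> (\<Sum>p\<in>\<Sigma> q. card ((\<lambda>(N, H). N \<union> H) ` (N2 \<times> HS q p)))"
      unfolding U2_def by (intro card_UN_le f\<Sigma>)
    then have "real (card U2) \<le> (\<Sum>p\<in>\<Sigma> q. real (card ((\<lambda>(N, H). N \<union> H) ` (N2 \<times> HS q p))))"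
      by (simp only: of_nat_sum[symmetric] of_nat_le_iff)
    also have "\<dots> \<le> (\<Sum>p\<in>\<Sigma> q. real (card ?E + 1) ^ K * (\<rho> ^ q * 2 ^ card ?X))"
    proof (intro sum_mono)
      fix p assume p: "p \<in> \<Sigma> q"
      have "real (card N2) \<le> real (card ?E + 1) ^ K" using N2le by (simp only: of_nat_power[symmetric] of_nat_le_iff)
      then have "real (card N2) * real (card (HS q p)) \<le> real (card ?E + 1) ^ K * (\<rho> ^ q * 2 ^ card ?X)"
        using HSle[OF p] by (intro mult_mono) auto
      then show "real (card ((\<lambda>(N, H). N \<union> H) ` (N2 \<times> HS q p))) \<le> real (card ?E + 1) ^ K * (\<rho> ^ q * 2 ^ card ?X)"
        using prod[OF fN(2), of q p] by linarith
    qed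
    also have "\<dots> = real (card (\<Sigma> q)) * (real (card ?E + 1) ^ K * (\<rho> ^ q * 2 ^ card ?X))" by simp
    also have "\<dots> \<le> real (n * n * r) ^ q * (real (card ?E + 1) ^ K * (\<rho> ^ q * 2 ^ card ?X))"
    proof (rule mult_right_mono)
      show "real (card (\<Sigma> q)) \<le> real (n * n * r) ^ q" using c\<Sigma>[of q] by (simp only: of_nat_power[symmetric] of_nat_le_iff)
    qed (use \<rho> in auto)
    finally show ?thesis by (simp add: power_mult_distrib mult_ac del: of_nat_mult)
  qed
  ultimately show ?thesis by (simp only: distrib_left sum_distrib_left)
qed

lemma exp_le_2_powr:
  fixes x :: real
  assumes "0 \<le> x"
  shows "exp x \<le> 2 powr (2 * x)"
proof -
  have "exp (1 / 2 :: real) \<le> 2" using exp_bound[of "1 / 2"] by (simp add: power2_eq_square)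
  then have "1 / 2 \<le> ln (2 :: real)" by (subst ln_ge_iff) simp_all
  then have "x * 1 \<le> x * (2 * ln 2)" using assms by (intro mult_left_mono) auto
  then show ?thesis by (simp add: powr_def)
qed

text \<open>A set \<open>A\<close> witnessing the failure of richness forces the graph to be \<open>K\<^sub>r\<close>-free on \<open>r * m\<close>
  vertices. By \<open>card_clique_free_le\<close>, applied with \<open>r - 1\<close> in place of \<open>r\<close>, this costs a factor
  exponential in \<open>m\<^sup>2\<close> against the \<open>2 ^ card V\<close> choices of \<open>A\<close>.\<close>

lemma card_not_rich_le:
  fixes L :: real
  assumes V: "finite V" and c: "c ` V \<subseteq> {..<r}" and r: "2 \<le> r" "real r \<le> L" and L: "100 \<le> L" "36 * ln L \<le> L"
    and n: "L ^ (62 * (r - 1) + 22) \<le> real (r * m)"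
  shows "real (card {H. H \<subseteq> cross_edges V c \<and> \<not> rich V r m c H})
    \<le> 2 ^ card V * (2 powr (- (real m ^ 2 / 4)) * 2 ^ card (cross_edges V c))"
proof -
  let ?X = "cross_edges V c"
  define \<A> where "\<A> = {A. A \<subseteq> V \<and> (\<forall>i<r. card {v\<in>A. c v = i} = m)}"
  define \<rho> where "\<rho> = 2 powr (- (real m ^ 2 / 4))"
  have fX: "finite ?X" using V by (simp add: cross_edges_def finite_imp_finite_nsets)
  have f\<A>: "finite \<A>" "card \<A> \<le> 2 ^ card V"
  proof -
    have "\<A> \<subseteq> Pow V" by (auto simp: \<A>_def)
    then show "finite \<A>" "card \<A> \<le> 2 ^ card V"
      using V card_mono[of "Pow V" \<A>] by (auto simp: card_Pow intro: finite_subset)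
  qed
  have A: "real (card {H. H \<subseteq> ?X \<and> cfree A r H}) \<le> \<rho> * 2 ^ card ?X" if A: "A \<in> \<A>" for A
  proof -
    have AV: "A \<subseteq> V" and Am: "\<And>i. i < r \<Longrightarrow> card {v\<in>A. c v = i} = m" using A by (auto simp: \<A>_def)
    have fA: "finite A" using AV V by (rule finite_subset)
    have cA: "c ` A \<subseteq> {..<r}" using c AV by blast
    have cardA: "card A = r * m" using sum_card_color_classes[OF fA cA] Am by simp
    define M where "M = real (card A)"
    have "real (card {K. K \<subseteq> cross_edges A c \<and> cfree A r K}) \<le> \<rho> * 2 ^ card (cross_edges A c)"
    proof -
      have "card {K. K \<subseteq> cross_edges A c \<and> cfree A r K} \<le> card {G. G \<subseteq> [A]\<^bsup>2\<^esup> \<and> cfree A (r - 1 + 1) G}"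
        using r(1) fA by (intro card_mono) (auto simp: cross_edges_def finite_imp_finite_nsets)
      also have "real \<dots> \<le> exp (M ^ 2 / L ^ 17) *
          2 powr ((1 - 1 / real (r - 1)) * M ^ 2 / 2 + 4 * M ^ 2 / L ^ 18)"
        unfolding M_def using r L n cardA by (intro card_clique_free_le fA) (auto simp: of_nat_diff)
      also have "\<dots> \<le> 2 powr (2 * (M ^ 2 / L ^ 17)) *
          2 powr ((1 - 1 / real (r - 1)) * M ^ 2 / 2 + 4 * M ^ 2 / L ^ 18)"
        using L by (intro mult_right_mono exp_le_2_powr) auto
      also have "\<dots> = 2 powr (2 * (M ^ 2 / L ^ 17) + ((1 - 1 / real (r - 1)) * M ^ 2 / 2 + 4 * M ^ 2 / L ^ 18))"
        by (rule powr_add[symmetric])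
      also have "\<dots> \<le> 2 powr (- (real m ^ 2 / 4) + (1 - 1 / real r) * M ^ 2 / 2)"
      proof (rule powr_mono)
        have M2: "M ^ 2 = real r ^ 2 * real m ^ 2" by (simp add: M_def cardA power_mult_distrib)
        have "real m ^ 2 / 2 \<le> (1 / real (r - 1) - 1 / real r) * M ^ 2 / 2"
        proof -
          obtain s where s: "r = Suc s" "1 \<le> s" using r(1) by (cases r) auto
          define S where "S = real s"
          have S: "0 < S" "real r = S + 1" "real (r - 1) = S" using s by (simp_all add: S_def)
          have "1 / S - 1 / (S + 1) = 1 / (S * (S + 1))" using S(1) by (simp add: field_simps)
          then have "(1 / real (r - 1) - 1 / real r) * M ^ 2 = (S + 1) / S * real m ^ 2"
            unfolding M2 S(2,3) using S(1) by (simp add: power2_eq_square)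
          moreover have "1 * real m ^ 2 \<le> (S + 1) / S * real m ^ 2"
            using S(1) by (intro mult_right_mono) auto
          ultimately show ?thesis by simp
        qed
        then have 1: "(1 - 1 / real (r - 1)) * M ^ 2 / 2 \<le> (1 - 1 / real r) * M ^ 2 / 2 - real m ^ 2 / 2"
          by (simp add: algebra_simps diff_divide_distrib)
        have e: "M ^ 2 / L ^ j \<le> real m ^ 2 / 24" if "3 \<le> j" for j
        proof -
          have "M ^ 2 * 24 \<le> L ^ 2 * real m ^ 2 * L"
            unfolding M2 using r L by (intro mult_mono power_mono) auto
          also have "\<dots> = real m ^ 2 * L ^ 3" by (simp add: power2_eq_square power3_eq_cube)
          also have "\<dots> \<le> real m ^ 2 * L ^ j" using L that by (intro mult_left_mono power_increasing) auto
          finally show ?thesis using L by (simp add: field_simps)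
        qed
        have "M ^ 2 / L ^ 17 \<le> real m ^ 2 / 24" by (rule e) simp
        then have "2 * (M ^ 2 / L ^ 17) \<le> real m ^ 2 / 12" by linarith
        moreover have "M ^ 2 / L ^ 18 \<le> real m ^ 2 / 24" by (rule e) simp
        then have "4 * (M ^ 2 / L ^ 18) \<le> real m ^ 2 / 6" by linarith
        then have "4 * M ^ 2 / L ^ 18 \<le> real m ^ 2 / 6" by (simp only: times_divide_eq_right)
        ultimately show "2 * (M ^ 2 / L ^ 17) + ((1 - 1 / real (r - 1)) * M ^ 2 / 2 + 4 * M ^ 2 / L ^ 18)
            \<le> - (real m ^ 2 / 4) + (1 - 1 / real r) * M ^ 2 / 2"
          using 1 by linarith
      qed simp
      also have "\<dots> = \<rho> * 2 powr (real (card (cross_edges A c)))"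
      proof -
        have "(\<Sum>i<r. (real (card {v\<in>A. c v = i}) - real (card A) / real r) ^ 2) = 0"
          using r(1) Am cardA by simp
        then have "(1 - 1 / real r) * M ^ 2 / 2 = real (card (cross_edges A c))"
          using card_cross_edges[OF fA cA] r(1) by (simp add: M_def)
        then show ?thesis by (simp only: \<rho>_def powr_add)
      qed
      finally show ?thesis by (simp add: powr_realpow)
    qed
    then have "real (card {H. H \<subseteq> ?X \<and> (\<forall>i\<in>{0::nat}. (\<lambda>K. cfree A r K) (H \<inter> cross_edges A c))})
        \<le> \<rho> ^ card {0::nat} * 2 ^ card ?X"
      using AV fX by (intro card_restricted_subsets_le) (auto simp: \<rho>_def cross_edges_def nsets_def)
    moreover have "cfree A r (H \<inter> cross_edges A c)" if "cfree A r H" for H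
      using that by (rule cfree_antimono[rotated]) blast
    then have "card {H. H \<subseteq> ?X \<and> cfree A r H} \<le> card {H. H \<subseteq> ?X \<and> (\<forall>i\<in>{0::nat}. cfree A r (H \<inter> cross_edges A c))}"
      using fX by (intro card_mono) auto
    ultimately show ?thesis by simp
  qed
  have "{H. H \<subseteq> ?X \<and> \<not> rich V r m c H} \<subseteq> (\<Union>A\<in>\<A>. {H. H \<subseteq> ?X \<and> cfree A r H})"
    by (auto simp: rich_def \<A>_def)
  then have "card {H. H \<subseteq> ?X \<and> \<not> rich V r m c H} \<le> card (\<Union>A\<in>\<A>. {H. H \<subseteq> ?X \<and> cfree A r H})"
    using f\<A> fX by (intro card_mono) auto
  also have "\<dots> \<le> (\<Sum>A\<in>\<A>. card {H. H \<subseteq> ?X \<and> cfree A r H})" by (intro card_UN_le f\<A>)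
  finally have "real (card {H. H \<subseteq> ?X \<and> \<not> rich V r m c H}) \<le> (\<Sum>A\<in>\<A>. real (card {H. H \<subseteq> ?X \<and> cfree A r H}))"
    by (simp only: of_nat_sum[symmetric] of_nat_le_iff)
  also have "\<dots> \<le> (\<Sum>A\<in>\<A>. \<rho> * 2 ^ card ?X)" using A by (rule sum_mono)
  also have "\<dots> = real (card \<A>) * (\<rho> * 2 ^ card ?X)" by simp
  also have "\<dots> \<le> 2 ^ card V * (\<rho> * 2 ^ card ?X)"
  proof (rule mult_right_mono)
    show "real (card \<A>) \<le> 2 ^ card V" using f\<A>(2) by (metis of_nat_le_iff of_nat_numeral of_nat_power)
  qed (simp add: \<rho>_def)
  finally show ?thesis by (simp add: \<rho>_def)
qed

section \<open>Partite graphs\<close>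

definition partite_on :: "'a set \<Rightarrow> nat \<Rightarrow> 'a set set set" where
  "partite_on V r = {G. G \<subseteq> [V]\<^bsup>2\<^esup> \<and> (\<exists>c. c ` V \<subseteq> {..<r} \<and> mono_edges G c = {})}"

definition clique_free_on :: "'a set \<Rightarrow> nat \<Rightarrow> 'a set set set" where
  "clique_free_on V k = {G. G \<subseteq> [V]\<^bsup>2\<^esup> \<and> cfree V k G}"

lemma cross_edges_partite:
  assumes "c ` V \<subseteq> {..<r}" "H \<subseteq> cross_edges V c"
  shows "H \<in> partite_on V r"
proof -
  have "mono_edges H c = {}" using assms(2) unfolding mono_edges_def cross_edges_def by blast
  moreover have "H \<subseteq> [V]\<^bsup>2\<^esup>" using assms(2) by (auto simp: cross_edges_def)
  ultimately show ?thesis using assms(1) by (auto simp: partite_on_def)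
qed

lemma finite_partite_on: "finite V \<Longrightarrow> finite (partite_on V r)"
  by (simp add: partite_on_def finite_imp_finite_nsets)

lemma finite_cross_edges: "finite V \<Longrightarrow> finite (cross_edges V c)"
  by (simp add: cross_edges_def finite_imp_finite_nsets)

text \<open>Colouring the vertices one by one, each with the colour used least so far.\<close>

lemma ex_few_mono_edges:
  assumes "finite V" "0 < r"
  shows "\<exists>c. c ` V \<subseteq> {..<r} \<and> r * card (mono_edges ([V]\<^bsup>2\<^esup>) c) \<le> card ([V]\<^bsup>2\<^esup>)"
  using assms(1)
proof (induction V)
  case empty
  have "[{}]\<^bsup>2\<^esup> = ({} :: 'a set set)" by (simp add: nsets_empty_iff)
  then show ?case by (simp add: mono_edges_def)
next
  case (insert x V)
  then obtain c where c: "c ` V \<subseteq> {..<r}" "r * card (mono_edges ([V]\<^bsup>2\<^esup>) c) \<le> card ([V]\<^bsup>2\<^esup>)" by blast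
  have "\<exists>j<r. r * card {v\<in>V. c v = j} \<le> card V"
  proof (rule ccontr)
    assume no: "\<not> ?thesis"
    have "(\<Sum>j<r. card V) < (\<Sum>j<r. r * card {v\<in>V. c v = j})"
      using no assms(2) by (intro sum_strict_mono) (auto simp: not_le)
    also have "\<dots> = r * card V"
      by (simp only: sum_distrib_left[symmetric] sum_card_color_classes[OF insert.hyps(1) c(1)])
    finally show False by simp
  qed
  then obtain j where j: "j < r" "r * card {v\<in>V. c v = j} \<le> card V" by blast
  define c' where "c' = c(x := j)"
  have fE: "finite ([V]\<^bsup>2\<^esup>)" using insert.hyps(1) by (rule finite_imp_finite_nsets)
  have cc: "c' v = c v" if "v \<in> V" for v using insert.hyps(2) that by (auto simp: c'_def)
  have E: "[insert x V]\<^bsup>2\<^esup> = [V]\<^bsup>2\<^esup> \<union> (\<lambda>v. {x, v}) ` V"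
    using insert.hyps(2) by (auto simp: nsets_2_eq insert_commute)
  have inj: "inj_on (\<lambda>v. {x, v}) A" for A by (auto simp: inj_on_def doubleton_eq_iff)
  have dis: "[V]\<^bsup>2\<^esup> \<inter> (\<lambda>v. {x, v}) ` V = {}" using insert.hyps(2) by (auto simp: nsets_def)
  have cE: "card ([insert x V]\<^bsup>2\<^esup>) = card ([V]\<^bsup>2\<^esup>) + card V"
    unfolding E using fE insert.hyps(1) dis inj by (simp add: card_Un_disjoint card_image)
  have "mono_edges ([insert x V]\<^bsup>2\<^esup>) c' \<subseteq> mono_edges ([V]\<^bsup>2\<^esup>) c \<union> (\<lambda>v. {x, v}) ` {v\<in>V. c v = j}"
  proof
    fix e assume e: "e \<in> mono_edges ([insert x V]\<^bsup>2\<^esup>) c'"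
    then have "e \<in> [V]\<^bsup>2\<^esup> \<or> (\<exists>v\<in>V. e = {x, v})" using E mono_edges_subset by blast
    then show "e \<in> mono_edges ([V]\<^bsup>2\<^esup>) c \<union> (\<lambda>v. {x, v}) ` {v\<in>V. c v = j}"
    proof
      assume eV: "e \<in> [V]\<^bsup>2\<^esup>"
      then obtain u v where uv: "e = {u, v}" "u \<in> V" "v \<in> V" by (elim nsets2_E)
      have "c' u = c' v" using mono_edges_eq[OF e] uv(1) by simp
      then have "c u = c v" using cc uv by simp
      then have "e \<in> mono_edges ([V]\<^bsup>2\<^esup>) c" unfolding uv(1) mono_edges_iff using eV uv(1) by simp
      then show ?thesis ..
    next
      assume "\<exists>v\<in>V. e = {x, v}"
      then obtain v where v: "v \<in> V" "e = {x, v}" by blast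
      have "c' x = c' v" using mono_edges_eq[OF e] v(2) by simp
      then have "c v = j" using cc[OF v(1)] by (simp add: c'_def)
      then show ?thesis using v by blast
    qed
  qed
  then have "card (mono_edges ([insert x V]\<^bsup>2\<^esup>) c') \<le> card (mono_edges ([V]\<^bsup>2\<^esup>) c \<union> (\<lambda>v. {x, v}) ` {v\<in>V. c v = j})"
    using fE insert.hyps(1) by (intro card_mono) (auto intro: finite_subset[OF mono_edges_subset])
  also have "\<dots> \<le> card (mono_edges ([V]\<^bsup>2\<^esup>) c) + card {v\<in>V. c v = j}"
    using card_Un_le[of "mono_edges ([V]\<^bsup>2\<^esup>) c" "(\<lambda>v. {x, v}) ` {v\<in>V. c v = j}"] inj by (simp add: card_image)
  finally have "card (mono_edges ([insert x V]\<^bsup>2\<^esup>) c') \<le> card (mono_edges ([V]\<^bsup>2\<^esup>) c) + card {v\<in>V. c v = j}" .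
  then have "r * card (mono_edges ([insert x V]\<^bsup>2\<^esup>) c') \<le> r * (card (mono_edges ([V]\<^bsup>2\<^esup>) c) + card {v\<in>V. c v = j})"
    by (rule mult_le_mono2)
  also have "\<dots> \<le> card ([V]\<^bsup>2\<^esup>) + card V" using c(2) j(2) by (simp add: distrib_left)
  finally have "r * card (mono_edges ([insert x V]\<^bsup>2\<^esup>) c') \<le> card ([insert x V]\<^bsup>2\<^esup>)" unfolding cE .
  moreover have "c' ` insert x V \<subseteq> {..<r}" using c(1) j(1) by (auto simp: c'_def)
  ultimately show ?case by blast
qed

lemma card_partite_ge:
  assumes V: "finite V" and r: "0 < r"
  shows "2 powr ((1 - 1 / real r) * real (card V) ^ 2 / 2 - real (card V) / 2) \<le> real (card (partite_on V r))"
proof -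
  let ?E = "[V]\<^bsup>2\<^esup>"
  obtain c where c: "c ` V \<subseteq> {..<r}" "r * card (mono_edges ?E c) \<le> card ?E"
    using ex_few_mono_edges[OF assms] by blast
  have fE: "finite ?E" using V by (rule finite_imp_finite_nsets)
  define n where "n = real (card V)"
  have cE: "real (card ?E) = n * (n - 1) / 2"
  proof (cases "card V")
    case 0
    then show ?thesis using card_nsets_2[OF V] by (simp add: n_def)
  next
    case (Suc k)
    have "2 dvd card V * (card V - 1)" unfolding Suc by simp
    then have "2 * real (card ?E) = real (card V * (card V - 1))"
      unfolding card_nsets_2[OF V] choose_two by (metis dvd_mult_div_cancel of_nat_mult of_nat_numeral)
    then show ?thesis using Suc by (simp add: n_def algebra_simps)
  qed
  have "?E = mono_edges ?E c \<union> cross_edges V c"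
    using mono_cross_split[of ?E V c] by (auto simp: cross_edges_def)
  then have "card ?E \<le> card (mono_edges ?E c) + card (cross_edges V c)"
    using card_Un_le by metis
  then have 1: "real (card ?E) \<le> real (card (mono_edges ?E c)) + real (card (cross_edges V c))" by linarith
  have 2: "real (card (mono_edges ?E c)) \<le> real (card ?E) / real r"
  proof -
    have "real r * real (card (mono_edges ?E c)) \<le> real (card ?E)"
      using c(2) by (simp only: of_nat_mult[symmetric] of_nat_le_iff)
    then show ?thesis using r by (simp add: field_simps)
  qed
  have "(1 - 1 / real r) * n ^ 2 / 2 - n / 2 \<le> real (card ?E) - real (card ?E) / real r"
  proof -
    define u where "u = 1 - 1 / real r"
    have "u * n \<le> 1 * n" using r by (intro mult_right_mono) (auto simp: n_def u_def)
    moreover have "real (card ?E) - real (card ?E) / real r = u * real (card ?E)"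
      by (simp add: left_diff_distrib u_def)
    moreover have "u * real (card ?E) = u * n ^ 2 / 2 - u * n / 2"
      unfolding cE by (simp add: algebra_simps power2_eq_square diff_divide_distrib)
    ultimately show ?thesis unfolding u_def[symmetric] by linarith
  qed
  then have "2 powr ((1 - 1 / real r) * n ^ 2 / 2 - n / 2) \<le> 2 powr real (card (cross_edges V c))"
    using 1 2 by (intro powr_mono) auto
  also have "\<dots> = real (card (Pow (cross_edges V c)))"
    using finite_cross_edges[OF V, of c] by (simp add: card_Pow powr_realpow)
  also have "\<dots> \<le> real (card (partite_on V r))"
    using cross_edges_partite[OF c(1)] finite_partite_on[OF V] by (intro of_nat_mono card_mono) auto
  finally show ?thesis unfolding n_def .
qed

text \<open>Each graph is rich for few balanced colourings, so the sum over balanced colourings counts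
  partite graphs almost without repetition. A factor of size \<open>2 powr o(card V / r)\<close> is affordable
  here, as a single monochromatic edge already costs more.\<close>

lemma sum_balanced_colorings_le:
  fixes m :: nat
  assumes V: "finite V" "V \<noteq> {}"
    and half: "\<And>c. c ` V \<subseteq> {..<r} \<Longrightarrow>
      2 * real (card {H. H \<subseteq> cross_edges V c \<and> \<not> rich V r m c H}) \<le> 2 ^ card (cross_edges V c)"
  defines "B \<equiv> {c \<in> V \<rightarrow>\<^sub>E {..<r}. \<forall>i<r. r * m < card {v\<in>V. c v = i}}"
  shows "(\<Sum>c\<in>B. (2::real) ^ card (cross_edges V c)) \<le> 2 * real (r ^ r * (card V * r) ^ (r * r * m)) * real (card (partite_on V r))"
proof -
  let ?P = "partite_on V r"
  let ?X = "cross_edges V"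
  have "finite (V \<rightarrow>\<^sub>E {..<r})" using V(1) by (intro finite_PiE) auto
  then have fB: "finite B" by (rule rev_finite_subset) (auto simp: B_def)
  have cB: "c ` V \<subseteq> {..<r}" if "c \<in> B" for c using that by (auto simp: B_def)
  have le: "(2::real) ^ card (?X c) \<le> 2 * (\<Sum>H\<in>?P. of_bool (H \<subseteq> ?X c \<and> rich V r m c H))" if c: "c \<in> B" for c
  proof -
    have fX: "finite (?X c)" using V(1) by (rule finite_cross_edges)
    have "(2::real) ^ card (?X c) = real (card (Pow (?X c)))" using fX by (simp add: card_Pow)
    also have "Pow (?X c) = {H. H \<subseteq> ?X c \<and> rich V r m c H} \<union> {H. H \<subseteq> ?X c \<and> \<not> rich V r m c H}" by blast
    also have "real (card \<dots>) = real (card {H. H \<subseteq> ?X c \<and> rich V r m c H}) + real (card {H. H \<subseteq> ?X c \<and> \<not> rich V r m c H})"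
      using fX by (subst card_Un_disjoint) auto
    finally have "2 ^ card (?X c) \<le> 2 * real (card {H. H \<subseteq> ?X c \<and> rich V r m c H})"
      using half[OF cB[OF c]] by linarith
    also have "{H. H \<subseteq> ?X c \<and> rich V r m c H} = ?P \<inter> {H. H \<subseteq> ?X c \<and> rich V r m c H}"
      using cross_edges_partite[OF cB[OF c]] by blast
    also have "real (card \<dots>) = (\<Sum>H\<in>?P. of_bool (H \<subseteq> ?X c \<and> rich V r m c H))"
      using finite_partite_on[OF V(1)] by simp
    finally show ?thesis .
  qed
  have "(\<Sum>c\<in>B. (2::real) ^ card (?X c)) \<le> (\<Sum>c\<in>B. 2 * (\<Sum>H\<in>?P. of_bool (H \<subseteq> ?X c \<and> rich V r m c H)))"
    using le by (rule sum_mono)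
  also have "\<dots> = 2 * (\<Sum>H\<in>?P. \<Sum>c\<in>B. of_bool (H \<subseteq> ?X c \<and> rich V r m c H))"
    unfolding sum_distrib_left[symmetric] by (subst sum.swap) (rule refl)
  also have "\<dots> \<le> 2 * (\<Sum>H\<in>?P. real (r ^ r * (card V * r) ^ (r * r * m)))"
  proof (intro mult_left_mono sum_mono)
    fix H
    have "(\<Sum>c\<in>B. of_bool (H \<subseteq> ?X c \<and> rich V r m c H)) = real (card (B \<inter> {c. H \<subseteq> ?X c \<and> rich V r m c H}))"
      using fB by simp
    also have "B \<inter> {c. H \<subseteq> ?X c \<and> rich V r m c H}
      = {c \<in> V \<rightarrow>\<^sub>E {..<r}. (\<forall>i<r. r * m < card {v\<in>V. c v = i}) \<and> H \<subseteq> cross_edges V c \<and> rich V r m c H}"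
      unfolding B_def by blast
    also have "real (card \<dots>) \<le> real (r ^ r * (card V * r) ^ (r * r * m))"
      unfolding of_nat_le_iff by (rule card_rich_colorings_le[OF V])
    finally show "(\<Sum>c\<in>B. of_bool (H \<subseteq> ?X c \<and> rich V r m c H)) \<le> real (r ^ r * (card V * r) ^ (r * r * m))" .
  qed simp
  also have "\<dots> = 2 * real (r ^ r * (card V * r) ^ (r * r * m)) * real (card ?P)"
    by (simp only: sum_constant mult_ac)
  finally show ?thesis .
qed

lemma card_graphs_of_coloring_le:
  assumes V: "finite V" and Q: "Q \<subseteq> Pow (cross_edges V c)"
  shows "card {G. G \<subseteq> [V]\<^bsup>2\<^esup> \<and> card (mono_edges G c) \<le> K \<and> G \<inter> cross_edges V c \<in> Q}
    \<le> (card ([V]\<^bsup>2\<^esup>) + 1) ^ K * card Q" (is "card ?S \<le> _")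
proof -
  let ?E = "[V]\<^bsup>2\<^esup>"
  let ?N = "{N. N \<subseteq> ?E \<and> card N \<le> K}"
  have fE: "finite ?E" using V by (rule finite_imp_finite_nsets)
  have fQ: "finite Q" using Q finite_cross_edges[OF V, of c] by (meson finite_Pow_iff finite_subset)
  have fN: "finite ?N" using fE by simp
  have "?S \<subseteq> (\<lambda>(N, H). N \<union> H) ` (?N \<times> Q)"
  proof
    fix G assume G: "G \<in> ?S"
    then have GE: "G \<subseteq> ?E" by blast
    have "mono_edges G c \<in> ?N" using G GE mono_edges_subset[of G c] by blast
    then have "mono_edges G c \<union> (G \<inter> cross_edges V c) \<in> (\<lambda>(N, H). N \<union> H) ` (?N \<times> Q)"
      using G by (intro image_eqI[of _ _ "(mono_edges G c, G \<inter> cross_edges V c)"]) simp_all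
    then show "G \<in> (\<lambda>(N, H). N \<union> H) ` (?N \<times> Q)" unfolding mono_cross_split[OF GE] .
  qed
  then have "card ?S \<le> card ((\<lambda>(N, H). N \<union> H) ` (?N \<times> Q))"
    by (rule card_mono[rotated]) (intro finite_imageI finite_cartesian_product fN fQ)
  also have "\<dots> \<le> card (?N \<times> Q)" by (intro card_image_le finite_cartesian_product fN fQ)
  also have "\<dots> \<le> (card ?E + 1) ^ K * card Q"
    unfolding card_cartesian_product by (intro mult_right_mono card_small_subsets_le fE) simp
  finally show ?thesis .
qed

section \<open>Almost all clique-free graphs are partite\<close>

lemma three_quarters_power_le: "(3 / 4) ^ a \<le> 2 powr (- (2 / 5) * real a)"
proof -
  have "(2 powr (- (2 / 5) :: real)) ^ 5 = (2 powr (- (2 / 5))) powr 5" by simp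
  also have "\<dots> = 2 powr (- 2)" unfolding powr_powr by simp
  also have "\<dots> = 1 / 4" by (simp add: powr_minus_divide)
  finally have "(3 / 4 :: real) ^ 5 \<le> (2 powr (- (2 / 5))) ^ 5" by (simp add: power_divide)
  then have "(3 / 4 :: real) \<le> 2 powr (- (2 / 5))"
    by (rule power_le_imp_le_base[of _ 4, simplified]) simp
  then have "(3 / 4 :: real) ^ a \<le> (2 powr (- (2 / 5))) ^ a" by (intro power_mono) auto
  also have "\<dots> = 2 powr (- (2 / 5) * real a)" by (simp add: powr_realpow[symmetric] powr_powr)
  finally show ?thesis .
qed

lemma mono_edges_restrict:
  assumes "G \<subseteq> [V]\<^bsup>2\<^esup>"
  shows "mono_edges G (restrict c V) = mono_edges G c"
proof -
  have "u \<in> V" if "e \<in> G" "u \<in> e" for e u using assms that by (auto simp: nsets_def)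
  then have "(restrict c V u = restrict c V v) = (c u = c v)" if "e \<in> G" "u \<in> e" "v \<in> e" for e u v
    using that by simp
  then show ?thesis unfolding mono_edges_def by blast
qed

lemma ex_best_coloring:
  fixes r :: nat
  assumes V: "finite V" and r: "0 < r" and G: "G \<subseteq> [V]\<^bsup>2\<^esup>"
  shows "\<exists>c\<in>V \<rightarrow>\<^sub>E {..<r}. \<forall>c'. c' ` V \<subseteq> {..<r} \<longrightarrow> card (mono_edges G c) \<le> card (mono_edges G c')"
proof -
  let ?C = "V \<rightarrow>\<^sub>E {..<r}"
  let ?f = "\<lambda>c. card (mono_edges G c)"
  have fin: "finite ?C" using V by (intro finite_PiE) auto
  have "restrict (\<lambda>_. 0) V \<in> ?C" using r by auto
  then have "?C \<noteq> {}" by (metis emptyE)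
  then have "Min (?f ` ?C) \<in> ?f ` ?C" using fin by (intro Min_in) simp_all
  then obtain c where c: "c \<in> ?C" "Min (?f ` ?C) = ?f c" by blast
  have "?f c \<le> ?f c'" if "c' ` V \<subseteq> {..<r}" for c'
  proof -
    have "restrict c' V \<in> ?C" using that by auto
    then have "Min (?f ` ?C) \<le> ?f (restrict c' V)" using fin by (intro Min_le) auto
    then show ?thesis using c(2) mono_edges_restrict[OF G, of c'] by simp
  qed
  then show ?thesis using c(1) by blast
qed

lemma partite_on_subset:
  assumes "0 < r"
  shows "partite_on V r \<subseteq> clique_free_on V (r + 1)"
proof
  fix G assume "G \<in> partite_on V r"
  then obtain c where G: "G \<subseteq> [V]\<^bsup>2\<^esup>" and c: "c ` V \<subseteq> {..<r}" "mono_edges G c = {}"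
    by (auto simp: partite_on_def)
  have "False" if S: "S \<subseteq> V" "card S = r + 1" "clique S G" for S
  proof -
    have "c ` S \<subseteq> {..<r}" using S(1) c(1) by blast
    then have "card (c ` S) \<le> r" using card_mono[of "{..<r}" "c ` S"] by simp
    then have "\<not> inj_on c S" using S(2) card_image[of c S] by auto
    then obtain u v where uv: "u \<in> S" "v \<in> S" "u \<noteq> v" "c u = c v" unfolding inj_on_def by blast
    then have "{u, v} \<in> mono_edges G c" using S(3) unfolding mono_edges_iff clique_def by blast
    then show False using c(2) by blast
  qed
  then show "G \<in> clique_free_on V (r + 1)" using G by (auto simp: clique_free_on_def cfree_def)
qed

definition balanced_colorings :: "'a set \<Rightarrow> nat \<Rightarrow> real \<Rightarrow> ('a \<Rightarrow> nat) set" where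
  "balanced_colorings V r d = {c \<in> V \<rightarrow>\<^sub>E {..<r}. \<forall>i<r. \<bar>real (card {v\<in>V. c v = i}) - real (card V) / real r\<bar> \<le> d}"

text \<open>The properties that an optimal colouring \<open>c\<close> of a rich clique-free graph has by
  \<open>rich_mono_degree\<close> and \<open>rich_mono_edge_codegree\<close>.\<close>

definition defective_graphs :: "'a set \<Rightarrow> nat \<Rightarrow> nat \<Rightarrow> nat \<Rightarrow> ('a \<Rightarrow> nat) \<Rightarrow> 'a set set set" where
  "defective_graphs V r m K c = {G. G \<subseteq> [V]\<^bsup>2\<^esup> \<and> mono_edges G c \<noteq> {} \<and> card (mono_edges G c) \<le> K \<and>
      (\<forall>v\<in>V. card {w\<in>V. c w = c v \<and> {v, w} \<in> G} \<le> m) \<and>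
      (\<forall>u v. {u, v} \<in> mono_edges G c \<longrightarrow>
         (\<exists>j<r. j \<noteq> c u \<and> card {w\<in>V. c w = j \<and> {u, w} \<in> G \<and> {v, w} \<in> G} \<le> m))}"

definition graphs_of_coloring :: "'a set \<Rightarrow> nat \<Rightarrow> ('a \<Rightarrow> nat) \<Rightarrow> 'a set set set \<Rightarrow> 'a set set set" where
  "graphs_of_coloring V K c Q = {G. G \<subseteq> [V]\<^bsup>2\<^esup> \<and> card (mono_edges G c) \<le> K \<and> G \<inter> cross_edges V c \<in> Q}"

text \<open>The last class is the essential one; the three before it collect the graphs on which the argument
  for an expensive monochromatic edge cannot be run.\<close>

lemma clique_free_cases:
  fixes d x :: real
  assumes V: "finite V" and r: "0 < r" and x: "real K = of_int \<lfloor>x\<rfloor>"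
    and big: "\<And>c i. c \<in> balanced_colorings V r d \<Longrightarrow> i < r \<Longrightarrow> m \<le> card {v\<in>V. c v = i}"
  shows "clique_free_on V (r + 1) \<subseteq> partite_on V r
    \<union> {G. G \<subseteq> [V]\<^bsup>2\<^esup> \<and> cfree V (r + 1) G \<and> (\<forall>c. c ` V \<subseteq> {..<r} \<longrightarrow> x < real (card (mono_edges G c)))}
    \<union> (\<Union>c\<in>(V \<rightarrow>\<^sub>E {..<r}) - balanced_colorings V r d. graphs_of_coloring V K c (Pow (cross_edges V c)))
    \<union> (\<Union>c\<in>V \<rightarrow>\<^sub>E {..<r}. graphs_of_coloring V K c {H. H \<subseteq> cross_edges V c \<and> \<not> rich V r m c H})
    \<union> (\<Union>c\<in>balanced_colorings V r d. defective_graphs V r m K c)"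
    (is "_ \<subseteq> _ \<union> ?A1 \<union> ?A2 \<union> ?A3 \<union> ?A4")
proof
  fix G assume "G \<in> clique_free_on V (r + 1)"
  then have G: "G \<subseteq> [V]\<^bsup>2\<^esup>" "cfree V (r + 1) G" by (auto simp: clique_free_on_def)
  obtain c where c: "c \<in> V \<rightarrow>\<^sub>E {..<r}"
    and opt: "\<And>c'. c' ` V \<subseteq> {..<r} \<Longrightarrow> card (mono_edges G c) \<le> card (mono_edges G c')"
    using ex_best_coloring[OF V r G(1)] by blast
  have cr: "c ` V \<subseteq> {..<r}" using c by auto
  let ?H = "G \<inter> cross_edges V c"
  consider "x < real (card (mono_edges G c))" | "mono_edges G c = {}"
    | "real (card (mono_edges G c)) \<le> x" "c \<notin> balanced_colorings V r d"
    | "real (card (mono_edges G c)) \<le> x" "\<not> rich V r m c ?H"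
    | "mono_edges G c \<noteq> {}" "real (card (mono_edges G c)) \<le> x" "c \<in> balanced_colorings V r d" "rich V r m c ?H"
    by linarith
  then show "G \<in> partite_on V r \<union> ?A1 \<union> ?A2 \<union> ?A3 \<union> ?A4"
  proof cases
    case 1
    then have "x < real (card (mono_edges G c'))" if "c' ` V \<subseteq> {..<r}" for c'
      using opt[OF that] by linarith
    then have "G \<in> ?A1" using G by blast
    then show ?thesis by blast
  next
    case 2
    then have "G \<in> partite_on V r" using G(1) cr unfolding partite_on_def by blast
    then show ?thesis by blast
  next
    case 3
    have "card (mono_edges G c) \<le> K" using 3(1) x by linarith
    then have "G \<in> graphs_of_coloring V K c (Pow (cross_edges V c))"
      using G(1) by (simp add: graphs_of_coloring_def)
    then have "G \<in> ?A2" using c 3(2) by blast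
    then show ?thesis by blast
  next
    case 4
    have "card (mono_edges G c) \<le> K" using 4(1) x by linarith
    then have "G \<in> graphs_of_coloring V K c {H. H \<subseteq> cross_edges V c \<and> \<not> rich V r m c H}"
      using G(1) 4(2) by (simp add: graphs_of_coloring_def)
    then have "G \<in> ?A3" using c by blast
    then show ?thesis by blast
  next
    case 5
    have K: "card (mono_edges G c) \<le> K" using 5(2) x by linarith
    have deg: "card {w\<in>V. c w = c v \<and> {v, w} \<in> G} \<le> m" if "v \<in> V" for v
      using rich_mono_degree[OF V G cr opt 5(4) that] by simp
    have cod: "\<exists>j<r. j \<noteq> c u \<and> card {w\<in>V. c w = j \<and> {u, w} \<in> G \<and> {v, w} \<in> G} \<le> m"
      if uv: "{u, v} \<in> mono_edges G c" for u v
    proof -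
      have "{u, v} \<in> [V]\<^bsup>2\<^esup>" using uv mono_edges_subset[of G c] G(1) by blast
      then have "c u < r" using cr by auto
      from rich_mono_edge_codegree[OF V G cr 5(4) uv big[OF 5(3) this]] show ?thesis
        by (meson less_imp_le)
    qed
    have "G \<in> defective_graphs V r m K c"
      unfolding defective_graphs_def using G(1) 5(1) K deg cod by blast
    then have "G \<in> ?A4" using 5(3) by blast
    then show ?thesis by blast
  qed
qed

text \<open>Colourings number at most \<open>2 powr (2 * L * N)\<close> and choices of \<open>K\<close> edges at most
  \<open>2 powr (4 * N\<^sup>2 / L ^ 15)\<close>. With \<open>m\<close> about \<open>N / L ^ 6\<close> and \<open>d = N / L ^ 3\<close> the losses \<open>m\<^sup>2 / 4\<close> of
  graphs that are not rich and \<open>d\<^sup>2 / 2\<close> of unbalanced colourings exceed this by powers of \<open>L\<close>. On the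
  other hand \<open>m\<close> is so small that the \<open>(N * r) ^ (r * r * m)\<close> colourings near a given one are
  outweighed by the cost of one monochromatic edge, which is exponential in \<open>y = N / r\<close>.\<close>

lemma card_clique_free_le_partite:
  fixes L N :: real
  assumes V: "finite V" and N: "N = real (card V)" "N = exp L" and r: "2 \<le> r" "real (r + 1) \<le> L"
    and L: "1000 \<le> L" "36 * ln L \<le> L" and n: "L ^ (121 * r) \<le> N"
  shows "real (card (clique_free_on V (r + 1))) \<le> real (card (partite_on V r)) * (1 + 4 / N)"
proof -
  define m where "m = nat \<lceil>N / L ^ 6\<rceil>"
  define K where "K = nat \<lfloor>N ^ 2 / L ^ 16\<rfloor>"
  define q where "q = nat \<lfloor>N / (10 * real r)\<rfloor>"
  define a where "a = nat \<lfloor>3 * N / (4 * real r)\<rfloor>"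
  define t where "t = (1 - 1 / real r) * N ^ 2 / 2"
  define P where "P = real (card (partite_on V r))"
  define x where "x = N / L"
  define y where "y = N / real r"
  define d where "d = N / L ^ 3"
  define e where "e j = N ^ 2 / L ^ j" for j :: nat
  define \<beta> where "\<beta> = 2 powr (- (y / 5))"
  let ?Col = "V \<rightarrow>\<^sub>E {..<r}"
  let ?E = "[V]\<^bsup>2\<^esup>"
  have L1: "1 \<le> L" "0 < L" using L by auto
  have rp: "0 < real r" "real r \<le> L" using r by auto
  have pw: "L ^ i \<le> L ^ j" if "i \<le> j" for i j using L1 that by (simp add: power_increasing)
  have N20: "L ^ 20 \<le> N" using n pw[of 20 "121 * r"] r(1) by simp
  have LN: "L \<le> N" using N20 pw[of 1 20] by simp
  have N1: "1000 \<le> N" "0 < N" using LN L by auto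
  have drop: "N / L ^ j \<le> N / L ^ i / 1000" if "i < j" for i j
  proof -
    have "L ^ i * 1000 \<le> L ^ i * L" using L by (intro mult_left_mono) auto
    also have "\<dots> = L ^ Suc i" by simp
    also have "\<dots> \<le> L ^ j" using that by (intro pw) simp
    finally have "N / L ^ j \<le> N / (L ^ i * 1000)"
      using N1 L1 by (intro divide_left_mono) auto
    then show ?thesis by simp
  qed
  have edrop: "e j \<le> e i / 1000" if "i < j" for i j
  proof -
    have "N * (N / L ^ j) \<le> N * (N / L ^ i / 1000)" using drop[OF that] N1 by (intro mult_left_mono) auto
    then show ?thesis by (simp add: e_def power2_eq_square)
  qed
  have e0: "0 \<le> e j" for j using L1 by (simp add: e_def)
  have x0: "0 < x" using N1 L1 by (simp add: x_def)
  have xy: "x \<le> y" unfolding x_def y_def using rp N1 by (intro divide_left_mono) auto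
  have yN: "y \<le> N" unfolding y_def using r(1) N1 by (simp add: divide_le_eq)
  have xL: "L ^ 19 \<le> x"
  proof -
    have "L ^ 20 = L ^ Suc 19" by simp
    then have "L ^ 20 = L ^ 19 * L" by (simp only: power_Suc2)
    then show ?thesis using N20 L1 by (simp add: x_def pos_le_divide_eq)
  qed
  have L3: "1000 * L ^ 2 \<le> L ^ 3" using L by (simp add: power2_eq_square power3_eq_cube)
  have small: "1000 * L ^ 2 \<le> x" "1000 * L \<le> x"
  proof -
    show 1: "1000 * L ^ 2 \<le> x" using L3 pw[of 3 19] xL by linarith
    have "L \<le> L ^ 2" using pw[of 1 2] by simp
    then show "1000 * L \<le> x" using 1 by linarith
  qed
  have LNe: "L * N \<le> e 19"
  proof -
    have "L ^ 20 * N \<le> N * N" using N20 N1 by (intro mult_right_mono) auto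
    moreover have "L ^ 20 = L ^ Suc 19" by simp
    then have "L ^ 20 = L * L ^ 19" by (simp only: power_Suc)
    ultimately show ?thesis using L1 by (simp add: e_def pos_le_divide_eq power2_eq_square mult_ac)
  qed
  have NLN: "1000 * N \<le> L * N" using L N1 by (intro mult_right_mono) auto
  have expN: "exp L ^ k \<le> 2 powr (2 * (L * real k))" for k
  proof -
    have "exp L ^ k = exp (L * real k)" by (simp add: exp_of_nat_mult[symmetric] mult.commute)
    also have "\<dots> \<le> 2 powr (2 * (L * real k))" using L1 by (intro exp_le_2_powr) simp
    finally show ?thesis .
  qed
  have invN: "2 powr (- (2 * L)) \<le> 1 / N"
  proof -
    have "N \<le> 2 powr (2 * L)" using expN[of 1] N(2) by simp
    then show ?thesis using N1 by (simp add: powr_minus field_simps)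
  qed
  have m1: "N / L ^ 6 \<le> real m" unfolding m_def by linarith
  have m2: "real m \<le> 2 * (N / L ^ 6)"
  proof -
    have "1 \<le> N / L ^ 6" using N20 pw[of 6 20] L1 by simp
    then show ?thesis unfolding m_def by linarith
  qed
  have msq: "e 12 \<le> real m ^ 2"
  proof -
    have "(N / L ^ 6) ^ 2 \<le> real m ^ 2" using m1 N1 L1 by (intro power_mono) auto
    then show ?thesis by (simp add: e_def power_divide power_mult[symmetric])
  qed
  have fE: "finite ?E" using V by (rule finite_imp_finite_nsets)
  have fCol: "finite ?Col" using V by (intro finite_PiE) auto
  have Kx: "real K = of_int \<lfloor>N ^ 2 / L ^ 16\<rfloor>"
  proof -
    have "0 \<le> \<lfloor>N ^ 2 / L ^ 16\<rfloor>" using L1 by simp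
    then show ?thesis unfolding K_def by simp
  qed
  then have Ke: "real K \<le> e 16" unfolding e_def by linarith
  have EK: "real ((card ?E + 1) ^ K) \<le> 2 powr (4 * e 15)"
  proof -
    have "real (card ?E) + 1 \<le> N ^ 2"
    proof -
      have "2 * 1 \<le> N * N" using N1 by (intro mult_mono) auto
      then show ?thesis using card_nsets_2_le[OF V] by (simp add: N(1) power2_eq_square)
    qed
    then have "(real (card ?E) + 1) ^ K \<le> (N ^ 2) ^ K" by (intro power_mono) auto
    also have "\<dots> = exp L ^ (2 * K)" by (simp add: N(2) power_mult)
    also have "\<dots> \<le> 2 powr (2 * (L * real (2 * K)))" by (rule expN)
    also have "\<dots> \<le> 2 powr (4 * e 15)"
    proof (rule powr_mono)
      have "L * real K \<le> L * e 16" using Ke L1 by (intro mult_left_mono) auto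
      also have "\<dots> = e 15"
      proof -
        have "L ^ 16 = L ^ Suc 15" by simp
        then have "L ^ 16 = L * L ^ 15" by (simp only: power_Suc)
        then show ?thesis using L1 by (simp add: e_def)
      qed
      finally show "2 * (L * real (2 * K)) \<le> 4 * e 15" by simp
    qed simp
    finally show ?thesis by (simp add: add.commute)
  qed
  have cCol: "real (card ?Col) \<le> 2 powr (2 * (L * N))"
  proof -
    have "real r \<le> exp L" using rp LN N(2) by linarith
    then have "real r ^ card V \<le> exp L ^ card V" by (intro power_mono) auto
    also have "\<dots> \<le> 2 powr (2 * (L * N))" using expN[of "card V"] N(1) by simp
    finally show ?thesis using V by (simp add: card_PiE)
  qed
  have crosst: "real (card (cross_edges V c)) = t - (\<Sum>i<r. (real (card {v\<in>V. c v = i}) - y) ^ 2) / 2"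
    if "c \<in> ?Col" for c
    unfolding t_def y_def N(1) using that r(1) by (intro card_cross_edges[OF V]) auto
  have cross2: "2 ^ card (cross_edges V c) = 2 powr real (card (cross_edges V c))" for c :: "'a \<Rightarrow> nat"
    by (simp add: powr_realpow)
  have crossle: "real (card (cross_edges V c)) \<le> t" if "c \<in> ?Col" for c
    using crosst[OF that] by (simp add: sum_nonneg)
  have rm: "real (r * m) \<le> x / 100"
  proof -
    have "real (r * m) \<le> L * (2 * (N / L ^ 6))" unfolding of_nat_mult using rp m2 by (intro mult_mono) auto
    also have "\<dots> = 2 * (N / L ^ 5)"
    proof -
      have "L ^ 6 = L ^ Suc 5" by simp
      then have "L ^ 6 = L * L ^ 5" by (simp only: power_Suc)
      then show ?thesis using L1 by simp
    qed
    also have "\<dots> \<le> x / 100" using drop[of 1 5] x0 by (simp add: x_def)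
    finally show ?thesis .
  qed
  have dx: "d \<le> x / 1000" using drop[of 1 3] by (simp add: d_def x_def)
  have large: "y - x / 1000 \<le> real (card {v\<in>V. c v = i})" if "c \<in> balanced_colorings V r d" "i < r" for c i
    using that dx unfolding balanced_colorings_def y_def N(1) by fastforce
  have BalCol: "c \<in> ?Col" if "c \<in> balanced_colorings V r d" for c
    using that by (simp add: balanced_colorings_def)
  have classm: "r * m < card {v\<in>V. c v = i}" if "c \<in> balanced_colorings V r d" "i < r" for c i
  proof -
    have "real (r * m) < real (card {v\<in>V. c v = i})" using large[OF that] rm xy x0 by linarith
    then show ?thesis by (simp only: of_nat_less_iff)
  qed
  have qy: "real q \<le> y / 10" "y / 10 - 1 \<le> real q"
  proof -
    have "N / (10 * real r) = y / 10" by (simp add: y_def)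
    moreover have "0 \<le> y / 10" using x0 xy by linarith
    ultimately show "real q \<le> y / 10" "y / 10 - 1 \<le> real q" unfolding q_def by linarith+
  qed
  have ay: "real a \<le> 3 / 4 * y" "3 / 4 * y - 1 \<le> real a"
  proof -
    have "3 * N / (4 * real r) = 3 / 4 * y" by (simp add: y_def)
    moreover have "0 \<le> 3 / 4 * y" using x0 xy by linarith
    ultimately show "real a \<le> 3 / 4 * y" "3 / 4 * y - 1 \<le> real a" unfolding a_def by linarith+
  qed
  have classa: "a + 2 * q \<le> card {v\<in>V. c v = i}" if "c \<in> balanced_colorings V r d" "i < r" for c i
  proof -
    have "real a + 2 * real q \<le> real (card {v\<in>V. c v = i})"
      using large[OF that] qy(1) ay(1) xy x0 by linarith
    then show ?thesis by linarith
  qed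
  have q1: "1 \<le> q"
  proof -
    have "0 < real q" using qy(2) xy small(2) L by linarith
    then show ?thesis by simp
  qed
  have notrich: "real (card {H. H \<subseteq> cross_edges V c \<and> \<not> rich V r m c H})
      \<le> 2 ^ card V * (2 powr (- (real m ^ 2 / 4)) * 2 ^ card (cross_edges V c))" if "c ` V \<subseteq> {..<r}" for c
  proof (rule card_not_rich_le[OF V that r(1) rp(2) _ L(2)])
    have "L ^ (62 * (r - 1) + 22) * L ^ 6 \<le> L ^ (121 * r)"
      unfolding power_add[symmetric] using r(1) by (intro pw) simp
    then have "L ^ (62 * (r - 1) + 22) \<le> N / L ^ 6" using n L1 by (simp add: pos_le_divide_eq)
    also have "\<dots> \<le> real m" by (rule m1)
    also have "\<dots> \<le> real (r * m)" unfolding of_nat_le_iff using r(1) by simp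
    finally show "L ^ (62 * (r - 1) + 22) \<le> real (r * m)" .
  qed (use L in simp)
  have twoN: "(2::real) ^ card V = 2 powr N" by (simp add: N(1) powr_realpow)
  have half: "2 * real (card {H. H \<subseteq> cross_edges V c \<and> \<not> rich V r m c H}) \<le> 2 ^ card (cross_edges V c)"
    if "c ` V \<subseteq> {..<r}" for c
  proof -
    have "1 + (N - real m ^ 2 / 4) \<le> 0"
      using msq LNe NLN N1 edrop[of 12 19] e0[of 19] by linarith
    then have "2 powr (1 + (N - real m ^ 2 / 4)) \<le> 2 powr 0" by (rule powr_mono) simp
    then have le1: "2 * (2 powr N * 2 powr (- (real m ^ 2 / 4))) \<le> 1"
      by (simp only: powr_add[symmetric] powr_one flip: diff_conv_add_uminus) (simp add: powr_add)
    have "2 * real (card {H. H \<subseteq> cross_edges V c \<and> \<not> rich V r m c H})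
        \<le> (2 * (2 powr N * 2 powr (- (real m ^ 2 / 4)))) * 2 ^ card (cross_edges V c)"
      using notrich[OF that] unfolding twoN by simp
    also have "\<dots> \<le> 1 * 2 ^ card (cross_edges V c)" using le1 by (rule mult_right_mono) simp
    finally show ?thesis by simp
  qed
  have P0: "2 powr (t - N / 2) \<le> P"
    unfolding P_def t_def N(1) using r(1) by (intro card_partite_ge[OF V]) simp
  have main_err: "2 powr (t - e 16 / 4) \<le> P / N"
  proof -
    have "2 powr (t - e 16 / 4) \<le> 2 powr ((t - N / 2) + (- (2 * L)))"
      using LNe NLN LN edrop[of 16 19] e0[of 19] by (intro powr_mono) auto
    also have "\<dots> = 2 powr (t - N / 2) * 2 powr (- (2 * L))" by (rule powr_add)
    also have "\<dots> \<le> P * (1 / N)" using P0 invN by (intro mult_mono) (auto simp: P_def)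
    finally show ?thesis by simp
  qed
  let ?A1 = "{G. G \<subseteq> ?E \<and> cfree V (r + 1) G \<and> (\<forall>c. c ` V \<subseteq> {..<r} \<longrightarrow> N ^ 2 / L ^ 16 < real (card (mono_edges G c)))}"
  let ?A2 = "\<Union>c\<in>?Col - balanced_colorings V r d. graphs_of_coloring V K c (Pow (cross_edges V c))"
  let ?A3 = "\<Union>c\<in>?Col. graphs_of_coloring V K c {H. H \<subseteq> cross_edges V c \<and> \<not> rich V r m c H}"
  let ?A4 = "\<Union>c\<in>balanced_colorings V r d. defective_graphs V r m K c"
  have A1: "real (card ?A1) \<le> P / N"
  proof -
    have n62: "L ^ (62 * r + 22) \<le> N" using n pw[of "62 * r + 22" "121 * r"] r(1) by simp
    have "real (card ?A1) \<le> exp (e 17) * 2 powr (t - N ^ 2 / (2 * L ^ 16))"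
      unfolding t_def e_def N(1) using r L n62[unfolded N(1)] by (intro card_far_from_partite_le[OF V]) auto
    also have "\<dots> \<le> 2 powr (2 * e 17) * 2 powr (t - N ^ 2 / (2 * L ^ 16))"
      using e0 by (intro mult_right_mono exp_le_2_powr) auto
    also have "\<dots> = 2 powr (2 * e 17 + (t - N ^ 2 / (2 * L ^ 16)))" by (rule powr_add[symmetric])
    also have "\<dots> \<le> 2 powr (t - e 16 / 4)"
    proof (rule powr_mono)
      have "N ^ 2 / (2 * L ^ 16) = e 16 / 2" by (simp add: e_def)
      then show "2 * e 17 + (t - N ^ 2 / (2 * L ^ 16)) \<le> t - e 16 / 4"
        using edrop[of 16 17] e0[of 16] by linarith
    qed simp
    finally show ?thesis using main_err by linarith
  qed
  have sumCol: "real (card (\<Union>c\<in>C. graphs_of_coloring V K c (Q c))) \<le> 2 powr (2 * (L * N)) * (2 powr (4 * e 15) * z)"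
    if C: "C \<subseteq> ?Col" and Q: "\<And>c. c \<in> C \<Longrightarrow> Q c \<subseteq> Pow (cross_edges V c)" "\<And>c. c \<in> C \<Longrightarrow> real (card (Q c)) \<le> z"
      and z: "0 \<le> z" for C Q z
  proof -
    have fC: "finite C" using C fCol by (rule finite_subset)
    have "card (\<Union>c\<in>C. graphs_of_coloring V K c (Q c)) \<le> (\<Sum>c\<in>C. card (graphs_of_coloring V K c (Q c)))"
      by (rule card_UN_le[OF fC])
    then have "real (card (\<Union>c\<in>C. graphs_of_coloring V K c (Q c))) \<le> (\<Sum>c\<in>C. real (card (graphs_of_coloring V K c (Q c))))"
      by (simp only: of_nat_sum[symmetric] of_nat_le_iff)
    also have "\<dots> \<le> (\<Sum>c\<in>C. 2 powr (4 * e 15) * z)"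
    proof (rule sum_mono)
      fix c assume c: "c \<in> C"
      have "real (card (graphs_of_coloring V K c (Q c))) \<le> real ((card ?E + 1) ^ K * card (Q c))"
        unfolding of_nat_le_iff graphs_of_coloring_def by (rule card_graphs_of_coloring_le[OF V Q(1)[OF c]])
      also have "\<dots> \<le> 2 powr (4 * e 15) * z"
        unfolding of_nat_mult using EK Q(2)[OF c] by (intro mult_mono) auto
      finally show "real (card (graphs_of_coloring V K c (Q c))) \<le> 2 powr (4 * e 15) * z" .
    qed
    also have "\<dots> = real (card C) * (2 powr (4 * e 15) * z)" by simp
    also have "\<dots> \<le> 2 powr (2 * (L * N)) * (2 powr (4 * e 15) * z)"
    proof (rule mult_right_mono)
      have "card C \<le> card ?Col" using C fCol by (rule card_mono[rotated])
      then show "real (card C) \<le> 2 powr (2 * (L * N))" using cCol by linarith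
    qed (use z in simp)
    finally show ?thesis .
  qed
  have A2: "real (card ?A2) \<le> P / N"
  proof -
    have "real (card ?A2) \<le> 2 powr (2 * (L * N)) * (2 powr (4 * e 15) * 2 powr (t - e 6 / 2))"
    proof (rule sumCol)
      fix c assume c: "c \<in> ?Col - balanced_colorings V r d"
      then obtain i where i: "i < r" "d < \<bar>real (card {v\<in>V. c v = i}) - y\<bar>"
        unfolding balanced_colorings_def y_def N(1) by (auto simp: not_le)
      have "e 6 \<le> (\<Sum>i<r. (real (card {v\<in>V. c v = i}) - y) ^ 2)"
      proof -
        have "0 \<le> d" using N1 L1 by (simp add: d_def)
        then have "d ^ 2 \<le> \<bar>real (card {v\<in>V. c v = i}) - y\<bar> ^ 2" using i(2) by (intro power_mono) auto
        moreover have "d ^ 2 = e 6" by (simp add: d_def e_def power_divide power_mult[symmetric])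
        moreover have "(real (card {v\<in>V. c v = i}) - y) ^ 2 \<le> (\<Sum>i<r. (real (card {v\<in>V. c v = i}) - y) ^ 2)"
          using i(1) by (intro member_le_sum) auto
        ultimately show ?thesis by simp
      qed
      then have "real (card (cross_edges V c)) \<le> t - e 6 / 2" using crosst[of c] c by simp
      then show "real (card (Pow (cross_edges V c))) \<le> 2 powr (t - e 6 / 2)"
        using finite_cross_edges[OF V, of c] cross2[of c] by (simp add: card_Pow)
    qed auto
    also have "\<dots> = 2 powr (2 * (L * N) + (4 * e 15 + (t - e 6 / 2)))" by (simp only: powr_add)
    also have "\<dots> \<le> 2 powr (t - e 16 / 4)"
      using LNe edrop[of 6 19] edrop[of 6 15] edrop[of 6 16] e0[of 6] by (intro powr_mono) auto
    finally show ?thesis using main_err by linarith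
  qed
  have A3: "real (card ?A3) \<le> P / N"
  proof -
    have "real (card ?A3) \<le> 2 powr (2 * (L * N)) * (2 powr (4 * e 15) * (2 powr N * (2 powr (- (real m ^ 2 / 4)) * 2 powr t)))"
    proof (rule sumCol)
      fix c assume c: "c \<in> ?Col"
      then have "c ` V \<subseteq> {..<r}" by auto
      from notrich[OF this]
      have "real (card {H. H \<subseteq> cross_edges V c \<and> \<not> rich V r m c H})
        \<le> 2 powr N * (2 powr (- (real m ^ 2 / 4)) * 2 powr real (card (cross_edges V c)))"
        unfolding twoN cross2 .
      also have "\<dots> \<le> 2 powr N * (2 powr (- (real m ^ 2 / 4)) * 2 powr t)"
        using crossle[OF c] by (intro mult_left_mono powr_mono) auto
      finally show "real (card {H. H \<subseteq> cross_edges V c \<and> \<not> rich V r m c H})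
        \<le> 2 powr N * (2 powr (- (real m ^ 2 / 4)) * 2 powr t)" .
    qed auto
    also have "\<dots> = 2 powr (2 * (L * N) + (4 * e 15 + (N + (- (real m ^ 2 / 4) + t))))" by (simp only: powr_add)
    also have "\<dots> \<le> 2 powr (t - e 16 / 4)"
    proof (rule powr_mono)
      show "2 * (L * N) + (4 * e 15 + (N + (- (real m ^ 2 / 4) + t))) \<le> t - e 16 / 4"
        using LNe NLN N1 msq edrop[of 12 19] edrop[of 12 15] edrop[of 12 16] e0[of 12] by linarith
    qed simp
    finally show ?thesis using main_err by linarith
  qed
  \<comment> \<open>The price of one matching edge: its ends, the class in which they have few common neighbours
    and the exceptional vertices there, against the factor \<open>3 / 4\<close> for each of \<open>a\<close> vertices. In \<open>b1\<close>
    also the monochromatic edges at its ends are chosen.\<close>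
  define B where "B = real ((card V + 1) ^ m)"
  define b1 where "b1 = real (card V * card V * r) * B ^ 2 * (B * (3 / 4) ^ a)"
  define b2 where "b2 = real (card V * card V * r) * (B * (3 / 4) ^ a)"
  have B1: "1 \<le> B" unfolding B_def by simp
  have B: "B \<le> exp L ^ (2 * m)"
  proof -
    have "real (card V + 1) \<le> N ^ 2"
    proof -
      have "N * 2 \<le> N * N" using N1 by (intro mult_left_mono) auto
      then have "N + 1 \<le> N * N" using N1 by linarith
      then show ?thesis by (simp add: N(1) power2_eq_square)
    qed
    then have "real (card V + 1) ^ m \<le> (N ^ 2) ^ m" by (intro power_mono) auto
    then show ?thesis unfolding B_def by (simp add: N(2) power_mult)
  qed
  have b1\<beta>: "b1 \<le> \<beta>"
  proof -
    have "real (card V * card V * r) \<le> exp L ^ 3"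
      using rp LN by (simp add: N(1)[symmetric] N(2)[symmetric] power3_eq_cube mult_mono)
    then have "b1 \<le> exp L ^ 3 * (exp L ^ (2 * m)) ^ 2 * (exp L ^ (2 * m) * 2 powr (- (2 / 5) * real a))"
      unfolding b1_def using B B1 three_quarters_power_le[of a] by (intro mult_mono power_mono) auto
    also have "\<dots> = exp L ^ (3 + 6 * m) * 2 powr (- (2 / 5) * real a)"
    proof -
      have "3 + 2 * m * 2 + 2 * m = 3 + 6 * m" by simp
      then show ?thesis by (simp only: power_add[symmetric] power_mult[symmetric] mult.assoc[symmetric])
    qed
    also have "\<dots> \<le> 2 powr (2 * (L * real (3 + 6 * m))) * 2 powr (- (2 / 5) * real a)"
      by (intro mult_right_mono expN) simp
    also have "\<dots> = 2 powr (2 * (L * real (3 + 6 * m)) + - (2 / 5) * real a)" by (rule powr_add[symmetric])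
    also have "\<dots> \<le> \<beta>"
      unfolding \<beta>_def
    proof (rule powr_mono)
      have "L * real m \<le> L * (2 * (N / L ^ 6))" using m2 L1 by (intro mult_left_mono) auto
      also have "\<dots> = 2 * (N / L ^ 5)"
      proof -
        have "L ^ 6 = L ^ Suc 5" by simp
        then have "L ^ 6 = L * L ^ 5" by (simp only: power_Suc)
        then show ?thesis using L1 by simp
      qed
      also have "\<dots> \<le> 2 * (x / 1000)" using drop[of 1 5] by (simp add: x_def)
      finally have "L * real m \<le> x / 500" by simp
      moreover have "2 * (L * real (3 + 6 * m)) = 6 * L + 12 * (L * real m)" by (simp add: algebra_simps)
      ultimately show "2 * (L * real (3 + 6 * m)) + - (2 / 5) * real a \<le> - (y / 5)"
        using small(2) ay(2) xy x0 L by linarith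
    qed simp
    finally show ?thesis .
  qed
  have b0: "0 \<le> b2" "b2 \<le> b1"
  proof -
    show 1: "0 \<le> b2" using B1 by (simp add: b2_def)
    have "b1 = B ^ 2 * b2" by (simp add: b1_def b2_def)
    moreover have "1 * b2 \<le> B ^ 2 * b2" using B1 1 by (intro mult_right_mono one_le_power) auto
    ultimately show "b2 \<le> b1" by simp
  qed
  have \<beta>: "0 < \<beta>" "\<beta> \<le> 1"
  proof -
    have "- (y / 5) \<le> 0" using xy x0 by simp
    then have "2 powr (- (y / 5)) \<le> 2 powr 0" by (rule powr_mono) simp
    then show "0 < \<beta>" "\<beta> \<le> 1" by (simp_all add: \<beta>_def)
  qed
  have def1: "real (card (defective_graphs V r m K c)) \<le> 2 ^ card (cross_edges V c) * ((N + 1) * \<beta>)"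
    if c: "c \<in> balanced_colorings V r d" for c
  proof -
    have "real (card (defective_graphs V r m K c)) \<le> 2 ^ card (cross_edges V c) *
      ((\<Sum>s=1..q. (real (card V * card V * r) * real ((card V + 1) ^ m) ^ 2 * (real ((card V + 1) ^ m) * (3 / 4) ^ a)) ^ s)
       + (real (card V * card V * r) * (real ((card V + 1) ^ m) * (3 / 4) ^ a)) ^ q * real (card ?E + 1) ^ K)"
      unfolding defective_graphs_def
    proof (rule card_defective_graphs_le[OF V _ q1])
      show "c ` V \<subseteq> {..<r}" using BalCol[OF c] by auto
      show "a + 2 * q \<le> card {v\<in>V. c v = j}" if "j < r" for j using classa[OF c that] .
    qed
    also have "\<dots> = 2 ^ card (cross_edges V c) * ((\<Sum>s=1..q. b1 ^ s) + b2 ^ q * real ((card ?E + 1) ^ K))"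
      by (simp add: b1_def b2_def B_def)
    also have "\<dots> \<le> 2 ^ card (cross_edges V c) * (N * \<beta> + \<beta>)"
    proof (intro mult_left_mono add_mono)
      have "(\<Sum>s=1..q. b1 ^ s) \<le> (\<Sum>s=1..q. \<beta>)"
      proof (rule sum_mono)
        fix s assume "s \<in> {1..q}"
        then have "b1 ^ s \<le> b1 ^ 1" using b0 b1\<beta> \<beta> by (intro power_decreasing) auto
        then show "b1 ^ s \<le> \<beta>" using b1\<beta> by simp
      qed
      also have "\<dots> = real q * \<beta>" by simp
      also have "\<dots> \<le> N * \<beta>" using qy(1) yN x0 xy \<beta> by (intro mult_right_mono) auto
      finally show "(\<Sum>s=1..q. b1 ^ s) \<le> N * \<beta>" .
      have "b2 ^ q * real ((card ?E + 1) ^ K) \<le> \<beta> ^ q * 2 powr (4 * e 15)"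
        using b0 b1\<beta> \<beta> EK by (intro mult_mono power_mono) auto
      also have "\<beta> ^ q = 2 powr (- (y / 5) * real q)"
        by (simp add: \<beta>_def powr_realpow[symmetric] powr_powr)
      also have "\<dots> * 2 powr (4 * e 15) = 2 powr (- (y / 5) * real q + 4 * e 15)" by (rule powr_add[symmetric])
      also have "\<dots> \<le> \<beta>"
        unfolding \<beta>_def
      proof (rule powr_mono)
        have "x / 5 * (x / 20) \<le> y / 5 * (real q - 1)"
          using xy x0 qy(2) small(2) L by (intro mult_mono) auto
        moreover have "x / 5 * (x / 20) = e 2 / 100" by (simp add: x_def e_def power2_eq_square)
        moreover have "4 * e 15 \<le> e 2 / 100" using edrop[of 2 15] e0[of 2] by simp
        moreover have "y / 5 * (real q - 1) = y / 5 * real q - y / 5" by (simp only: right_diff_distrib mult_1_right)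
        moreover have "- (y / 5) * real q = - (y / 5 * real q)" by (rule mult_minus_left)
        ultimately show "- (y / 5) * real q + 4 * e 15 \<le> - (y / 5)" by linarith
      qed simp
      finally show "b2 ^ q * real ((card ?E + 1) ^ K) \<le> \<beta>" .
    qed auto
    finally show ?thesis by (simp add: algebra_simps)
  qed
  have Vne: "V \<noteq> {}" using N1 N(1) by auto
  define R where "R = real (r ^ r * (card V * r) ^ (r * r * m))"
  have A4: "real (card ?A4) \<le> P / N"
  proof -
    have fB: "finite (balanced_colorings V r d)"
      using fCol by (rule rev_finite_subset) (auto simp: balanced_colorings_def)
    have "card ?A4 \<le> (\<Sum>c\<in>balanced_colorings V r d. card (defective_graphs V r m K c))"
      by (rule card_UN_le[OF fB])
    then have "real (card ?A4) \<le> (\<Sum>c\<in>balanced_colorings V r d. real (card (defective_graphs V r m K c)))"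
      by (simp only: of_nat_sum[symmetric] of_nat_le_iff)
    also have "\<dots> \<le> (\<Sum>c\<in>balanced_colorings V r d. 2 ^ card (cross_edges V c) * ((N + 1) * \<beta>))"
      using def1 by (rule sum_mono)
    also have "\<dots> = (\<Sum>c\<in>balanced_colorings V r d. 2 ^ card (cross_edges V c)) * ((N + 1) * \<beta>)"
      by (rule sum_distrib_right[symmetric])
    also have "\<dots> \<le> (2 * R * P) * ((N + 1) * \<beta>)"
    proof (rule mult_right_mono)
      let ?B = "{c \<in> ?Col. \<forall>i<r. r * m < card {v\<in>V. c v = i}}"
      have "(\<Sum>c\<in>balanced_colorings V r d. (2::real) ^ card (cross_edges V c)) \<le> (\<Sum>c\<in>?B. 2 ^ card (cross_edges V c))"
        using fCol classm BalCol by (intro sum_mono2) auto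
      also have "\<dots> \<le> 2 * R * P"
        unfolding R_def P_def by (rule sum_balanced_colorings_le[OF V Vne half])
      finally show "(\<Sum>c\<in>balanced_colorings V r d. 2 ^ card (cross_edges V c)) \<le> 2 * R * P" .
    qed (use \<beta> N1 in auto)
    also have "\<dots> \<le> P * 2 powr (- (2 * L))"
    proof -
      have "R \<le> exp L ^ r * (exp L ^ 2) ^ (r * r * m)"
      proof -
        have rN: "real r \<le> exp L" using rp LN N(2) by linarith
        then have "real (card V * r) \<le> exp L ^ 2"
          unfolding of_nat_mult power2_eq_square using N by (intro mult_mono) auto
        then show ?thesis
          unfolding R_def of_nat_mult of_nat_power using rN by (intro mult_mono power_mono) auto
      qed
      also have "\<dots> = exp L ^ (r + 2 * (r * r * m))" by (simp add: power_add power_mult)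
      also have "\<dots> \<le> 2 powr (2 * (L * real (r + 2 * (r * r * m))))" by (rule expN)
      also have "\<dots> \<le> 2 powr (2 * L ^ 2 + x / 100)"
      proof (rule powr_mono)
        have "L * real (r + 2 * (r * r * m)) = L * real r + 2 * (L * (real r * real r)) * real m"
          by (simp add: algebra_simps)
        also have "\<dots> \<le> L * L + 2 * (L * (L * L)) * (2 * (N / L ^ 6))"
          using rp m2 L1 by (intro add_mono mult_mono) auto
        also have "\<dots> = L ^ 2 + 4 * (N / L ^ 3)"
        proof -
          have "L ^ 6 = L ^ (3 + 3)" by simp
          then have "L ^ 6 = (L * (L * L)) * L ^ 3" by (simp only: power_add power3_eq_cube mult.assoc)
          then show ?thesis using L1 by (simp add: power2_eq_square)
        qed
        also have "\<dots> \<le> L ^ 2 + x / 200" using dx x0 unfolding d_def by linarith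
        finally show "2 * (L * real (r + 2 * (r * r * m))) \<le> 2 * L ^ 2 + x / 100" by linarith
      qed simp
      finally have R: "R \<le> 2 powr (2 * L ^ 2 + x / 100)" .
      have N2: "2 * (N + 1) \<le> 2 powr (4 * L)"
      proof -
        have "2 * (N + 1) \<le> N * N"
        proof -
          have "2 * (N + 1) \<le> N * 1000" using N1 by simp
          also have "\<dots> \<le> N * N" using N1 by (intro mult_left_mono) auto
          finally show ?thesis .
        qed
        also have "\<dots> = exp L ^ 2" by (simp add: N(2) power2_eq_square)
        also have "\<dots> \<le> 2 powr (4 * L)" using expN[of 2] by simp
        finally show ?thesis .
      qed
      have "(2 * R * P) * ((N + 1) * \<beta>) = P * (R * ((2 * (N + 1)) * \<beta>))" by (simp only: mult_ac)
      also have "\<dots> \<le> P * (2 powr (2 * L ^ 2 + x / 100) * (2 powr (4 * L) * 2 powr (- (y / 5))))"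
        using R N2 N1 unfolding \<beta>_def by (intro mult_left_mono mult_mono) (auto simp: P_def)
      also have "\<dots> = P * 2 powr (2 * L ^ 2 + x / 100 + (4 * L + - (y / 5)))"
        by (simp only: powr_add)
      also have "\<dots> \<le> P * 2 powr (- (2 * L))"
        using small xy x0 L by (intro mult_left_mono powr_mono) (auto simp: P_def)
      finally show ?thesis .
    qed
    also have "\<dots> \<le> P * (1 / N)" using invN by (intro mult_left_mono) (auto simp: P_def)
    finally show ?thesis by simp
  qed
  have "clique_free_on V (r + 1) \<subseteq> partite_on V r \<union> ?A1 \<union> ?A2 \<union> ?A3 \<union> ?A4"
  proof (rule clique_free_cases[OF V _ Kx])
    show "m \<le> card {v\<in>V. c v = i}" if "c \<in> balanced_colorings V r d" "i < r" for c i
    proof -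
      have "m \<le> r * m" using r(1) by simp
      then show ?thesis using classm[OF that] by linarith
    qed
  qed (use r in simp)
  moreover have "partite_on V r \<union> ?A1 \<union> ?A2 \<union> ?A3 \<union> ?A4 \<subseteq> Pow ?E"
    unfolding partite_on_def graphs_of_coloring_def defective_graphs_def by blast
  then have "finite (partite_on V r \<union> ?A1 \<union> ?A2 \<union> ?A3 \<union> ?A4)"
    using fE by (meson finite_Pow_iff finite_subset)
  ultimately have "card (clique_free_on V (r + 1)) \<le> card (partite_on V r \<union> ?A1 \<union> ?A2 \<union> ?A3 \<union> ?A4)"
    by (rule card_mono[rotated])
  also have "\<dots> \<le> card (partite_on V r) + card ?A1 + card ?A2 + card ?A3 + card ?A4"
    by (intro order_trans[OF card_Un_le] add_right_mono) simp
  finally have "real (card (clique_free_on V (r + 1))) \<le> P + real (card ?A1) + real (card ?A2) + real (card ?A3) + real (card ?A4)"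
    unfolding P_def by (simp only: of_nat_add[symmetric] of_nat_le_iff)
  also have "\<dots> \<le> P + P / N + P / N + P / N + P / N"
    using A1 A2 A3 A4 by (intro add_mono) auto
  also have "\<dots> = P * (1 + 4 / N)" by (simp add: algebra_simps)
  finally show ?thesis unfolding P_def .
qed

lemma clique_free_graphs_eq: "clique_free_graphs n k = clique_free_on {1..n} k"
  by (simp add: clique_free_graphs_def clique_free_on_def complete_edges_def clique_free_def cfree_def)

lemma partite_graphs_eq: "partite_graphs n k = partite_on {1..n} k"
proof -
  have iff: "(\<forall>u\<in>{1..n}. \<forall>v\<in>{1..n}. {u, v} \<in> E \<longrightarrow> c u \<noteq> c v) \<longleftrightarrow> mono_edges E c = {}"
    if E: "E \<subseteq> [{1..n}]\<^bsup>2\<^esup>" for E and c :: "nat \<Rightarrow> nat"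
  proof
    assume *: "\<forall>u\<in>{1..n}. \<forall>v\<in>{1..n}. {u, v} \<in> E \<longrightarrow> c u \<noteq> c v"
    have "False" if e: "e \<in> mono_edges E c" for e
    proof -
      have eE: "e \<in> E" using e mono_edges_subset by blast
      then have "e \<in> [{1..n}]\<^bsup>2\<^esup>" using E by blast
      then obtain u v where uv: "e = {u, v}" "u \<in> {1..n}" "v \<in> {1..n}" by (elim nsets2_E)
      then have "c u = c v" using mono_edges_eq[OF e] by simp
      then show False using * uv eE by blast
    qed
    then show "mono_edges E c = {}" by blast
  next
    assume *: "mono_edges E c = {}"
    show "\<forall>u\<in>{1..n}. \<forall>v\<in>{1..n}. {u, v} \<in> E \<longrightarrow> c u \<noteq> c v"
    proof (intro ballI impI notI)
      fix u v assume "{u, v} \<in> E" "c u = c v"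
      then have "{u, v} \<in> mono_edges E c" by simp
      then show False using * by blast
    qed
  qed
  show ?thesis
    unfolding partite_graphs_def partite_on_def partite_def complete_edges_def
    by (intro Collect_cong conj_cong refl arg_cong[where f = Ex] ext iff)
qed

theorem theorem1p2:
  fixes r :: "nat \<Rightarrow> nat"
  assumes "\<forall>\<^sub>F n in sequentially.
    2 \<le> r n \<and> real (r n) \<le> ln (real n) / (121 * ln (ln (real n)))"
  shows "(\<lambda>n. real (card (partite_graphs n (r n))) /
              real (card (clique_free_graphs n (r n + 1)))) \<longlonglongrightarrow> 1"
proof -
  let ?f = "\<lambda>n. real (card (partite_graphs n (r n))) / real (card (clique_free_graphs n (r n + 1)))"
  have lim: "filterlim (\<lambda>n. ln (real n)) at_top sequentially"
    by (rule filterlim_compose[OF ln_at_top filterlim_real_sequentially])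
  have ev1: "\<forall>\<^sub>F n in sequentially. 1000 \<le> ln (real n)"
    using lim by (simp add: filterlim_at_top)
  have "\<forall>\<^sub>F x :: real in at_top. ln x / x < 1 / 36"
    using order_tendstoD(2)[OF ln_x_over_x_tendsto_0, of "1 / 36"] by simp
  then have ev2: "\<forall>\<^sub>F n in sequentially. ln (ln (real n)) / ln (real n) < 1 / 36"
    using lim by (rule eventually_compose_filterlim)
  have "\<forall>\<^sub>F n in sequentially. 1 / (1 + 4 / real n) \<le> ?f n \<and> ?f n \<le> 1"
    using assms ev1 ev2
  proof eventually_elim
    case (elim n)
    define L where "L = ln (real n)"
    have L: "1000 \<le> L" using elim(2) by (simp add: L_def)
    have n: "0 < n" using L by (cases n) (simp_all add: L_def)
    have nL: "real n = exp L" using n by (simp add: L_def)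
    have L36: "36 * ln L \<le> L" using elim(3) L by (simp add: L_def[symmetric] field_simps)
    have lnL: "1 \<le> ln L" using L exp_le by (subst ln_ge_iff) auto
    have "real (r n) * (121 * ln L) \<le> L"
      using elim(1) lnL by (simp add: L_def[symmetric] pos_le_divide_eq)
    then have rL: "121 * real (r n) * ln L \<le> L" by (simp add: mult_ac)
    have "121 * real (r n) * 1 \<le> 121 * real (r n) * ln L" using lnL by (intro mult_left_mono) auto
    then have r1: "real (r n + 1) \<le> L" using rL L by simp
    have "L ^ (121 * r n) = exp (ln L) ^ (121 * r n)" using L by simp
    also have "\<dots> = exp (real (121 * r n) * ln L)" by (simp only: exp_of_nat_mult)
    also have "\<dots> = exp (121 * real (r n) * ln L)" by simp
    also have "\<dots> \<le> real n" unfolding nL using rL by simp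
    finally have Ln: "L ^ (121 * r n) \<le> real n" .
    have "real (card (clique_free_on {1..n} (r n + 1))) \<le> real (card (partite_on {1..n} (r n))) * (1 + 4 / real n)"
      using nL elim(1) r1 L L36 Ln by (intro card_clique_free_le_partite) auto
    then have le: "real (card (clique_free_graphs n (r n + 1))) \<le> real (card (partite_graphs n (r n))) * (1 + 4 / real n)"
      by (simp only: clique_free_graphs_eq partite_graphs_eq)
    have "card (partite_on {1..n} (r n)) \<le> card (clique_free_on {1..n} (r n + 1))"
      using elim(1) by (intro card_mono partite_on_subset) (auto simp: clique_free_on_def finite_imp_finite_nsets)
    then have ge: "card (partite_graphs n (r n)) \<le> card (clique_free_graphs n (r n + 1))"
      by (simp only: clique_free_graphs_eq partite_graphs_eq)
    have "0 < real (card (partite_on {1..n} (r n)))"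
      using card_partite_ge[of "{1..n}" "r n"] elim(1) by (smt (verit) finite_atLeastAtMost powr_gt_zero zero_less_numeral less_le_trans)
    then have pos: "0 < real (card (partite_graphs n (r n)))" by (simp only: partite_graphs_eq)
    show ?case
      using le ge pos n by (simp add: field_simps)
  qed
  then have ev: "\<forall>\<^sub>F n in sequentially. 1 / (1 + 4 / real n) \<le> ?f n" "\<forall>\<^sub>F n in sequentially. ?f n \<le> 1"
    by (auto elim: eventually_mono)
  have "(\<lambda>n. 1 / (1 + 4 / real n)) \<longlonglongrightarrow> 1 / (1 + 0)"
    by (intro tendsto_intros lim_const_over_n) auto
  then show ?thesis using tendsto_sandwich[OF ev _ tendsto_const] by simp
qed

end
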